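(* Let $k>0$ be an integer. For the affine Grassmannian of the supergroup $GL_{1|1}$, the Schubert varieties with cocharacter $\lambda=(k|0)$ or $\lambda=(0|k)$ are parametrized by the points of the super projective space $\mathbb{P}^{0|k}$, i.e. $$Gr^{(0|k)}_{GL_{1|1}} \cong Gr^{(k|0)}_{GL_{1|1}} \cong \mathbb{P}^{0|k}.$$
   Context: A superalgebra $R=R_0\oplus R_1$ here is an associative, unital, supercommutative ($ab=(-1)^{|a||b|}ba$ for homogeneous $a,b$) $\mathbb{Z}_2$-graded algebra over $\mathbb{C}$. $G=GL_{1|1}$ is the functor sending $R$ to the group of supermatrices $\left(\begin{array}{c|c} x & \kappa\\ \hline \kappa' & x'\end{array}\right)$ with $x,x'\in R_0^*$ and $\kappa,\kappa'\in R_1$. Put $R\llbracket t\rrbracket=R_0\llbracket t\rrbracket\oplus R_1\llbracket t\rrbracket$ and $R((t))=R_0((t))\oplus R_1((t))$ with $t$ even; $G\llbracket t\rrbracket$ and $G((t))$ denote the functors $R\mapsto G(R\llbracket t\rrbracket)$ and $R\mapsto G(R((t)))$. The affine Grassmannian is $Gr_G=G((t))/G\llbracket t\rrbracket$ (quotient by right multiplication), with left action of $G\llbracket t\rrbracket$. For $\lambda=(\lambda_1|\lambda_{\hat 1})\in\mathbb{Z}\times\mathbb{Z}$, $t^\lambda=\operatorname{diag}(t^{\lambda_1},t^{\lambda_{\hat1}})$, and the Schubert variety $Gr_G^\lambda$ is the $G\llbracket t\rrbracket$-orbit of $[t^\lambda]$, identified with $G\llbracket t\rrbracket/\bigl(G\llbracket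 t\rrbracket\cap t^\lambda G\llbracket t\rrbracket t^{-\lambda}\bigr)$. $\mathbb{P}^{p|q}$ denotes the super projective space of superdimension $p|q$, whose $R$-points are the direct summands of rank $1|0$ of $R^{p+1|q}$; $\mathbb{P}^{0|k}$ is thus the super projective space of superdimension $0|k$. *)

theory Defs
  imports Complex_Main "HOL-Library.Z2" "HOL-Algebra.Algebra"
begin

section \<open>Superalgebras over the complex numbers\<close>

definition complex_ring :: "complex ring" where
  "complex_ring = \<lparr>carrier = UNIV, monoid.mult = (*), one = 1, ring.zero = 0, add = (+)\<rparr>"

text \<open>A \<open>\<int>\<^sub>2\<close>-graded module with scalars in \<open>'r\<close>; the parities are the elements of the type
  \<^typ>\<open>bit\<close>. As for \<^locale>\<open>module\<close>, the fields inherited from rings matter only when the module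
  is an algebra.\<close>

record ('r, 'm) graded_module = "('r, 'm) module" +
  homog :: "bit \<Rightarrow> 'm set"

type_synonym 'a superalgebra = "(complex, 'a) graded_module"

locale superalgebra = ring R + module complex_ring R
  for R :: "'a superalgebra" (structure) +
  assumes smult_mult_left: "x \<in> carrier R \<Longrightarrow> y \<in> carrier R \<Longrightarrow> (c \<odot> x) \<otimes> y = c \<odot> (x \<otimes> y)"
    and smult_mult_right: "x \<in> carrier R \<Longrightarrow> y \<in> carrier R \<Longrightarrow> x \<otimes> (c \<odot> y) = c \<odot> (x \<otimes> y)"
    and homog_submodule: "submodule (homog R i) complex_ring R"
    and homog_decomp:
      "x \<in> carrier R \<Longrightarrow> \<exists>!p. p \<in> homog R 0 \<times> homog R 1 \<and> x = fst p \<oplus> snd p"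
    and one_even: "\<one> \<in> homog R 0"
    and homog_mult: "x \<in> homog R i \<Longrightarrow> y \<in> homog R j \<Longrightarrow> x \<otimes> y \<in> homog R (i + j)"
    and supercommutative: "x \<in> homog R i \<Longrightarrow> y \<in> homog R j \<Longrightarrow>
      x \<otimes> y = (if i = 1 \<and> j = 1 then \<ominus> (y \<otimes> x) else y \<otimes> x)"

definition even_part :: "'a superalgebra \<Rightarrow> 'a superalgebra" where
  "even_part R = R\<lparr>carrier := homog R 0\<rparr>"

definition superalgebra_hom :: "'a superalgebra \<Rightarrow> 'b superalgebra \<Rightarrow> ('a \<Rightarrow> 'b) set" where
  "superalgebra_hom R S = {\<phi> \<in> ring_hom R S.
     (\<forall>c. \<forall>x \<in> carrier R. \<phi> (c \<odot>\<^bsub>R\<^esub> x) = c \<odot>\<^bsub>S\<^esub> \<phi> x) \<and>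
     (\<forall>i. \<phi> ` homog R i \<subseteq> homog S i)}"


section \<open>Functors of points\<close>

text \<open>Set-valued functors on the category of superalgebras whose carriers are sets of elements
  of \<open>'a\<close>; the type \<open>'a\<close> plays the role of a universe.\<close>

record ('a, 'x) point_functor =
  pts :: "'a superalgebra \<Rightarrow> 'x set"
  pts_map :: "'a superalgebra \<Rightarrow> 'a superalgebra \<Rightarrow> ('a \<Rightarrow> 'a) \<Rightarrow> 'x \<Rightarrow> 'x"

locale point_functor =
  fixes F :: "('a, 'x) point_functor"
  assumes map_closed: "superalgebra R \<Longrightarrow> superalgebra S \<Longrightarrow> \<phi> \<in> superalgebra_hom R S \<Longrightarrow>
      x \<in> pts F R \<Longrightarrow> pts_map F R S \<phi> x \<in> pts F S"
    and map_id: "superalgebra R \<Longrightarrow> x \<in> pts F R \<Longrightarrow> pts_map F R R (\<lambda>a. a) x = x"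
    and map_comp: "superalgebra R \<Longrightarrow> superalgebra S \<Longrightarrow> superalgebra T \<Longrightarrow>
      \<phi> \<in> superalgebra_hom R S \<Longrightarrow> \<psi> \<in> superalgebra_hom S T \<Longrightarrow> x \<in> pts F R \<Longrightarrow>
      pts_map F R T (\<psi> \<circ> \<phi>) x = pts_map F S T \<psi> (pts_map F R S \<phi> x)"

definition naturally_isomorphic ::
    "('a, 'x) point_functor \<Rightarrow> ('a, 'y) point_functor \<Rightarrow> bool" (infix \<open>\<cong>\<^sub>F\<close> 50) where
  "F \<cong>\<^sub>F F' \<longleftrightarrow> point_functor F \<and> point_functor F' \<and>
     (\<exists>\<eta>. (\<forall>R. superalgebra R \<longrightarrow> bij_betw (\<eta> R) (pts F R) (pts F' R)) \<and>
          (\<forall>R S \<phi>. superalgebra R \<and> superalgebra S \<and> \<phi> \<in> superalgebra_hom R S \<longrightarrow>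
             (\<forall>x \<in> pts F R. \<eta> S (pts_map F R S \<phi> x) = pts_map F' R S \<phi> (\<eta> R x))))"


section \<open>Laurent series and power series\<close>

text \<open>The series \<open>\<Sum>n. f n t\<^sup>n\<close> is represented by its coefficient function on the integers, and
  power series are the Laurent series without terms of negative degree. The index set in the
  convolution product is finite, so \<^const>\<open>finsum\<close> is a genuine sum.\<close>

definition laurent :: "'a superalgebra \<Rightarrow> (int \<Rightarrow> 'a) superalgebra" where
  "laurent R =
    (let A = {f. (\<forall>n. f n \<in> carrier R) \<and> (\<exists>N. \<forall>n<N. f n = \<zero>\<^bsub>R\<^esub>)} in
     \<lparr>carrier = A,
      monoid.mult = (\<lambda>f g n. \<Oplus>\<^bsub>R\<^esub>i \<in> {i. f i \<noteq> \<zero>\<^bsub>R\<^esub> \<and> g (n - i) \<noteq> \<zero>\<^bsub>R\<^esub>}. f i \<otimes>\<^bsub>R\<^esub> g (n - i)),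
      one = (\<lambda>n. if n = 0 then \<one>\<^bsub>R\<^esub> else \<zero>\<^bsub>R\<^esub>),
      ring.zero = (\<lambda>n. \<zero>\<^bsub>R\<^esub>),
      add = (\<lambda>f g n. f n \<oplus>\<^bsub>R\<^esub> g n),
      smult = (\<lambda>c f n. c \<odot>\<^bsub>R\<^esub> f n),
      homog = (\<lambda>p. {f \<in> A. \<forall>n. f n \<in> homog R p})\<rparr>)"

definition powser :: "'a superalgebra \<Rightarrow> (int \<Rightarrow> 'a) superalgebra" where
  "powser R =
    (let B = {f. \<forall>n<0. f n = \<zero>\<^bsub>R\<^esub>} in
     (laurent R)\<lparr>carrier := carrier (laurent R) \<inter> B,
                 homog := (\<lambda>p. homog (laurent R) p \<inter> B)\<rparr>)"

definition t_power :: "'a superalgebra \<Rightarrow> int \<Rightarrow> int \<Rightarrow> 'a" where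
  "t_power R a = (\<lambda>n. if n = a then \<one>\<^bsub>R\<^esub> else \<zero>\<^bsub>R\<^esub>)"


section \<open>The supergroup \<open>GL\<^bsub>1|1\<^esub>\<close>, its affine Grassmannian and Schubert varieties\<close>

text \<open>\<open>Supermatrix x \<kappa> \<kappa>' x'\<close> has first row \<open>(x, \<kappa>)\<close> and second row \<open>(\<kappa>', x')\<close>.\<close>

datatype 'a supermatrix = Supermatrix 'a 'a 'a 'a

fun supermatrix_mult :: "'a superalgebra \<Rightarrow> 'a supermatrix \<Rightarrow> 'a supermatrix \<Rightarrow> 'a supermatrix" where
  "supermatrix_mult R (Supermatrix a b c d) (Supermatrix a' b' c' d') =
     Supermatrix (a \<otimes>\<^bsub>R\<^esub> a' \<oplus>\<^bsub>R\<^esub> b \<otimes>\<^bsub>R\<^esub> c') (a \<otimes>\<^bsub>R\<^esub> b' \<oplus>\<^bsub>R\<^esub> b \<otimes>\<^bsub>R\<^esub> d')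
                 (c \<otimes>\<^bsub>R\<^esub> a' \<oplus>\<^bsub>R\<^esub> d \<otimes>\<^bsub>R\<^esub> c') (c \<otimes>\<^bsub>R\<^esub> b' \<oplus>\<^bsub>R\<^esub> d \<otimes>\<^bsub>R\<^esub> d')"

definition GL11 :: "'a superalgebra \<Rightarrow> 'a supermatrix monoid" where
  "GL11 R =
    \<lparr>carrier = {Supermatrix x \<kappa> \<kappa>' x' | x \<kappa> \<kappa>' x'.
       x \<in> Units (even_part R) \<and> x' \<in> Units (even_part R) \<and> \<kappa> \<in> homog R 1 \<and> \<kappa>' \<in> homog R 1},
     monoid.mult = supermatrix_mult R,
     one = Supermatrix \<one>\<^bsub>R\<^esub> \<zero>\<^bsub>R\<^esub> \<zero>\<^bsub>R\<^esub> \<one>\<^bsub>R\<^esub>\<rparr>"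

text \<open>A homomorphism \<open>\<phi>\<close> sends a coset \<open>C = g G(R\<lbrakk>t\<rbrakk>)\<close> to \<open>\<phi>(C) G(S\<lbrakk>t\<rbrakk>) = \<phi>(g) G(S\<lbrakk>t\<rbrakk>)\<close>.\<close>

definition affine_Grassmannian :: "('a, (int \<Rightarrow> 'a) supermatrix set) point_functor" where
  "affine_Grassmannian =
    \<lparr>pts = (\<lambda>R. lcosets\<^bsub>GL11 (laurent R)\<^esub> carrier (GL11 (powser R))),
     pts_map = (\<lambda>R S \<phi> C.
       (map_supermatrix (\<lambda>f. \<phi> \<circ> f) ` C) <#>\<^bsub>GL11 (laurent S)\<^esub> carrier (GL11 (powser S)))\<rparr>"

definition t_cochar :: "'a superalgebra \<Rightarrow> int \<times> int \<Rightarrow> (int \<Rightarrow> 'a) supermatrix" where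
  "t_cochar R l =
     Supermatrix (t_power R (fst l)) \<zero>\<^bsub>laurent R\<^esub> \<zero>\<^bsub>laurent R\<^esub> (t_power R (snd l))"

definition Schubert :: "int \<times> int \<Rightarrow> ('a, (int \<Rightarrow> 'a) supermatrix set) point_functor" where
  "Schubert l =
    \<lparr>pts = (\<lambda>R. orbit (GL11 (powser R)) (\<lambda>h C. h <#\<^bsub>GL11 (laurent R)\<^esub> C)
                  (t_cochar R l <#\<^bsub>GL11 (laurent R)\<^esub> carrier (GL11 (powser R)))),
     pts_map = pts_map affine_Grassmannian\<rparr>"


section \<open>Supermodules and their rank\<close>

text \<open>Supermodules are left modules; the last \<open>q\<close> coordinates of \<open>R\<^bsup>p|q\<^esup>\<close> are odd.\<close>

definition coord_parity :: "nat \<Rightarrow> nat \<Rightarrow> bit" where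
  "coord_parity p i = (if i < p then 0 else 1)"

definition free_module :: "'a superalgebra \<Rightarrow> nat \<Rightarrow> nat \<Rightarrow> ('a, nat \<Rightarrow> 'a) graded_module" where
  "free_module R p q =
    \<lparr>carrier = {..<p + q} \<rightarrow>\<^sub>E carrier R, monoid.mult = undefined, one = undefined,
     ring.zero = (\<lambda>i\<in>{..<p + q}. \<zero>\<^bsub>R\<^esub>),
     add = (\<lambda>v w. \<lambda>i\<in>{..<p + q}. v i \<oplus>\<^bsub>R\<^esub> w i),
     smult = (\<lambda>r v. \<lambda>i\<in>{..<p + q}. r \<otimes>\<^bsub>R\<^esub> v i),
     homog = (\<lambda>j. \<Pi>\<^sub>E i\<in>{..<p + q}. homog R (j + coord_parity p i))\<rparr>"

definition regular_module :: "'a superalgebra \<Rightarrow> ('a, 'a) graded_module" where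
  "regular_module R =
    \<lparr>carrier = carrier R, monoid.mult = monoid.mult R, one = one R, ring.zero = ring.zero R,
     add = add R, smult = monoid.mult R, homog = homog R\<rparr>"

definition graded_submodule :: "'a superalgebra \<Rightarrow> ('a, 'm) graded_module \<Rightarrow> 'm set \<Rightarrow> bool" where
  "graded_submodule R M L \<longleftrightarrow> submodule L R M \<and>
     (\<forall>x\<in>L. \<exists>y \<in> L \<inter> homog M 0. \<exists>z \<in> L \<inter> homog M 1. x = y \<oplus>\<^bsub>M\<^esub> z)"

definition restrict_module :: "('a, 'm) graded_module \<Rightarrow> 'm set \<Rightarrow> ('a, 'm) graded_module" where
  "restrict_module M L = M\<lparr>carrier := L, homog := (\<lambda>i. homog M i \<inter> L)\<rparr>"

definition direct_summand :: "'a superalgebra \<Rightarrow> ('a, 'm) graded_module \<Rightarrow> 'm set \<Rightarrow> bool" where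
  "direct_summand R M L \<longleftrightarrow> graded_submodule R M L \<and>
     (\<exists>N. graded_submodule R M N \<and> L \<inter> N = {\<zero>\<^bsub>M\<^esub>} \<and> L <+>\<^bsub>M\<^esub> N = carrier M)"

definition supermodule_span :: "'a superalgebra \<Rightarrow> ('a, 'm) graded_module \<Rightarrow> 'm set \<Rightarrow> 'm set" where
  "supermodule_span R M B = \<Inter>{N. submodule N R M \<and> B \<subseteq> N}"

text \<open>\<open>fraction R S M m s\<close> is the class of \<open>m / s\<close> in the localization of \<open>M\<close> at a multiplicative
  set \<open>S\<close> of even elements.\<close>

definition fraction ::
    "'a superalgebra \<Rightarrow> 'a set \<Rightarrow> ('a, 'm) graded_module \<Rightarrow> 'm \<Rightarrow> 'a \<Rightarrow> ('m \<times> 'a) set" where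
  "fraction R S M m s = {(n, t). n \<in> carrier M \<and> t \<in> S \<and>
     (\<exists>u\<in>S. u \<odot>\<^bsub>M\<^esub> (t \<odot>\<^bsub>M\<^esub> m) = u \<odot>\<^bsub>M\<^esub> (s \<odot>\<^bsub>M\<^esub> n))}"

text \<open>The scalars of \<open>localization R S M\<close> are the elements of \<open>localization R S (regular_module R)\<close>,
  the localized superalgebra. The unions below run over the representatives of the given classes,
  all of which yield the same fraction.\<close>

definition localization :: "'a superalgebra \<Rightarrow> 'a set \<Rightarrow> ('a, 'm) graded_module \<Rightarrow>
    (('a \<times> 'a) set, ('m \<times> 'a) set) graded_module" where
  "localization R S M =
    \<lparr>carrier = {fraction R S M m s | m s. m \<in> carrier M \<and> s \<in> S},
     monoid.mult = undefined, one = undefined,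
     ring.zero = fraction R S M \<zero>\<^bsub>M\<^esub> \<one>\<^bsub>R\<^esub>,
     add = (\<lambda>U V. \<Union>(m, s)\<in>U. \<Union>(n, t)\<in>V.
              fraction R S M (t \<odot>\<^bsub>M\<^esub> m \<oplus>\<^bsub>M\<^esub> s \<odot>\<^bsub>M\<^esub> n) (s \<otimes>\<^bsub>R\<^esub> t)),
     smult = (\<lambda>A V. \<Union>(r, t)\<in>A. \<Union>(m, s)\<in>V. fraction R S M (r \<odot>\<^bsub>M\<^esub> m) (t \<otimes>\<^bsub>R\<^esub> s)),
     homog = (\<lambda>i. {fraction R S M m s | m s. m \<in> homog M i \<and> s \<in> S})\<rparr>"

text \<open>\<open>M\<close> has a homogeneous basis of \<open>p\<close> even and \<open>q\<close> odd elements over the scalars \<open>A\<close>.\<close>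

definition free_of_rank :: "'r set \<Rightarrow> ('r, 'm) graded_module \<Rightarrow> nat \<Rightarrow> nat \<Rightarrow> bool" where
  "free_of_rank A M p q \<longleftrightarrow>
     (\<exists>e. (\<forall>i<p + q. e i \<in> homog M (coord_parity p i)) \<and>
          (\<forall>x \<in> carrier M. \<exists>!c. c \<in> {..<p + q} \<rightarrow>\<^sub>E A \<and>
             x = (\<Oplus>\<^bsub>M\<^esub>i\<in>{..<p + q}. c i \<odot>\<^bsub>M\<^esub> e i)))"

text \<open>The rank of a finitely generated projective supermodule is read off from its localizations
  at the prime ideals of \<open>R\<^sub>0\<close>, which are free.\<close>

definition has_rank :: "'a superalgebra \<Rightarrow> ('a, 'm) graded_module \<Rightarrow> nat \<Rightarrow> nat \<Rightarrow> bool" where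
  "has_rank R M p q \<longleftrightarrow>
     (\<forall>P. primeideal P (even_part R) \<longrightarrow>
        (let S = homog R 0 - P in
         free_of_rank (carrier (localization R S (regular_module R))) (localization R S M) p q))"


section \<open>Super projective space\<close>

text \<open>A homomorphism from \<open>R\<close> to \<open>S\<close> acts by base change: the image of \<open>S \<otimes>\<^sub>R L\<close> in \<open>S\<^bsup>p+1|q\<^esup>\<close> is the
  span of the coordinatewise image of \<open>L\<close>.\<close>

definition super_projective_space :: "nat \<Rightarrow> nat \<Rightarrow> ('a, (nat \<Rightarrow> 'a) set) point_functor" where
  "super_projective_space p q =
    \<lparr>pts = (\<lambda>R. {L. direct_summand R (free_module R (p + 1) q) L \<and>
                    has_rank R (restrict_module (free_module R (p + 1) q) L) 1 0}),
     pts_map = (\<lambda>R S \<phi> L.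
       supermodule_span S (free_module S (p + 1) q) ((\<lambda>v. \<lambda>i\<in>{..<p + 1 + q}. \<phi> (v i)) ` L))\<rparr>"

end

(* Both functors are represented by k free odd coordinates. For lambda = (k|0) the coset of
   g t^lambda, where g has last column (kappa, x'), depends only on kappa / x' modulo t^k, and every
   odd polynomial of degree less than k occurs; conjugating by the permutation matrix exchanges
   (k|0) and (0|k). On the other side, a rank 1|0 summand L of R^(1|k) is generated by a unique even
   vector with first coordinate 1. Indeed the first coordinates of even elements of L form an ideal
   I of R_0. If I were contained in a prime P, then all coordinates of a local generator f of L would
   lie in P + R_1, and projecting f along a complement of L would give (t - r) f = 0 with t outside P
   and r in P + R_1, which is absurd because f is torsion free at P. Once e in L has first coordinate
   1, elements of L with first coordinate 0 vanish at every prime, so L = R e. *)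

theory Submission
  imports Defs
begin

section \<open>Supercommutative rings\<close>

text \<open>Precision t^k comes from the stabilizer of the base point: conjugation by t^\<lambda>
  with \<lambda> = (k|0) multiplies the upper right entry by t^k and divides the lower left one by
  it, so the matrices over power series that fix the coset of t^\<lambda> are those with upper right
  entry divisible by t^k. On the projective side one chart suffices, since odd coordinates square to
  zero and only the single even coordinate can be invertible. Free localizations alone do not force
  this: over C[x] the submodule x C[x] of C[x] is free of rank one, but its generator is no unit.
  The complement of L is what excludes such examples. The obstacle is that primes live in R_0
  whereas scalars and coordinates also have odd parts. P + R_1 is nevertheless a two-sided ideal,
  because a product of two odd elements squares to zero and so lies in P. The localizations are only
  used through numerators and denominators; each local statement becomes global because the even
  elements that witness it form an ideal of R_0 contained in no prime.\<close>

text \<open>The complex scalars are only needed for the absence of 2-torsion, which makes odd elements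
  square to zero.\<close>

locale supercommutative_ring = ring R for R :: "'a superalgebra" (structure) +
  assumes homog_closed [simp]: "x \<in> homog R i \<Longrightarrow> x \<in> carrier R"
    and homog_zero [simp]: "\<zero> \<in> homog R i"
    and homog_add [simp]: "x \<in> homog R i \<Longrightarrow> y \<in> homog R i \<Longrightarrow> x \<oplus> y \<in> homog R i"
    and homog_split: "x \<in> carrier R \<Longrightarrow> \<exists>a\<in>homog R 0. \<exists>b\<in>homog R 1. x = a \<oplus> b"
    and homog_direct: "a \<in> homog R 0 \<Longrightarrow> b \<in> homog R 1 \<Longrightarrow> a \<oplus> b = \<zero> \<Longrightarrow> a = \<zero>"
    and one_even [simp]: "\<one> \<in> homog R 0"
    and homog_mult: "x \<in> homog R i \<Longrightarrow> y \<in> homog R j \<Longrightarrow> x \<otimes> y \<in> homog R (i + j)"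
    and even_mult_commute: "x \<in> homog R 0 \<Longrightarrow> y \<in> homog R i \<Longrightarrow> x \<otimes> y = y \<otimes> x"
    and odd_mult_anticommute: "x \<in> homog R 1 \<Longrightarrow> y \<in> homog R 1 \<Longrightarrow> x \<otimes> y \<oplus> y \<otimes> x = \<zero>"
    and two_torsion_free: "x \<in> carrier R \<Longrightarrow> x \<oplus> x = \<zero> \<Longrightarrow> x = \<zero>"
begin

lemma even_even_mult [simp]: "x \<in> homog R 0 \<Longrightarrow> y \<in> homog R 0 \<Longrightarrow> x \<otimes> y \<in> homog R 0"
  using homog_mult[of x 0 y 0] by simp

lemma even_odd_mult [simp]: "x \<in> homog R 0 \<Longrightarrow> y \<in> homog R 1 \<Longrightarrow> x \<otimes> y \<in> homog R 1"
  using homog_mult[of x 0 y 1] by simp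

lemma odd_even_mult [simp]: "x \<in> homog R 1 \<Longrightarrow> y \<in> homog R 0 \<Longrightarrow> x \<otimes> y \<in> homog R 1"
  using homog_mult[of x 1 y 0] by simp

lemma odd_odd_mult [simp]: "x \<in> homog R 1 \<Longrightarrow> y \<in> homog R 1 \<Longrightarrow> x \<otimes> y \<in> homog R 0"
  using homog_mult[of x 1 y 1] by simp

text \<open>Closure under negation follows from directness of the grading: if \<ominus> x = a
  \<oplus> b, then separating parities in a \<oplus> b \<oplus> x = \<zero> leaves for \<ominus> x
  only the summand with the parity of x.\<close>

lemma homog_minus [simp]:
  assumes x: "x \<in> homog R i"
  shows "\<ominus> x \<in> homog R i"
proof -
  obtain a b where a: "a \<in> homog R 0" and b: "b \<in> homog R 1" and e: "\<ominus> x = a \<oplus> b"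
    using homog_split[of "\<ominus> x"] x by auto
  have ab: "a \<oplus> b \<oplus> x = \<zero>"
    using e[symmetric] x by (simp add: l_neg)
  show ?thesis
  proof (cases "i = 0")
    case True
    have "(a \<oplus> x) \<oplus> b = \<zero>"
      using ab a b x by (simp add: a_ac)
    then have "a \<oplus> x = \<zero>"
      using a b x True by (auto intro!: homog_direct[of _ b])
    then have "\<ominus> x = a"
      using a x by (simp add: minus_equality)
    then show ?thesis using a True by simp
  next
    case False
    then have i: "i = 1" by simp
    have "a \<oplus> (b \<oplus> x) = \<zero>"
      using ab a b x by (simp add: a_ac)
    then have "a = \<zero>"
      using a b x i by (auto intro!: homog_direct[of _ "b \<oplus> x"])
    then show ?thesis using e b i by simp
  qed
qed

lemma homog_decomp_unique:
  assumes "a \<in> homog R 0" "b \<in> homog R 1" "a' \<in> homog R 0" "b' \<in> homog R 1" "a \<oplus> b = a' \<oplus> b'"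
  shows "a = a'" "b = b'"
proof -
  have "(a \<oplus> \<ominus> a') \<oplus> (b \<oplus> \<ominus> b') = (a \<oplus> b) \<oplus> \<ominus> (a' \<oplus> b')"
    using assms(1-4) by (simp add: a_ac minus_add)
  also have "\<dots> = \<zero>"
    using assms by (simp add: r_neg)
  finally have "a \<oplus> \<ominus> a' = \<zero>"
    using homog_direct[of "a \<oplus> \<ominus> a'" "b \<oplus> \<ominus> b'"] assms(1-4) by simp
  then show "a = a'"
    using minus_equality[of a "\<ominus> a'"] minus_minus[of a'] homog_closed[OF assms(1)] homog_closed[OF assms(3)]
    by (metis a_inv_closed)
  then have "a \<oplus> b = a \<oplus> b'"
    using assms(5) by simp
  then show "b = b'"
    using assms(1-4) add.l_cancel[of a b b'] by simp
qed

lemma even_commute: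
  assumes x: "x \<in> homog R 0" and y: "y \<in> carrier R"
  shows "x \<otimes> y = y \<otimes> x"
proof -
  obtain a b where "a \<in> homog R 0" "b \<in> homog R 1" "y = a \<oplus> b"
    using homog_split[OF y] by auto
  moreover from this have "x \<otimes> a = a \<otimes> x" "x \<otimes> b = b \<otimes> x"
    using x by (auto intro: even_mult_commute)
  ultimately show ?thesis
    using x by (simp only: r_distr l_distr homog_closed)
qed

lemma odd_square: "x \<in> homog R 1 \<Longrightarrow> x \<otimes> x = \<zero>"
  using odd_mult_anticommute[of x x] two_torsion_free[of "x \<otimes> x"] by simp

text \<open>The product x \<otimes> y is even, hence central, so its square contains the factor y
  \<otimes> y. Two uses depend on this: such products lie in every prime ideal of the even part, and
  adding one to an even unit yields a unit.\<close>

lemma odd_mult_square: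
  assumes "x \<in> homog R 1" "y \<in> homog R 1"
  shows "(x \<otimes> y) \<otimes> (x \<otimes> y) = \<zero>"
proof -
  have "(x \<otimes> y) \<otimes> (x \<otimes> y) = x \<otimes> ((x \<otimes> y) \<otimes> y)"
    using assms even_commute[of "x \<otimes> y" y] by (simp add: m_assoc)
  then show ?thesis
    using assms odd_square[of y] by (simp add: m_assoc)
qed

lemma even_part_cring: "cring (even_part R)"
proof (rule cringI)
  show "abelian_group (even_part R)"
  proof (rule abelian_groupI)
    show "\<exists>y\<in>carrier (even_part R). y \<oplus>\<^bsub>even_part R\<^esub> x = \<zero>\<^bsub>even_part R\<^esub>" if "x \<in> carrier (even_part R)" for x
      using that by (intro bexI[of _ "\<ominus> x"]) (auto simp: even_part_def l_neg)
  qed (auto simp: even_part_def a_ac)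
  show "Group.comm_monoid (even_part R)"
  proof (rule comm_monoidI)
    show "x \<otimes>\<^bsub>even_part R\<^esub> y = y \<otimes>\<^bsub>even_part R\<^esub> x"
      if "x \<in> carrier (even_part R)" "y \<in> carrier (even_part R)" for x y
      using that by (simp add: even_part_def even_commute)
  qed (auto simp: even_part_def m_assoc)
qed (auto simp: even_part_def l_distr)

text \<open>Even elements are central, so a one-sided inverse is two-sided; it is required to be
  even because the units are those of \<open>even_part R\<close>.\<close>

lemma even_Units_iff: "x \<in> Units (even_part R) \<longleftrightarrow> x \<in> homog R 0 \<and> (\<exists>y\<in>homog R 0. x \<otimes> y = \<one>)"
proof -
  have "x \<otimes> y = \<one> \<Longrightarrow> y \<otimes> x = \<one>" if "x \<in> homog R 0" "y \<in> homog R 0" for y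
    using even_commute[of x y] that by simp
  then show ?thesis
    by (auto simp: Units_def even_part_def)
qed

lemma even_Units_even [simp]: "x \<in> Units (even_part R) \<Longrightarrow> x \<in> homog R 0"
  by (simp add: even_Units_iff)

lemma one_even_Unit [simp]: "\<one> \<in> Units (even_part R)"
  by (subst even_Units_iff) (auto intro: bexI[of _ \<one>])

lemma even_Units_mult [simp]:
  assumes "x \<in> Units (even_part R)" "y \<in> Units (even_part R)"
  shows "x \<otimes> y \<in> Units (even_part R)"
  using monoid.Units_m_closed[OF ring.is_monoid[OF cring.axioms(1)[OF even_part_cring]] assms]
  by (simp add: even_part_def)

text \<open>With b the inverse of a and c = n \<otimes> b, the inverse of a \<oplus> n is b
  \<otimes> (\<one> \<oplus> \<ominus> c), the geometric series cut off after its second term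
  because c squares to zero.\<close>

lemma even_Units_add_nilpotent:
  assumes a: "a \<in> Units (even_part R)" and n: "n \<in> homog R 0" "n \<otimes> n = \<zero>"
  shows "a \<oplus> n \<in> Units (even_part R)"
proof -
  obtain b where b: "b \<in> homog R 0" "a \<otimes> b = \<one>" and a0: "a \<in> homog R 0"
    using a even_Units_iff[of a] by blast
  have 1: "(a \<oplus> n) \<otimes> b = \<one> \<oplus> n \<otimes> b"
    using a0 b n by (simp add: l_distr)
  have sq: "(n \<otimes> b) \<otimes> (n \<otimes> b) = \<zero>"
  proof -
    have "(n \<otimes> b) \<otimes> (n \<otimes> b) = (b \<otimes> n) \<otimes> (n \<otimes> b)"
      using b n even_commute[of n b] by simp
    also have "\<dots> = b \<otimes> ((n \<otimes> n) \<otimes> b)"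
      using b(1) n(1) by (simp add: m_assoc)
    also have "\<dots> = \<zero>"
      using n b(1) by simp
    finally show ?thesis .
  qed
  define c where "c = n \<otimes> b"
  have c: "c \<in> carrier R" "c \<otimes> c = \<zero>"
    using b n sq by (auto simp: c_def)
  have "(a \<oplus> n) \<otimes> (b \<otimes> (\<one> \<oplus> \<ominus> c)) = ((a \<oplus> n) \<otimes> b) \<otimes> (\<one> \<oplus> \<ominus> c)"
    using a0 b n c by (intro m_assoc[symmetric]) auto
  also have "\<dots> = (\<one> \<oplus> c) \<otimes> (\<one> \<oplus> \<ominus> c)"
    by (simp only: 1 c_def)
  also have "\<dots> = \<one>"
    using c by (simp add: l_distr r_distr r_minus a_assoc l_neg r_neg)
  finally have "(a \<oplus> n) \<otimes> (b \<otimes> (\<one> \<oplus> \<ominus> (n \<otimes> b))) = \<one>"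
    by (simp add: c_def)
  moreover have "a \<oplus> n \<in> homog R 0" "b \<otimes> (\<one> \<oplus> \<ominus> (n \<otimes> b)) \<in> homog R 0"
    using a0 b(1) n(1) by simp_all
  ultimately show ?thesis
    using even_Units_iff by blast
qed

end

lemma Ex1_unique: "\<exists>!x. P x \<Longrightarrow> P x \<Longrightarrow> P y \<Longrightarrow> x = y"
  by blast

text \<open>Directness is the unique decomposition of \<zero> compared with the trivial one. The
  absence of 2-torsion comes from writing x as 1/2 times x \<oplus> x.\<close>

lemma superalgebra_imp_supercommutative_ring:
  assumes "superalgebra R"
  shows "supercommutative_ring R"
proof -
  interpret ring R by (rule superalgebra.axioms(1)[OF assms])
  interpret A: superalgebra R by fact
  have sub: "subgroup (homog R i) (add_monoid R)" for i
    using A.homog_submodule[of i] by (simp add: submodule_def)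
  show ?thesis
  proof (intro supercommutative_ring.intro supercommutative_ring_axioms.intro)
    show "ring R" by (rule superalgebra.axioms(1)[OF assms])
    show c: "x \<in> carrier R" if "x \<in> homog R i" for x i
      using subgroup.mem_carrier[OF sub that] by simp
    show z: "\<zero>\<^bsub>R\<^esub> \<in> homog R i" for i
      using subgroup.one_closed[OF sub] by simp
    show "x \<oplus>\<^bsub>R\<^esub> y \<in> homog R i" if "x \<in> homog R i" "y \<in> homog R i" for x y i
      using subgroup.m_closed[OF sub that] by simp
    show "\<exists>a\<in>homog R 0. \<exists>b\<in>homog R 1. x = a \<oplus>\<^bsub>R\<^esub> b" if "x \<in> carrier R" for x
      using ex1_implies_ex[OF A.homog_decomp[OF that]] by (metis SigmaE fst_conv snd_conv)
    show "a = \<zero>\<^bsub>R\<^esub>" if "a \<in> homog R 0" "b \<in> homog R 1" "a \<oplus>\<^bsub>R\<^esub> b = \<zero>\<^bsub>R\<^esub>" for a b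
    proof -
      have "\<exists>!p. p \<in> homog R 0 \<times> homog R 1 \<and> \<zero>\<^bsub>R\<^esub> = fst p \<oplus>\<^bsub>R\<^esub> snd p"
        by (rule A.homog_decomp[OF zero_closed])
      moreover have "(a, b) \<in> homog R 0 \<times> homog R 1 \<and> \<zero>\<^bsub>R\<^esub> = fst (a, b) \<oplus>\<^bsub>R\<^esub> snd (a, b)"
        using that by simp
      moreover have "(\<zero>\<^bsub>R\<^esub>, \<zero>\<^bsub>R\<^esub>) \<in> homog R 0 \<times> homog R 1 \<and>
          \<zero>\<^bsub>R\<^esub> = fst (\<zero>\<^bsub>R\<^esub>, \<zero>\<^bsub>R\<^esub>) \<oplus>\<^bsub>R\<^esub> snd (\<zero>\<^bsub>R\<^esub>, \<zero>\<^bsub>R\<^esub>)"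
        using z by simp
      ultimately have "(a, b) = (\<zero>\<^bsub>R\<^esub>, \<zero>\<^bsub>R\<^esub>)"
        by (rule Ex1_unique)
      then show ?thesis by simp
    qed
    show "\<one>\<^bsub>R\<^esub> \<in> homog R 0" by (rule A.one_even)
    show "x \<otimes>\<^bsub>R\<^esub> y \<in> homog R (i + j)" if "x \<in> homog R i" "y \<in> homog R j" for x y i j
      using that by (rule A.homog_mult)
    show "x \<otimes>\<^bsub>R\<^esub> y = y \<otimes>\<^bsub>R\<^esub> x" if "x \<in> homog R 0" "y \<in> homog R i" for x y i
      using A.supercommutative[OF that] by simp
    show "x \<otimes>\<^bsub>R\<^esub> y \<oplus>\<^bsub>R\<^esub> y \<otimes>\<^bsub>R\<^esub> x = \<zero>\<^bsub>R\<^esub>" if "x \<in> homog R 1" "y \<in> homog R 1" for x y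
      using A.supercommutative[OF that] c[OF that(1)] c[OF that(2)] by (simp add: l_neg)
    show "x = \<zero>\<^bsub>R\<^esub>" if x: "x \<in> carrier R" and "x \<oplus>\<^bsub>R\<^esub> x = \<zero>\<^bsub>R\<^esub>" for x
    proof -
      have one: "c \<odot>\<^bsub>R\<^esub> x \<oplus>\<^bsub>R\<^esub> d \<odot>\<^bsub>R\<^esub> x = (c + d) \<odot>\<^bsub>R\<^esub> x" for c d
        using A.smult_l_distr[of c d x] x by (simp add: complex_ring_def)
      have "x = 1 \<odot>\<^bsub>R\<^esub> x"
        using A.smult_one[OF x] by (simp add: complex_ring_def)
      also have "\<dots> = (1/2) \<odot>\<^bsub>R\<^esub> x \<oplus>\<^bsub>R\<^esub> (1/2) \<odot>\<^bsub>R\<^esub> x"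
        using one[of "1/2" "1/2"] by simp
      also have "\<dots> = (1/2) \<odot>\<^bsub>R\<^esub> (x \<oplus>\<^bsub>R\<^esub> x)"
        using A.smult_r_distr[of "1/2" x x] x by (simp add: complex_ring_def)
      also have "\<dots> = \<zero>\<^bsub>R\<^esub>"
        using that A.smult_r_null[of "1/2"] by (simp add: complex_ring_def)
      finally show ?thesis .
    qed
  qed
qed

text \<open>Dropping the complex scalars lets the coefficientwise extension of a homomorphism to
  Laurent or power series be treated in the same setting as the homomorphism itself.\<close>

definition graded_ring_hom :: "'a superalgebra \<Rightarrow> 'b superalgebra \<Rightarrow> ('a \<Rightarrow> 'b) set" where
  "graded_ring_hom R S = {\<phi> \<in> ring_hom R S. \<forall>i. \<phi> ` homog R i \<subseteq> homog S i}"

lemma superalgebra_hom_graded: "\<phi> \<in> superalgebra_hom R S \<Longrightarrow> \<phi> \<in> graded_ring_hom R S"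
  by (auto simp: superalgebra_hom_def graded_ring_hom_def)

lemma graded_ring_homD:
  assumes "\<phi> \<in> graded_ring_hom R S"
  shows "x \<in> carrier R \<Longrightarrow> \<phi> x \<in> carrier S"
    "x \<in> carrier R \<Longrightarrow> y \<in> carrier R \<Longrightarrow> \<phi> (x \<otimes>\<^bsub>R\<^esub> y) = \<phi> x \<otimes>\<^bsub>S\<^esub> \<phi> y"
    "x \<in> carrier R \<Longrightarrow> y \<in> carrier R \<Longrightarrow> \<phi> (x \<oplus>\<^bsub>R\<^esub> y) = \<phi> x \<oplus>\<^bsub>S\<^esub> \<phi> y"
    "\<phi> \<one>\<^bsub>R\<^esub> = \<one>\<^bsub>S\<^esub>" "x \<in> homog R i \<Longrightarrow> \<phi> x \<in> homog S i"
  using assms by (auto simp: graded_ring_hom_def ring_hom_def image_subset_iff)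

lemma graded_ring_hom_zero:
  assumes "supercommutative_ring R" "supercommutative_ring S" "\<phi> \<in> graded_ring_hom R S"
  shows "\<phi> \<zero>\<^bsub>R\<^esub> = \<zero>\<^bsub>S\<^esub>"
  using ring_hom_zero[of \<phi> R S] assms
  by (auto simp: graded_ring_hom_def supercommutative_ring_def)


section \<open>Laurent series and power series\<close>

context supercommutative_ring
begin

lemma finsum_swap:
  assumes "finite A" "finite B" "\<And>i j. i \<in> A \<Longrightarrow> j \<in> B \<Longrightarrow> f i j \<in> carrier R"
  shows "(\<Oplus>i\<in>A. \<Oplus>j\<in>B. f i j) = (\<Oplus>j\<in>B. \<Oplus>i\<in>A. f i j)"
  using assms(1,3)
proof (induction A)
  case empty
  then show ?case
    using finsum_zero by simp
next
  case (insert a A)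
  have "(\<Oplus>i\<in>insert a A. \<Oplus>j\<in>B. f i j) = (\<Oplus>j\<in>B. f a j) \<oplus> (\<Oplus>i\<in>A. \<Oplus>j\<in>B. f i j)"
    using insert by (intro finsum_insert) (auto intro!: finsum_closed)
  also have "\<dots> = (\<Oplus>j\<in>B. f a j) \<oplus> (\<Oplus>j\<in>B. \<Oplus>i\<in>A. f i j)"
    using insert by simp
  also have "\<dots> = (\<Oplus>j\<in>B. f a j \<oplus> (\<Oplus>i\<in>A. f i j))"
    using insert by (intro finsum_addf[symmetric]) (auto intro!: finsum_closed)
  also have "\<dots> = (\<Oplus>j\<in>B. \<Oplus>i\<in>insert a A. f i j)"
    using insert by (intro finsum_cong') (auto intro!: finsum_insert[symmetric] finsum_closed)
  finally show ?case .
qed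

text \<open>Over an infinite index set \<open>finsum\<close> takes the value \<zero>, which has
  every parity. Coefficients of a product of series are therefore homogeneous without a look at
  their index set.\<close>

lemma homog_finsum:
  assumes "\<And>i. i \<in> A \<Longrightarrow> f i \<in> homog R p"
  shows "(\<Oplus>i\<in>A. f i) \<in> homog R p"
proof (cases "finite A")
  case True
  then show ?thesis
    using assms
  proof (induction A)
    case (insert a A)
    then have "f \<in> A \<rightarrow> carrier R" "f a \<in> carrier R"
      by (auto intro: homog_closed)
    then show ?case
      using insert by (simp add: finsum_insert)
  qed simp
qed (simp add: finsum_infinite)

lemma laurent_carrier_iff:
  "f \<in> carrier (laurent R) \<longleftrightarrow> (\<forall>n. f n \<in> carrier R) \<and> (\<exists>N. \<forall>n<N. f n = \<zero>)"
  by (simp add: laurent_def Let_def)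

lemma laurent_homog_iff:
  "f \<in> homog (laurent R) p \<longleftrightarrow> (\<forall>n. f n \<in> homog R p) \<and> (\<exists>N. \<forall>n<N. f n = \<zero>)"
  by (auto simp: laurent_def Let_def intro: homog_closed)

lemma laurent_add [simp]: "f \<oplus>\<^bsub>laurent R\<^esub> g = (\<lambda>n. f n \<oplus> g n)"
  by (simp add: laurent_def Let_def)

lemma laurent_zero [simp]: "\<zero>\<^bsub>laurent R\<^esub> = (\<lambda>n. \<zero>)"
  by (simp add: laurent_def Let_def)

lemma laurent_one: "\<one>\<^bsub>laurent R\<^esub> = (\<lambda>n. if n = 0 then \<one> else \<zero>)"
  by (simp add: laurent_def Let_def)

lemma laurent_coeff: "f \<in> carrier (laurent R) \<Longrightarrow> f n \<in> carrier R"
  by (simp add: laurent_carrier_iff)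

text \<open>The index set in the definition of the product depends on where both factors vanish.
  Here it is replaced by any finite set containing the window a..n - b, outside of which one factor
  is zero, so that several products can be compared over a common index set.\<close>

lemma laurent_mult_coeff:
  assumes f: "f \<in> carrier (laurent R)" "\<forall>i<a. f i = \<zero>"
    and g: "g \<in> carrier (laurent R)" "\<forall>i<b. g i = \<zero>"
    and I: "finite I" "{a..n - b} \<subseteq> I"
  shows "(f \<otimes>\<^bsub>laurent R\<^esub> g) n = (\<Oplus>i\<in>I. f i \<otimes> g (n - i))"
proof -
  let ?S = "{i. f i \<noteq> \<zero> \<and> g (n - i) \<noteq> \<zero>}"
  have "?S \<subseteq> {a..n - b}"
  proof
    fix i assume "i \<in> ?S"
    then have "\<not> i < a" "\<not> n - i < b"
      using f(2) g(2) by auto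
    then show "i \<in> {a..n - b}" by auto
  qed
  then have S: "?S \<subseteq> I" using I(2) by blast
  have "(\<Oplus>i\<in>?S. f i \<otimes> g (n - i)) = (\<Oplus>i\<in>I. f i \<otimes> g (n - i))"
  proof (rule add.finprod_mono_neutral_cong_left[OF I(1) S _ refl])
    show "(\<lambda>i. f i \<otimes> g (n - i)) \<in> I \<rightarrow> carrier R"
      using laurent_coeff[OF f(1)] laurent_coeff[OF g(1)] by simp
    fix i assume "i \<in> I - ?S"
    then have "f i = \<zero> \<or> g (n - i) = \<zero>" by blast
    then show "f i \<otimes> g (n - i) = \<zero>"
      using laurent_coeff[OF f(1), of i] laurent_coeff[OF g(1), of "n - i"] by auto
  qed
  then show ?thesis
    by (simp add: laurent_def Let_def)
qed

lemma laurent_mult_vanish: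
  assumes f: "f \<in> carrier (laurent R)" "\<forall>i<a. f i = \<zero>"
    and g: "g \<in> carrier (laurent R)" "\<forall>i<b. g i = \<zero>"
    and n: "n < a + b"
  shows "(f \<otimes>\<^bsub>laurent R\<^esub> g) n = \<zero>"
  using laurent_mult_coeff[OF f g, where I = "{}" and n = n] n by simp

lemma laurent_mult_coeff_closed:
  assumes f: "f \<in> carrier (laurent R)" and g: "g \<in> carrier (laurent R)"
  shows "(f \<otimes>\<^bsub>laurent R\<^esub> g) n \<in> carrier R"
  using f g unfolding laurent_def Let_def by (auto intro!: finsum_closed)

lemma laurent_boundE:
  assumes "f \<in> carrier (laurent R)"
  obtains a where "\<forall>i<a. f i = \<zero>"
  using assms by (auto simp: laurent_carrier_iff)

lemma laurent_homog_closed: "f \<in> homog (laurent R) p \<Longrightarrow> f \<in> carrier (laurent R)"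
  by (auto simp: laurent_homog_iff laurent_carrier_iff intro: homog_closed)

lemma laurent_mult_closed:
  assumes f: "f \<in> carrier (laurent R)" and g: "g \<in> carrier (laurent R)"
  shows "f \<otimes>\<^bsub>laurent R\<^esub> g \<in> carrier (laurent R)"
proof -
  obtain a where a: "\<forall>i<a. f i = \<zero>" using laurent_boundE[OF f] by blast
  obtain b where b: "\<forall>i<b. g i = \<zero>" using laurent_boundE[OF g] by blast
  have "\<forall>n<a+b. (f \<otimes>\<^bsub>laurent R\<^esub> g) n = \<zero>"
    using laurent_mult_vanish[OF f a g b] by blast
  then show ?thesis
    using laurent_mult_coeff_closed[OF f g] unfolding laurent_carrier_iff by blast
qed

text \<open>Both sides become the same double sum over a fixed rectangle. The index i is the
  exponent taken from f, and j is the total exponent taken from f and g; since neither range depends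
  on the other index, the two sums can be exchanged.\<close>

lemma laurent_mult_assoc:
  assumes f: "f \<in> carrier (laurent R)" and g: "g \<in> carrier (laurent R)" and h: "h \<in> carrier (laurent R)"
  shows "f \<otimes>\<^bsub>laurent R\<^esub> g \<otimes>\<^bsub>laurent R\<^esub> h = f \<otimes>\<^bsub>laurent R\<^esub> (g \<otimes>\<^bsub>laurent R\<^esub> h)"
proof
  let ?L = "laurent R"
  fix n
  obtain a where a: "\<forall>i<a. f i = \<zero>" using laurent_boundE[OF f] by blast
  obtain b where b: "\<forall>i<b. g i = \<zero>" using laurent_boundE[OF g] by blast
  obtain c where c: "\<forall>i<c. h i = \<zero>" using laurent_boundE[OF h] by blast
  note fc = laurent_coeff[OF f] and gc = laurent_coeff[OF g] and hc = laurent_coeff[OF h]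
  let ?I = "{a..n - (b + c)}" and ?J = "{a + b..n - c}"
  have "(f \<otimes>\<^bsub>?L\<^esub> g \<otimes>\<^bsub>?L\<^esub> h) n = (\<Oplus>j\<in>?J. (f \<otimes>\<^bsub>?L\<^esub> g) j \<otimes> h (n - j))"
    by (rule laurent_mult_coeff[OF laurent_mult_closed[OF f g] _ h c])
       (auto simp: laurent_mult_vanish[OF f a g b])
  also have "\<dots> = (\<Oplus>j\<in>?J. \<Oplus>i\<in>?I. f i \<otimes> (g (j - i) \<otimes> h (n - j)))"
  proof (intro finsum_cong' refl)
    fix j assume j: "j \<in> ?J"
    have "(f \<otimes>\<^bsub>?L\<^esub> g) j = (\<Oplus>i\<in>?I. f i \<otimes> g (j - i))"
      by (rule laurent_mult_coeff[OF f a g b]) (use j in auto)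
    then show "(f \<otimes>\<^bsub>?L\<^esub> g) j \<otimes> h (n - j) = (\<Oplus>i\<in>?I. f i \<otimes> (g (j - i) \<otimes> h (n - j)))"
      using fc gc hc by (simp add: finsum_ldistr m_assoc)
  qed (use fc gc hc in \<open>auto intro!: finsum_closed\<close>)
  also have "\<dots> = (\<Oplus>i\<in>?I. \<Oplus>j\<in>?J. f i \<otimes> (g (j - i) \<otimes> h (n - j)))"
    by (rule finsum_swap) (use fc gc hc in auto)
  also have "\<dots> = (\<Oplus>i\<in>?I. f i \<otimes> (g \<otimes>\<^bsub>?L\<^esub> h) (n - i))"
  proof (intro finsum_cong' refl)
    fix i assume i: "i \<in> ?I"
    have "(g \<otimes>\<^bsub>?L\<^esub> h) (n - i) = (\<Oplus>m\<in>(\<lambda>j. j - i) ` ?J. g m \<otimes> h (n - i - m))"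
    proof (rule laurent_mult_coeff[OF g b h c])
      show "{b..n - i - c} \<subseteq> (\<lambda>j. j - i) ` ?J"
      proof
        fix m assume "m \<in> {b..n - i - c}"
        then show "m \<in> (\<lambda>j. j - i) ` ?J"
          using i by (intro image_eqI[of _ _ "m + i"]) auto
      qed
    qed auto
    also have "\<dots> = (\<Oplus>j\<in>?J. g (j - i) \<otimes> h (n - i - (j - i)))"
      by (rule finsum_reindex) (use gc hc in \<open>auto simp: inj_on_def\<close>)
    finally show "(\<Oplus>j\<in>?J. f i \<otimes> (g (j - i) \<otimes> h (n - j))) = f i \<otimes> (g \<otimes>\<^bsub>?L\<^esub> h) (n - i)"
      using fc gc hc by (simp add: finsum_rdistr)
  qed (use fc laurent_mult_coeff_closed[OF g h] in auto)
  also have "\<dots> = (f \<otimes>\<^bsub>?L\<^esub> (g \<otimes>\<^bsub>?L\<^esub> h)) n"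
    by (rule laurent_mult_coeff[OF f a laurent_mult_closed[OF g h], where b = "b + c", symmetric])
       (auto simp: laurent_mult_vanish[OF g b h c])
  finally show "(f \<otimes>\<^bsub>?L\<^esub> g \<otimes>\<^bsub>?L\<^esub> h) n = (f \<otimes>\<^bsub>?L\<^esub> (g \<otimes>\<^bsub>?L\<^esub> h)) n" .
qed

text \<open>The substitution j = n - i puts the product in the reversed order on the index set of
  the original one, so that commutation and anticommutation can be checked term by term.\<close>

lemma laurent_mult_coeff_flip:
  assumes f: "f \<in> carrier (laurent R)" "\<forall>i<a. f i = \<zero>"
    and g: "g \<in> carrier (laurent R)" "\<forall>i<b. g i = \<zero>"
  shows "(g \<otimes>\<^bsub>laurent R\<^esub> f) n = (\<Oplus>i\<in>{a..n - b}. g (n - i) \<otimes> f i)"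
proof -
  have "(g \<otimes>\<^bsub>laurent R\<^esub> f) n = (\<Oplus>j\<in>(\<lambda>i. n - i) ` {a..n - b}. g j \<otimes> f (n - j))"
  proof (rule laurent_mult_coeff[OF g f])
    show "{b..n - a} \<subseteq> (\<lambda>i. n - i) ` {a..n - b}"
    proof
      fix m assume "m \<in> {b..n - a}"
      then show "m \<in> (\<lambda>i. n - i) ` {a..n - b}"
        by (intro image_eqI[of _ _ "n - m"]) auto
    qed
  qed auto
  also have "\<dots> = (\<Oplus>i\<in>{a..n - b}. g (n - i) \<otimes> f (n - (n - i)))"
    by (rule finsum_reindex) (use laurent_coeff[OF f(1)] laurent_coeff[OF g(1)] in \<open>auto simp: inj_on_def\<close>)
  finally show ?thesis by simp
qed

lemma laurent_add_closed:
  assumes "f \<in> homog (laurent R) p" "g \<in> homog (laurent R) p"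
  shows "(\<lambda>n. f n \<oplus> g n) \<in> homog (laurent R) p"
proof -
  obtain a where a: "\<forall>i<a. f i = \<zero>" using laurent_boundE[OF laurent_homog_closed[OF assms(1)]] by blast
  obtain b where b: "\<forall>i<b. g i = \<zero>" using laurent_boundE[OF laurent_homog_closed[OF assms(2)]] by blast
  have "\<exists>N. \<forall>n<N. f n \<oplus> g n = \<zero>"
    using a b by (intro exI[of _ "min a b"]) simp
  then show ?thesis
    using assms unfolding laurent_homog_iff by (simp only: homog_add simp_thms)
qed

lemma laurent_common_boundE:
  assumes "f \<in> carrier (laurent R)" "g \<in> carrier (laurent R)"
  obtains a where "\<forall>i<a. f i = \<zero>" "\<forall>i<a. g i = \<zero>"
proof -
  obtain a where a: "\<forall>i<a. f i = \<zero>" using laurent_boundE[OF assms(1)] by blast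
  obtain b where b: "\<forall>i<b. g i = \<zero>" using laurent_boundE[OF assms(2)] by blast
  show ?thesis by (rule that[of "min a b"]) (use a b in auto)
qed

text \<open>The clause on vanishing coefficients makes both parts inherit every lower bound of f. It
  yields membership in the Laurent series and later shows that the parts of a power series are power
  series.\<close>

lemma laurent_split:
  assumes f: "f \<in> carrier (laurent R)"
  shows "\<exists>a\<in>homog (laurent R) 0. \<exists>b\<in>homog (laurent R) 1.
    f = (\<lambda>n. a n \<oplus> b n) \<and> (\<forall>n. f n = \<zero> \<longrightarrow> a n = \<zero> \<and> b n = \<zero>)"
proof -
  have "\<forall>n. \<exists>a b. a \<in> homog R 0 \<and> b \<in> homog R 1 \<and> f n = a \<oplus> b"
    using f homog_split by (metis laurent_coeff)
  then obtain a b where ab: "\<And>n. a n \<in> homog R 0" "\<And>n. b n \<in> homog R 1" "\<And>n. f n = a n \<oplus> b n"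
    by metis
  have z: "a n = \<zero> \<and> b n = \<zero>" if "f n = \<zero>" for n
    using homog_decomp_unique[OF ab(1) ab(2) homog_zero homog_zero, of n n] ab(3)[of n] that by simp
  obtain N where N: "\<forall>i<N. f i = \<zero>" using laurent_boundE[OF f] by blast
  have "a \<in> homog (laurent R) 0" "b \<in> homog (laurent R) 1"
    using ab(1,2) z N unfolding laurent_homog_iff by blast+
  moreover have "f = (\<lambda>n. a n \<oplus> b n)"
    using ab(3) by blast
  ultimately show ?thesis
    using z by blast
qed

lemma laurent_ring: "ring (laurent R)"
proof (rule ringI)
  let ?L = "laurent R"
  have add_closed: "f \<oplus>\<^bsub>?L\<^esub> g \<in> carrier ?L"
      if f: "f \<in> carrier ?L" and g: "g \<in> carrier ?L" for f g
    proof -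
      obtain a where "\<forall>i<a. f i = \<zero>" "\<forall>i<a. g i = \<zero>"
        using laurent_common_boundE[OF f g] by blast
      then have "\<exists>N. \<forall>n<N. f n \<oplus> g n = \<zero>"
        by (intro exI[of _ a]) simp
      then show ?thesis
        using f g by (simp add: laurent_carrier_iff)
    qed
  show "abelian_group ?L"
  proof (rule abelian_groupI)
    show "\<exists>g\<in>carrier ?L. g \<oplus>\<^bsub>?L\<^esub> f = \<zero>\<^bsub>?L\<^esub>"
      if "f \<in> carrier ?L" for f
      using that by (intro bexI[of _ "\<lambda>n. \<ominus> f n"]) (auto simp: laurent_carrier_iff l_neg)
    show "f \<oplus>\<^bsub>?L\<^esub> g \<oplus>\<^bsub>?L\<^esub> h = f \<oplus>\<^bsub>?L\<^esub> (g \<oplus>\<^bsub>?L\<^esub> h)"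
      if "f \<in> carrier ?L" "g \<in> carrier ?L" "h \<in> carrier ?L" for f g h
      using that by (simp add: laurent_carrier_iff a_assoc)
    show "f \<oplus>\<^bsub>?L\<^esub> g = g \<oplus>\<^bsub>?L\<^esub> f"
      if "f \<in> carrier ?L" "g \<in> carrier ?L" for f g
      using that by (simp add: laurent_carrier_iff a_comm)
  qed (use add_closed in \<open>auto simp: laurent_carrier_iff\<close>)
  show "monoid ?L"
  proof (rule monoidI)
    show one: "\<one>\<^bsub>?L\<^esub> \<in> carrier ?L"
      by (auto simp: laurent_one laurent_carrier_iff)
    show "\<one>\<^bsub>?L\<^esub> \<otimes>\<^bsub>?L\<^esub> f = f" if f: "f \<in> carrier ?L" for f
    proof
      fix n
      \<comment> \<open>In the range chosen next, the maximum keeps the index 0, the only one that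
        contributes, even when n < b. The minimum in the mirrored computation for right
        multiplication keeps the index n in the same way.\<close>
      obtain b where b: "\<forall>i<b. f i = \<zero>" using laurent_boundE[OF f] by blast
      have "(\<one>\<^bsub>?L\<^esub> \<otimes>\<^bsub>?L\<^esub> f) n
          = (\<Oplus>i\<in>{0..max 0 (n - b)}. \<one>\<^bsub>?L\<^esub> i \<otimes> f (n - i))"
        by (rule laurent_mult_coeff[OF one _ f b]) (auto simp: laurent_one)
      also have "\<dots> = (\<Oplus>i\<in>{0..max 0 (n - b)}. if 0 = i then f (n - i) else \<zero>)"
        by (rule finsum_cong') (use laurent_coeff[OF f] in \<open>auto simp: laurent_one\<close>)
      also have "\<dots> = f n"
        by (subst finsum_singleton) (use laurent_coeff[OF f] in auto)
      finally show "(\<one>\<^bsub>?L\<^esub> \<otimes>\<^bsub>?L\<^esub> f) n = f n" .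
    qed
    show "f \<otimes>\<^bsub>?L\<^esub> \<one>\<^bsub>?L\<^esub> = f" if f: "f \<in> carrier ?L" for f
    proof
      fix n
      obtain b where b: "\<forall>i<b. f i = \<zero>" using laurent_boundE[OF f] by blast
      have "(f \<otimes>\<^bsub>?L\<^esub> \<one>\<^bsub>?L\<^esub>) n
          = (\<Oplus>i\<in>{min n b..n}. f i \<otimes> \<one>\<^bsub>?L\<^esub> (n - i))"
        by (rule laurent_mult_coeff[OF f b one, of 0]) (auto simp: laurent_one)
      also have "\<dots> = (\<Oplus>i\<in>{min n b..n}. if n = i then f i else \<zero>)"
        by (rule finsum_cong') (use laurent_coeff[OF f] in \<open>auto simp: laurent_one\<close>)
      also have "\<dots> = f n"
        by (subst finsum_singleton) (use laurent_coeff[OF f] in auto)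
      finally show "(f \<otimes>\<^bsub>?L\<^esub> \<one>\<^bsub>?L\<^esub>) n = f n" .
    qed
  qed (auto intro: laurent_mult_closed laurent_mult_assoc)
  show "(f \<oplus>\<^bsub>?L\<^esub> g) \<otimes>\<^bsub>?L\<^esub> h = f \<otimes>\<^bsub>?L\<^esub> h \<oplus>\<^bsub>?L\<^esub> g \<otimes>\<^bsub>?L\<^esub> h"
    if f: "f \<in> carrier ?L" and g: "g \<in> carrier ?L" and h: "h \<in> carrier ?L" for f g h
  proof
    fix n
    obtain a where a: "\<forall>i<a. f i = \<zero>" "\<forall>i<a. g i = \<zero>"
      using laurent_common_boundE[OF f g] by blast
    obtain b where b: "\<forall>i<b. h i = \<zero>" using laurent_boundE[OF h] by blast
    have eq: "(u \<otimes>\<^bsub>?L\<^esub> h) n = (\<Oplus>i\<in>{a..n - b}. u i \<otimes> h (n - i))"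
      if "u \<in> carrier ?L" "\<forall>i<a. u i = \<zero>" for u
      by (rule laurent_mult_coeff[OF that h b]) auto
    have "(\<lambda>n. f n \<oplus> g n) \<in> carrier ?L"
      using add_closed[OF f g] by simp
    then show "((f \<oplus>\<^bsub>?L\<^esub> g) \<otimes>\<^bsub>?L\<^esub> h) n
        = (f \<otimes>\<^bsub>?L\<^esub> h \<oplus>\<^bsub>?L\<^esub> g \<otimes>\<^bsub>?L\<^esub> h) n"
      using a f g laurent_coeff[OF f] laurent_coeff[OF g] laurent_coeff[OF h]
      by (simp add: eq l_distr finsum_addf)
  qed
  show "h \<otimes>\<^bsub>?L\<^esub> (f \<oplus>\<^bsub>?L\<^esub> g) = h \<otimes>\<^bsub>?L\<^esub> f \<oplus>\<^bsub>?L\<^esub> h \<otimes>\<^bsub>?L\<^esub> g"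
    if f: "f \<in> carrier ?L" and g: "g \<in> carrier ?L" and h: "h \<in> carrier ?L" for f g h
  proof
    fix n
    obtain a where a: "\<forall>i<a. f i = \<zero>" "\<forall>i<a. g i = \<zero>"
      using laurent_common_boundE[OF f g] by blast
    obtain b where b: "\<forall>i<b. h i = \<zero>" using laurent_boundE[OF h] by blast
    have eq: "(h \<otimes>\<^bsub>?L\<^esub> u) n = (\<Oplus>i\<in>{b..n - a}. h i \<otimes> u (n - i))"
      if "u \<in> carrier ?L" "\<forall>i<a. u i = \<zero>" for u
      by (rule laurent_mult_coeff[OF h b that]) auto
    have "(\<lambda>n. f n \<oplus> g n) \<in> carrier ?L"
      using add_closed[OF f g] by simp
    then show "(h \<otimes>\<^bsub>?L\<^esub> (f \<oplus>\<^bsub>?L\<^esub> g)) n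
        = (h \<otimes>\<^bsub>?L\<^esub> f \<oplus>\<^bsub>?L\<^esub> h \<otimes>\<^bsub>?L\<^esub> g) n"
      using a f g laurent_coeff[OF f] laurent_coeff[OF g] laurent_coeff[OF h]
      by (simp add: eq r_distr finsum_addf)
  qed
qed

text \<open>Each axiom reduces to its counterpart in the coefficients. For the two commutation rules
  the reversed product is first brought to the same index set.\<close>

lemma laurent_supercommutative_ring: "supercommutative_ring (laurent R)"
proof (intro supercommutative_ring.intro supercommutative_ring_axioms.intro laurent_ring)
  let ?L = "laurent R"
  show "f \<in> homog ?L i \<Longrightarrow> f \<in> carrier ?L" for f i
    by (rule laurent_homog_closed)
  show "\<zero>\<^bsub>?L\<^esub> \<in> homog ?L i" for i
    by (simp add: laurent_homog_iff)
  show "f \<oplus>\<^bsub>?L\<^esub> g \<in> homog ?L i"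
    if "f \<in> homog ?L i" "g \<in> homog ?L i" for f g i
    using laurent_add_closed[OF that] by simp
  show "\<exists>a\<in>homog ?L 0. \<exists>b\<in>homog ?L 1. f = a \<oplus>\<^bsub>?L\<^esub> b"
    if "f \<in> carrier ?L" for f
    using laurent_split[OF that] by auto
  show "a = \<zero>\<^bsub>?L\<^esub>" if a: "a \<in> homog ?L 0" and b: "b \<in> homog ?L 1"
    and ab: "a \<oplus>\<^bsub>?L\<^esub> b = \<zero>\<^bsub>?L\<^esub>" for a b
  proof
    fix n
    show "a n = \<zero>\<^bsub>?L\<^esub> n"
      using homog_direct[of "a n" "b n"] a b fun_cong[OF ab, of n] by (simp add: laurent_homog_iff)
  qed
  show "\<one>\<^bsub>?L\<^esub> \<in> homog ?L 0"
    by (auto simp: laurent_one laurent_homog_iff)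
  show "f \<otimes>\<^bsub>?L\<^esub> g \<in> homog ?L (i + j)"
    if f: "f \<in> homog ?L i" and g: "g \<in> homog ?L j" for f g i j
  proof -
    have "(f \<otimes>\<^bsub>?L\<^esub> g) n \<in> homog R (i + j)" for n
      using f g unfolding laurent_def Let_def by (auto intro!: homog_finsum homog_mult)
    then show ?thesis
      using laurent_mult_closed[OF laurent_homog_closed[OF f] laurent_homog_closed[OF g]]
      unfolding laurent_homog_iff laurent_carrier_iff by blast
  qed
  show "f \<otimes>\<^bsub>?L\<^esub> g = g \<otimes>\<^bsub>?L\<^esub> f"
    if f: "f \<in> homog ?L 0" and g: "g \<in> homog ?L i" for f g i
  proof
    fix n
    have fg: "f \<in> carrier ?L" "g \<in> carrier ?L"
      using f g by (auto intro: laurent_homog_closed)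
    note c = laurent_coeff[OF fg(1)] laurent_coeff[OF fg(2)]
    obtain a where a: "\<forall>i<a. f i = \<zero>" using laurent_boundE[OF fg(1)] by blast
    obtain b where b: "\<forall>i<b. g i = \<zero>" using laurent_boundE[OF fg(2)] by blast
    have "(f \<otimes>\<^bsub>?L\<^esub> g) n = (\<Oplus>i\<in>{a..n - b}. f i \<otimes> g (n - i))"
      by (rule laurent_mult_coeff[OF fg(1) a fg(2) b]) auto
    also have "\<dots> = (\<Oplus>i\<in>{a..n - b}. g (n - i) \<otimes> f i)"
      by (rule finsum_cong') (use c f in \<open>auto simp: laurent_homog_iff intro: even_commute\<close>)
    also have "\<dots> = (g \<otimes>\<^bsub>?L\<^esub> f) n"
      by (rule laurent_mult_coeff_flip[OF fg(1) a fg(2) b, symmetric])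
    finally show "(f \<otimes>\<^bsub>?L\<^esub> g) n = (g \<otimes>\<^bsub>?L\<^esub> f) n" .
  qed
  show "f \<otimes>\<^bsub>?L\<^esub> g \<oplus>\<^bsub>?L\<^esub> g \<otimes>\<^bsub>?L\<^esub> f = \<zero>\<^bsub>?L\<^esub>"
    if f: "f \<in> homog ?L 1" and g: "g \<in> homog ?L 1" for f g
  proof
    fix n
    have fg: "f \<in> carrier ?L" "g \<in> carrier ?L"
      using f g by (auto intro: laurent_homog_closed)
    note c = laurent_coeff[OF fg(1)] laurent_coeff[OF fg(2)]
    obtain a where a: "\<forall>i<a. f i = \<zero>" using laurent_boundE[OF fg(1)] by blast
    obtain b where b: "\<forall>i<b. g i = \<zero>" using laurent_boundE[OF fg(2)] by blast
    have "(f \<otimes>\<^bsub>?L\<^esub> g \<oplus>\<^bsub>?L\<^esub> g \<otimes>\<^bsub>?L\<^esub> f) n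
        = (\<Oplus>i\<in>{a..n - b}. f i \<otimes> g (n - i)) \<oplus> (\<Oplus>i\<in>{a..n - b}. g (n - i) \<otimes> f i)"
      using laurent_mult_coeff[OF fg(1) a fg(2) b, of "{a..n - b}" n]
        laurent_mult_coeff_flip[OF fg(1) a fg(2) b, of n] by simp
    also have "\<dots> = (\<Oplus>i\<in>{a..n - b}. f i \<otimes> g (n - i) \<oplus> g (n - i) \<otimes> f i)"
      by (rule finsum_addf[symmetric]) (use c in auto)
    also have "\<dots> = (\<Oplus>i\<in>{a..n - b}. \<zero>)"
      by (rule finsum_cong') (use f g in \<open>auto simp: laurent_homog_iff intro: odd_mult_anticommute\<close>)
    also have "\<dots> = \<zero>"
      by (rule finsum_zero)
    finally show "(f \<otimes>\<^bsub>?L\<^esub> g \<oplus>\<^bsub>?L\<^esub> g \<otimes>\<^bsub>?L\<^esub> f) n = \<zero>\<^bsub>?L\<^esub> n"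
      by simp
  qed
  show "f = \<zero>\<^bsub>?L\<^esub>" if f: "f \<in> carrier ?L"
    and ff: "f \<oplus>\<^bsub>?L\<^esub> f = \<zero>\<^bsub>?L\<^esub>" for f
  proof
    fix n
    show "f n = \<zero>\<^bsub>?L\<^esub> n"
      using two_torsion_free[of "f n"] laurent_coeff[OF f] fun_cong[OF ff, of n] by simp
  qed
qed

section \<open>Power series inside the Laurent series\<close>

lemma powser_carrier_iff:
  "f \<in> carrier (powser R) \<longleftrightarrow> (\<forall>n. f n \<in> carrier R) \<and> (\<forall>n<0. f n = \<zero>)"
  by (auto simp: powser_def Let_def laurent_carrier_iff)

lemma powser_homog_iff:
  "f \<in> homog (powser R) p \<longleftrightarrow> (\<forall>n. f n \<in> homog R p) \<and> (\<forall>n<0. f n = \<zero>)"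
  by (auto simp: powser_def Let_def laurent_homog_iff)

lemma powser_simps [simp]:
  "monoid.mult (powser R) = monoid.mult (laurent R)" "\<one>\<^bsub>powser R\<^esub> = \<one>\<^bsub>laurent R\<^esub>"
  "add (powser R) = add (laurent R)" "\<zero>\<^bsub>powser R\<^esub> = \<zero>\<^bsub>laurent R\<^esub>"
  by (simp_all add: powser_def Let_def)

lemma powser_closed: "f \<in> carrier (powser R) \<Longrightarrow> f \<in> carrier (laurent R)"
  by (auto simp: powser_def Let_def)

lemma powser_homogD:
  assumes "f \<in> homog (powser R) p"
  shows "f \<in> homog (laurent R) p" "f \<in> carrier (powser R)"
  using assms by (auto simp: powser_homog_iff laurent_homog_iff powser_carrier_iff intro: homog_closed)

lemma powser_mult_vanish:
  assumes "f \<in> carrier (powser R)" "g \<in> carrier (powser R)" "n < 0"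
  shows "(f \<otimes>\<^bsub>laurent R\<^esub> g) n = \<zero>"
  using laurent_mult_vanish[OF powser_closed[OF assms(1)] _ powser_closed[OF assms(2)], of 0 0 n] assms
  by (simp add: powser_carrier_iff)

text \<open>All operations are those of the Laurent series, so the identities are inherited. What
  remains is that negative coefficients stay zero under products, negation and the splitting into
  parities.\<close>

lemma powser_supercommutative_ring: "supercommutative_ring (powser R)"
proof -
  let ?L = "laurent R" and ?P = "powser R"
  interpret L: supercommutative_ring "laurent R"
    by (rule laurent_supercommutative_ring)
  have mult_closed: "f \<otimes>\<^bsub>?L\<^esub> g \<in> carrier ?P"
    if f: "f \<in> carrier ?P" and g: "g \<in> carrier ?P" for f g
    using L.m_closed[OF powser_closed[OF f] powser_closed[OF g]] powser_mult_vanish[OF f g]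
    unfolding powser_carrier_iff laurent_carrier_iff by blast
  have one: "\<one>\<^bsub>?L\<^esub> \<in> homog ?P 0"
    by (auto simp: laurent_one powser_homog_iff)
  show ?thesis
  proof (intro supercommutative_ring.intro supercommutative_ring_axioms.intro)
    show "ring ?P"
    proof (rule ringI)
      show "abelian_group ?P"
      proof (rule abelian_groupI)
        show "f \<oplus>\<^bsub>?P\<^esub> g \<in> carrier ?P"
          if "f \<in> carrier ?P" "g \<in> carrier ?P" for f g
          using that by (simp add: powser_carrier_iff)
        show "f \<oplus>\<^bsub>?P\<^esub> g \<oplus>\<^bsub>?P\<^esub> h = f \<oplus>\<^bsub>?P\<^esub> (g \<oplus>\<^bsub>?P\<^esub> h)"
          if "f \<in> carrier ?P" "g \<in> carrier ?P" "h \<in> carrier ?P" for f g h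
          using that by (simp add: powser_carrier_iff a_assoc)
        show "f \<oplus>\<^bsub>?P\<^esub> g = g \<oplus>\<^bsub>?P\<^esub> f"
          if "f \<in> carrier ?P" "g \<in> carrier ?P" for f g
          using that by (simp add: powser_carrier_iff a_comm)
        show "\<exists>g\<in>carrier ?P. g \<oplus>\<^bsub>?P\<^esub> f = \<zero>\<^bsub>?P\<^esub>"
          if "f \<in> carrier ?P" for f
          using that by (intro bexI[of _ "\<lambda>n. \<ominus> f n"]) (auto simp: powser_carrier_iff l_neg)
      qed (simp_all add: powser_carrier_iff)
      show "monoid ?P"
      proof (rule monoidI)
        show "\<one>\<^bsub>?P\<^esub> \<in> carrier ?P"
          using powser_homogD(2)[OF one] by simp
      qed (use mult_closed in \<open>simp_all add: powser_closed L.m_assoc\<close>)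
      show "(f \<oplus>\<^bsub>?P\<^esub> g) \<otimes>\<^bsub>?P\<^esub> h = f \<otimes>\<^bsub>?P\<^esub> h \<oplus>\<^bsub>?P\<^esub> g \<otimes>\<^bsub>?P\<^esub> h"
        if "f \<in> carrier ?P" "g \<in> carrier ?P" "h \<in> carrier ?P" for f g h
        using L.l_distr[of f g h] that by (simp add: powser_closed)
      show "h \<otimes>\<^bsub>?P\<^esub> (f \<oplus>\<^bsub>?P\<^esub> g) = h \<otimes>\<^bsub>?P\<^esub> f \<oplus>\<^bsub>?P\<^esub> h \<otimes>\<^bsub>?P\<^esub> g"
        if "f \<in> carrier ?P" "g \<in> carrier ?P" "h \<in> carrier ?P" for f g h
        using L.r_distr[of f g h] that by (simp add: powser_closed)
    qed
    show "f \<in> carrier ?P" if "f \<in> homog ?P i" for f i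
      using that by (rule powser_homogD)
    show "\<zero>\<^bsub>?P\<^esub> \<in> homog ?P i" for i
      by (simp add: powser_homog_iff)
    show "f \<oplus>\<^bsub>?P\<^esub> g \<in> homog ?P i"
      if "f \<in> homog ?P i" "g \<in> homog ?P i" for f g i
      using that by (simp add: powser_homog_iff)
    show "\<exists>a\<in>homog ?P 0. \<exists>b\<in>homog ?P 1. f = a \<oplus>\<^bsub>?P\<^esub> b"
      if f: "f \<in> carrier ?P" for f
    proof -
      obtain a b where ab: "a \<in> homog ?L 0" "b \<in> homog ?L 1"
        "\<forall>n. f n = \<zero> \<longrightarrow> a n = \<zero> \<and> b n = \<zero>" and fab: "f = (\<lambda>n. a n \<oplus> b n)"
        using laurent_split[OF powser_closed[OF f]] by blast
      have "a \<in> homog ?P 0" "b \<in> homog ?P 1"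
        using ab f unfolding powser_homog_iff laurent_homog_iff powser_carrier_iff by blast+
      moreover have "f = a \<oplus>\<^bsub>?P\<^esub> b"
        using fab by simp
      ultimately show ?thesis by blast
    qed
    show "a = \<zero>\<^bsub>?P\<^esub>" if "a \<in> homog ?P 0" "b \<in> homog ?P 1"
      "a \<oplus>\<^bsub>?P\<^esub> b = \<zero>\<^bsub>?P\<^esub>" for a b
      using L.homog_direct[of a b] that powser_homogD(1) by simp
    show "\<one>\<^bsub>?P\<^esub> \<in> homog ?P 0"
      using one by simp
    show "f \<otimes>\<^bsub>?P\<^esub> g \<in> homog ?P (i + j)"
      if f: "f \<in> homog ?P i" and g: "g \<in> homog ?P j" for f g i j
      using L.homog_mult[OF powser_homogD(1)[OF f] powser_homogD(1)[OF g]]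
        powser_mult_vanish[OF powser_homogD(2)[OF f] powser_homogD(2)[OF g]]
      by (simp add: powser_homog_iff laurent_homog_iff)
    show "f \<otimes>\<^bsub>?P\<^esub> g = g \<otimes>\<^bsub>?P\<^esub> f"
      if "f \<in> homog ?P 0" "g \<in> homog ?P i" for f g i
      using L.even_mult_commute[of f g i] that powser_homogD(1) by simp
    show "f \<otimes>\<^bsub>?P\<^esub> g \<oplus>\<^bsub>?P\<^esub> g \<otimes>\<^bsub>?P\<^esub> f = \<zero>\<^bsub>?P\<^esub>"
      if "f \<in> homog ?P 1" "g \<in> homog ?P 1" for f g
      using L.odd_mult_anticommute[of f g] that powser_homogD(1) by simp
    show "f = \<zero>\<^bsub>?P\<^esub>" if "f \<in> carrier ?P" "f \<oplus>\<^bsub>?P\<^esub> f = \<zero>\<^bsub>?P\<^esub>" for f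
      using L.two_torsion_free[of f] that powser_closed by simp
  qed
qed

end

section \<open>Coefficientwise extension of homomorphisms to series\<close>

lemma graded_ring_hom_finsum:
  assumes "supercommutative_ring R" "supercommutative_ring S" and phi: "\<phi> \<in> graded_ring_hom R S"
    and "finite A" "\<And>i. i \<in> A \<Longrightarrow> f i \<in> carrier R"
  shows "\<phi> (\<Oplus>\<^bsub>R\<^esub>i\<in>A. f i) = (\<Oplus>\<^bsub>S\<^esub>i\<in>A. \<phi> (f i))"
proof -
  interpret R: supercommutative_ring R by fact
  interpret S: supercommutative_ring S by fact
  show ?thesis
    using assms(4,5)
  proof (induction A)
    case empty
    then show ?case
      using graded_ring_hom_zero[OF assms(1-3)] by simp
  next
    case (insert a A)
    then have "f \<in> A \<rightarrow> carrier R" "f a \<in> carrier R" "(\<lambda>i. \<phi> (f i)) \<in> A \<rightarrow> carrier S" "\<phi> (f a) \<in> carrier S"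
      using graded_ring_homD(1)[OF phi] by auto
    then show ?case
      using insert by (simp add: R.finsum_insert S.finsum_insert graded_ring_homD(3)[OF phi] R.finsum_closed)
  qed
qed

text \<open>A homomorphism may kill coefficients, so the index sets in the definitions of the two
  products can differ. Both products are evaluated over the window a..n - b given by lower bounds of
  f and g, which remain lower bounds after applying \<phi>.\<close>

lemma laurent_map_hom:
  assumes "supercommutative_ring R" "supercommutative_ring S" and phi: "\<phi> \<in> graded_ring_hom R S"
  shows "(\<lambda>f. \<phi> \<circ> f) \<in> graded_ring_hom (laurent R) (laurent S)"
proof -
  interpret R: supercommutative_ring R by fact
  interpret S: supercommutative_ring S by fact
  note phi_zero = graded_ring_hom_zero[OF assms]
  note phiD = graded_ring_homD[OF phi]
  have vanish: "\<exists>N. \<forall>n<N. \<phi> (f n) = \<zero>\<^bsub>S\<^esub>" if "\<exists>N. \<forall>n<N. f n = \<zero>\<^bsub>R\<^esub>" for f :: "int \<Rightarrow> 'a"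
    using that phi_zero by metis
  have closed: "\<phi> \<circ> f \<in> carrier (laurent S)" if "f \<in> carrier (laurent R)" for f
    using that phiD(1) vanish[of f] by (simp add: R.laurent_carrier_iff S.laurent_carrier_iff)
  have mult: "\<phi> \<circ> (f \<otimes>\<^bsub>laurent R\<^esub> g) = (\<phi> \<circ> f) \<otimes>\<^bsub>laurent S\<^esub> (\<phi> \<circ> g)"
    if f: "f \<in> carrier (laurent R)" and g: "g \<in> carrier (laurent R)" for f g
  proof
    fix n
    note fg = R.laurent_coeff[OF f] R.laurent_coeff[OF g]
    obtain a where a: "\<forall>i<a. f i = \<zero>\<^bsub>R\<^esub>" using R.laurent_boundE[OF f] by blast
    obtain b where b: "\<forall>i<b. g i = \<zero>\<^bsub>R\<^esub>" using R.laurent_boundE[OF g] by blast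
    have "(f \<otimes>\<^bsub>laurent R\<^esub> g) n = (\<Oplus>\<^bsub>R\<^esub>i\<in>{a..n - b}. f i \<otimes>\<^bsub>R\<^esub> g (n - i))"
      by (rule R.laurent_mult_coeff[OF f a g b]) auto
    then have "(\<phi> \<circ> (f \<otimes>\<^bsub>laurent R\<^esub> g)) n = (\<Oplus>\<^bsub>S\<^esub>i\<in>{a..n - b}. \<phi> (f i \<otimes>\<^bsub>R\<^esub> g (n - i)))"
      using fg by (simp add: graded_ring_hom_finsum[OF assms])
    also have "\<dots> = (\<Oplus>\<^bsub>S\<^esub>i\<in>{a..n - b}. \<phi> (f i) \<otimes>\<^bsub>S\<^esub> \<phi> (g (n - i)))"
      by (rule S.finsum_cong') (use fg phiD in auto)
    also have "\<dots> = ((\<phi> \<circ> f) \<otimes>\<^bsub>laurent S\<^esub> (\<phi> \<circ> g)) n"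
      using a b phi_zero
      by (subst S.laurent_mult_coeff[OF closed[OF f] _ closed[OF g], of a b]) auto
    finally show "(\<phi> \<circ> (f \<otimes>\<^bsub>laurent R\<^esub> g)) n = ((\<phi> \<circ> f) \<otimes>\<^bsub>laurent S\<^esub> (\<phi> \<circ> g)) n" .
  qed
  have "(\<lambda>f. \<phi> \<circ> f) \<in> ring_hom (laurent R) (laurent S)"
  proof (rule ring_hom_memI)
    show "\<phi> \<circ> (f \<oplus>\<^bsub>laurent R\<^esub> g) = (\<phi> \<circ> f) \<oplus>\<^bsub>laurent S\<^esub> (\<phi> \<circ> g)"
      if f: "f \<in> carrier (laurent R)" and g: "g \<in> carrier (laurent R)" for f g
      using R.laurent_coeff[OF f] R.laurent_coeff[OF g] phiD(3) by (simp add: fun_eq_iff)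
    show "\<phi> \<circ> \<one>\<^bsub>laurent R\<^esub> = \<one>\<^bsub>laurent S\<^esub>"
      using phiD(4) phi_zero by (auto simp: R.laurent_one S.laurent_one)
  qed (use closed mult in auto)
  moreover have "\<phi> \<circ> f \<in> homog (laurent S) i" if "f \<in> homog (laurent R) i" for f i
    using that phiD(5) vanish[of f] by (simp add: R.laurent_homog_iff S.laurent_homog_iff)
  ultimately show ?thesis
    by (auto simp: graded_ring_hom_def)
qed

lemma powser_map_hom:
  assumes "supercommutative_ring R" "supercommutative_ring S" and phi: "\<phi> \<in> graded_ring_hom R S"
  shows "(\<lambda>f. \<phi> \<circ> f) \<in> graded_ring_hom (powser R) (powser S)"
proof -
  interpret R: supercommutative_ring R by fact
  interpret S: supercommutative_ring S by fact
  note phi_zero = graded_ring_hom_zero[OF assms]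
  note phiD = graded_ring_homD[OF phi]
  note hom = graded_ring_homD[OF laurent_map_hom[OF assms]]
  have "(\<lambda>f. \<phi> \<circ> f) \<in> ring_hom (powser R) (powser S)"
  proof (rule ring_hom_memI)
    show "\<phi> \<circ> f \<in> carrier (powser S)" if "f \<in> carrier (powser R)" for f
      using that phiD(1) phi_zero by (auto simp: R.powser_carrier_iff S.powser_carrier_iff)
    show "\<phi> \<circ> (f \<otimes>\<^bsub>powser R\<^esub> g) = (\<phi> \<circ> f) \<otimes>\<^bsub>powser S\<^esub> (\<phi> \<circ> g)"
      "\<phi> \<circ> (f \<oplus>\<^bsub>powser R\<^esub> g) = (\<phi> \<circ> f) \<oplus>\<^bsub>powser S\<^esub> (\<phi> \<circ> g)"
      if "f \<in> carrier (powser R)" "g \<in> carrier (powser R)" for f g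
      using hom(2,3)[of f g] R.powser_closed that by simp_all
  qed (use hom(4) in simp)
  moreover have "\<phi> \<circ> f \<in> homog (powser S) i" if "f \<in> homog (powser R) i" for f i
    using that phiD(5) phi_zero by (auto simp: R.powser_homog_iff S.powser_homog_iff)
  ultimately show ?thesis
    by (auto simp: graded_ring_hom_def)
qed


section \<open>The group of supermatrices\<close>

context supercommutative_ring
begin

lemma GL11_carrier_iff:
  "Supermatrix a b c d \<in> carrier (GL11 R) \<longleftrightarrow>
    a \<in> Units (even_part R) \<and> b \<in> homog R 1 \<and> c \<in> homog R 1 \<and> d \<in> Units (even_part R)"
  by (auto simp: GL11_def)

lemma GL11_carrierE:
  assumes "g \<in> carrier (GL11 R)"
  obtains a b c d where "g = Supermatrix a b c d"
    "a \<in> Units (even_part R)" "b \<in> homog R 1" "c \<in> homog R 1" "d \<in> Units (even_part R)"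
  using assms by (auto simp: GL11_def)

lemma GL11_mult [simp]: "monoid.mult (GL11 R) = supermatrix_mult R"
  by (simp add: GL11_def)

lemma GL11_one: "\<one>\<^bsub>GL11 R\<^esub> = Supermatrix \<one> \<zero> \<zero> \<one>"
  by (simp add: GL11_def)

lemma even_Units_closed [simp]: "x \<in> Units (even_part R) \<Longrightarrow> x \<in> carrier R"
  using homog_closed[of x 0] even_Units_even by blast

text \<open>A product of odd elements squares to zero, so it does not affect invertibility. This
  keeps the diagonal entries of a product of supermatrices invertible.\<close>

lemma even_Units_add_odd_mult:
  assumes "a \<in> Units (even_part R)" "b \<in> homog R 1" "c \<in> homog R 1"
  shows "a \<oplus> b \<otimes> c \<in> Units (even_part R)" "b \<otimes> c \<oplus> a \<in> Units (even_part R)"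
proof -
  show "a \<oplus> b \<otimes> c \<in> Units (even_part R)"
    by (rule even_Units_add_nilpotent[OF assms(1) _ odd_mult_square]) (use assms in auto)
  then show "b \<otimes> c \<oplus> a \<in> Units (even_part R)"
    using assms a_comm[of "b \<otimes> c" a] by simp
qed

lemma GL11_mult_closed:
  assumes "g \<in> carrier (GL11 R)" "h \<in> carrier (GL11 R)"
  shows "supermatrix_mult R g h \<in> carrier (GL11 R)"
  using assms by (elim GL11_carrierE) (simp add: GL11_carrier_iff even_Units_add_odd_mult)

lemma supermatrix_mult_assoc:
  assumes "a \<in> carrier R" "b \<in> carrier R" "c \<in> carrier R" "d \<in> carrier R"
    "a' \<in> carrier R" "b' \<in> carrier R" "c' \<in> carrier R" "d' \<in> carrier R"
    "a'' \<in> carrier R" "b'' \<in> carrier R" "c'' \<in> carrier R" "d'' \<in> carrier R"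
  shows "supermatrix_mult R (supermatrix_mult R (Supermatrix a b c d) (Supermatrix a' b' c' d')) (Supermatrix a'' b'' c'' d'')
    = supermatrix_mult R (Supermatrix a b c d) (supermatrix_mult R (Supermatrix a' b' c' d') (Supermatrix a'' b'' c'' d''))"
  using assms by (simp add: l_distr r_distr m_assoc a_ac)

lemma GL11_monoid: "monoid (GL11 R)"
proof (rule monoidI)
  show "g \<otimes>\<^bsub>GL11 R\<^esub> h \<in> carrier (GL11 R)"
    if "g \<in> carrier (GL11 R)" "h \<in> carrier (GL11 R)" for g h
    using GL11_mult_closed[OF that] by simp
  show "\<one>\<^bsub>GL11 R\<^esub> \<in> carrier (GL11 R)"
    by (simp add: GL11_one GL11_carrier_iff)
  show "g \<otimes>\<^bsub>GL11 R\<^esub> h \<otimes>\<^bsub>GL11 R\<^esub> l = g \<otimes>\<^bsub>GL11 R\<^esub> (h \<otimes>\<^bsub>GL11 R\<^esub> l)"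
    if "g \<in> carrier (GL11 R)" "h \<in> carrier (GL11 R)" "l \<in> carrier (GL11 R)" for g h l
    using that unfolding GL11_mult
    by (elim GL11_carrierE) (simp only: supermatrix_mult_assoc homog_closed even_Units_closed)
  show "\<one>\<^bsub>GL11 R\<^esub> \<otimes>\<^bsub>GL11 R\<^esub> g = g" "g \<otimes>\<^bsub>GL11 R\<^esub> \<one>\<^bsub>GL11 R\<^esub> = g" if "g \<in> carrier (GL11 R)" for g
    using that by (auto elim!: GL11_carrierE simp: GL11_one)
qed

text \<open>Instead of a closed formula for the inverse, each matrix is factored as upper unipotent
  times diagonal times lower unipotent. Only these three kinds of factors need explicit
  inverses.\<close>

lemma GL11_group: "group (GL11 R)"
proof -
  interpret G: monoid "GL11 R" by (rule GL11_monoid)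
  have UnitsI: "g \<in> Units (GL11 R)" if "h \<in> carrier (GL11 R)" "g \<in> carrier (GL11 R)"
    "h \<otimes>\<^bsub>GL11 R\<^esub> g = \<one>\<^bsub>GL11 R\<^esub>" "g \<otimes>\<^bsub>GL11 R\<^esub> h = \<one>\<^bsub>GL11 R\<^esub>" for g h
    using that unfolding Units_def by blast
  have unip: "Supermatrix \<one> u \<zero> \<one> \<in> Units (GL11 R)" "Supermatrix \<one> \<zero> u \<one> \<in> Units (GL11 R)"
    if u: "u \<in> homog R 1" for u
  proof -
    show "Supermatrix \<one> u \<zero> \<one> \<in> Units (GL11 R)"
      using u by (intro UnitsI[of "Supermatrix \<one> (\<ominus> u) \<zero> \<one>"])
        (simp_all add: GL11_carrier_iff GL11_one l_neg r_neg)
    show "Supermatrix \<one> \<zero> u \<one> \<in> Units (GL11 R)"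
      using u by (intro UnitsI[of "Supermatrix \<one> \<zero> (\<ominus> u) \<one>"])
        (simp_all add: GL11_carrier_iff GL11_one l_neg r_neg)
  qed
  have diag: "Supermatrix x \<zero> \<zero> y \<in> Units (GL11 R)"
    if x: "x \<in> Units (even_part R)" and y: "y \<in> Units (even_part R)" for x y
  proof -
    have inv: "\<exists>z\<in>Units (even_part R). x \<otimes> z = \<one> \<and> z \<otimes> x = \<one>" if "x \<in> Units (even_part R)" for x
      using that even_Units_iff by (metis even_commute homog_closed)
    obtain x' y' where "x' \<in> Units (even_part R)" "x \<otimes> x' = \<one>" "x' \<otimes> x = \<one>"
      "y' \<in> Units (even_part R)" "y \<otimes> y' = \<one>" "y' \<otimes> y = \<one>"
      using inv[OF x] inv[OF y] by blast
    then show ?thesis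
      using x y by (intro UnitsI[of "Supermatrix x' \<zero> \<zero> y'"])
        (simp_all add: GL11_carrier_iff GL11_one)
  qed
  have "g \<in> Units (GL11 R)" if g0: "g \<in> carrier (GL11 R)" for g
  proof -
    obtain a b c d where g: "g = Supermatrix a b c d"
      "a \<in> Units (even_part R)" "b \<in> homog R 1" "c \<in> homog R 1" "d \<in> Units (even_part R)"
      using GL11_carrierE[OF g0] by blast
    obtain e where e: "e \<in> homog R 0" "d \<otimes> e = \<one>"
      using g(5) even_Units_iff by blast
    \<comment> \<open>With e the inverse of d, the entry y = a \<oplus> \<ominus> (b \<otimes> e
      \<otimes> c) is the Schur complement of d. It differs from a by a product of two odd elements
      and is therefore a unit.\<close>
    define u v y where "u = b \<otimes> e" and "v = e \<otimes> c" and "y = a \<oplus> \<ominus> (u \<otimes> c)"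
    have u: "u \<in> homog R 1" and v: "v \<in> homog R 1"
      using g e by (auto simp: u_def v_def)
    have "y \<in> Units (even_part R)"
      using even_Units_add_odd_mult(1)[OF g(2), of "\<ominus> u" c] u g(4) by (simp add: y_def l_minus)
    note units = unip(1)[OF u] diag[OF this g(5)] unip(2)[OF v]
    have ud: "u \<otimes> d = b"
      using g e even_commute[of d e] by (simp add: u_def m_assoc)
    have dv: "d \<otimes> v = c"
      using g e by (simp add: v_def m_assoc[symmetric])
    have bv: "b \<otimes> v = u \<otimes> c"
      using m_assoc[of u d v] ud dv u v g(5) by simp
    have y: "y \<in> carrier R" "y \<oplus> u \<otimes> c = a"
      using g u by (simp_all add: y_def a_assoc l_neg)
    have "Supermatrix \<one> u \<zero> \<one> \<otimes>\<^bsub>GL11 R\<^esub> Supermatrix y \<zero> \<zero> d \<otimes>\<^bsub>GL11 R\<^esub> Supermatrix \<one> \<zero> v \<one>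
        = Supermatrix (y \<oplus> u \<otimes> d \<otimes> v) (u \<otimes> d) (d \<otimes> v) d"
      using u v g y by simp
    also have "\<dots> = g"
      using y(2) by (simp only: ud dv bv g(1))
    finally show ?thesis
      using units G.Units_m_closed by metis
  qed
  then show ?thesis
    by (intro group.intro GL11_monoid group_axioms.intro subsetI)
qed

end

lemma even_Units_hom:
  assumes "supercommutative_ring R" "supercommutative_ring S" and phi: "\<phi> \<in> graded_ring_hom R S"
    and x: "x \<in> Units (even_part R)"
  shows "\<phi> x \<in> Units (even_part S)"
proof -
  interpret R: supercommutative_ring R by fact
  interpret S: supercommutative_ring S by fact
  obtain y where "x \<in> homog R 0" "y \<in> homog R 0" "x \<otimes>\<^bsub>R\<^esub> y = \<one>\<^bsub>R\<^esub>"
    using x R.even_Units_iff by blast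
  then show ?thesis
    using graded_ring_homD[OF phi] S.even_Units_iff by (metis R.homog_closed)
qed

lemma GL11_hom:
  assumes "supercommutative_ring R" "supercommutative_ring S" and phi: "\<phi> \<in> graded_ring_hom R S"
  shows "map_supermatrix \<phi> \<in> hom (GL11 R) (GL11 S)"
proof (rule homI)
  interpret R: supercommutative_ring R by fact
  interpret S: supercommutative_ring S by fact
  note phiD = graded_ring_homD[OF phi]
  show "map_supermatrix \<phi> g \<in> carrier (GL11 S)" if "g \<in> carrier (GL11 R)" for g
    using that by (elim R.GL11_carrierE) (simp add: S.GL11_carrier_iff even_Units_hom[OF assms] phiD(5))
  show "map_supermatrix \<phi> (g \<otimes>\<^bsub>GL11 R\<^esub> h) = map_supermatrix \<phi> g \<otimes>\<^bsub>GL11 S\<^esub> map_supermatrix \<phi> h"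
    if "g \<in> carrier (GL11 R)" "h \<in> carrier (GL11 R)" for g h
    using that by (elim R.GL11_carrierE) (simp add: phiD(2,3))
qed

section \<open>Exchange of the two diagonal entries\<close>

fun swap_supermatrix :: "'a supermatrix \<Rightarrow> 'a supermatrix" where
  "swap_supermatrix (Supermatrix a b c d) = Supermatrix d c b a"

lemma swap_swap_supermatrix [simp]: "swap_supermatrix (swap_supermatrix g) = g"
  by (cases g) simp

lemma swap_map_supermatrix: "swap_supermatrix (map_supermatrix \<phi> g) = map_supermatrix \<phi> (swap_supermatrix g)"
  by (cases g) simp

text \<open>This is conjugation by the permutation matrix. That matrix has zero diagonal and so is
  no point of \<open>GL11 R\<close> for nonzero R; hence the conjugation is given by its effect on
  entries. Multiplication of supermatrices involves no signs, so only commutativity of addition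
  enters.\<close>

lemma (in supercommutative_ring) swap_supermatrix_hom: "swap_supermatrix \<in> hom (GL11 R) (GL11 R)"
proof (rule homI)
  show "swap_supermatrix g \<in> carrier (GL11 R)" if "g \<in> carrier (GL11 R)" for g
    using that by (elim GL11_carrierE) (simp add: GL11_carrier_iff)
  show "swap_supermatrix (g \<otimes>\<^bsub>GL11 R\<^esub> h) = swap_supermatrix g \<otimes>\<^bsub>GL11 R\<^esub> swap_supermatrix h"
    if "g \<in> carrier (GL11 R)" "h \<in> carrier (GL11 R)" for g h
    using that by (elim GL11_carrierE) (simp add: a_comm)
qed

section \<open>Images of cosets under group homomorphisms\<close>

lemma l_coset_image_hom:
  assumes "\<psi> \<in> hom G K" "g \<in> carrier G" "H \<subseteq> carrier G"
  shows "\<psi> ` (g <#\<^bsub>G\<^esub> H) = \<psi> g <#\<^bsub>K\<^esub> \<psi> ` H"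
proof -
  have "\<psi> (g \<otimes>\<^bsub>G\<^esub> h) = \<psi> g \<otimes>\<^bsub>K\<^esub> \<psi> h" if "h \<in> H" for h
    using assms that by (auto intro: hom_mult)
  then show ?thesis
    by (auto simp: l_coset_def image_UN)
qed

lemma set_mult_image_hom:
  assumes "\<psi> \<in> hom G K" "C \<subseteq> carrier G" "H \<subseteq> carrier G"
  shows "\<psi> ` (C <#>\<^bsub>G\<^esub> H) = \<psi> ` C <#>\<^bsub>K\<^esub> \<psi> ` H"
proof -
  have "\<psi> (g \<otimes>\<^bsub>G\<^esub> h) = \<psi> g \<otimes>\<^bsub>K\<^esub> \<psi> h" if "g \<in> C" "h \<in> H" for g h
    using assms that by (auto intro: hom_mult)
  then show ?thesis
    by (auto simp: set_mult_def image_UN)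
qed

text \<open>Since \<psi> maps H into H' and preserves the identity, the product of \<psi>(H) and H'
  is H'. The set-level map on points of the Grassmannian can thus be computed on one representative
  of a coset.\<close>

lemma coset_push_forward:
  assumes "group G" "group K" "\<psi> \<in> hom G K" "subgroup H G" "subgroup H' K" "\<psi> ` H \<subseteq> H'" "g \<in> carrier G"
  shows "\<psi> ` (g <#\<^bsub>G\<^esub> H) <#>\<^bsub>K\<^esub> H' = \<psi> g <#\<^bsub>K\<^esub> H'"
proof -
  interpret G: group G by fact
  interpret K: group K by fact
  have H: "H \<subseteq> carrier G" and H': "H' \<subseteq> carrier K"
    using assms(4,5) by (auto simp: subgroup_def)
  have "\<psi> ` H <#>\<^bsub>K\<^esub> H' = H'"
  proof
    show "\<psi> ` H <#>\<^bsub>K\<^esub> H' \<subseteq> H'"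
      using assms(6) subgroup.m_closed[OF assms(5)] by (auto simp: set_mult_def)
    show "H' \<subseteq> \<psi> ` H <#>\<^bsub>K\<^esub> H'"
    proof
      fix h assume h: "h \<in> H'"
      have "\<psi> \<one>\<^bsub>G\<^esub> = \<one>\<^bsub>K\<^esub>"
        using hom_one[OF assms(3)] assms(1,2) by simp
      then have "h = \<psi> \<one>\<^bsub>G\<^esub> \<otimes>\<^bsub>K\<^esub> h"
        using h H' by auto
      then show "h \<in> \<psi> ` H <#>\<^bsub>K\<^esub> H'"
        using h subgroup.one_closed[OF assms(4)] unfolding set_mult_def by blast
    qed
  qed
  moreover have "(\<psi> g <#\<^bsub>K\<^esub> \<psi> ` H) <#>\<^bsub>K\<^esub> H' = \<psi> g <#\<^bsub>K\<^esub> (\<psi> ` H <#>\<^bsub>K\<^esub> H')"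
    using assms(3,6,7) H' by (intro K.setmult_lcos_assoc) (auto simp: hom_def)
  ultimately show ?thesis
    by (simp add: l_coset_image_hom[OF assms(3,7) H])
qed


section \<open>Schubert varieties\<close>

lemma (in group) l_coset_eq_iff:
  assumes "subgroup H G" "x \<in> carrier G" "y \<in> carrier G"
  shows "x <# H = y <# H \<longleftrightarrow> (\<exists>h\<in>H. y = x \<otimes> h)"
proof
  assume "x <# H = y <# H"
  moreover have "y \<in> y <# H"
    using subgroup.one_closed[OF assms(1)] assms(3) by (force simp: l_coset_def)
  ultimately show "\<exists>h\<in>H. y = x \<otimes> h"
    by (auto simp: l_coset_def)
next
  assume "\<exists>h\<in>H. y = x \<otimes> h"
  then show "x <# H = y <# H"
    using l_repr_independence[OF _ assms(2,1), of y] by (auto simp: l_coset_def)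
qed

text \<open>The coordinates \<open>s\<close> are later taken to be extensional on
  \<open>{..<k}\<close>. The upper guard discards their value \<open>undefined\<close> from k on,
  and the lower one is needed because \<open>nat\<close> sends negative integers to 0.\<close>

definition odd_polynomial :: "'a superalgebra \<Rightarrow> nat \<Rightarrow> (nat \<Rightarrow> 'a) \<Rightarrow> int \<Rightarrow> 'a" where
  "odd_polynomial R k s = (\<lambda>n. if 0 \<le> n \<and> n < int k then s (nat n) else \<zero>\<^bsub>R\<^esub>)"

text \<open>The matrix \<open>u t\<^sup>\<lambda>\<close> for \<open>\<lambda> = (k|0)\<close> and the unipotent \<open>u\<close> with upper right entry \<open>\<Sum>i<k. s i t\<^sup>i\<close>.\<close>

definition Schubert_representative :: "'a superalgebra \<Rightarrow> nat \<Rightarrow> (nat \<Rightarrow> 'a) \<Rightarrow> (int \<Rightarrow> 'a) supermatrix" where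
  "Schubert_representative R k s =
     Supermatrix (t_power R (int k)) (odd_polynomial R k s) \<zero>\<^bsub>laurent R\<^esub> \<one>\<^bsub>laurent R\<^esub>"

context supercommutative_ring
begin

lemma t_power_even: "t_power R a \<in> homog (laurent R) 0"
  by (auto simp: t_power_def laurent_homog_iff)

lemma t_power_powser_even: "0 \<le> a \<Longrightarrow> t_power R a \<in> homog (powser R) 0"
  by (auto simp: t_power_def powser_homog_iff)

lemma t_power_0: "t_power R 0 = \<one>\<^bsub>laurent R\<^esub>"
  by (simp add: t_power_def laurent_one)

text \<open>Multiplication by t^a shifts the exponents by a. As for the unit series, the maximum
  keeps the contributing index a in the range of summation when n - b < a.\<close>

lemma t_power_mult:
  assumes f: "f \<in> carrier (laurent R)"
  shows "(t_power R a \<otimes>\<^bsub>laurent R\<^esub> f) n = f (n - a)"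
proof -
  obtain b where b: "\<forall>i<b. f i = \<zero>" using laurent_boundE[OF f] by blast
  have "(t_power R a \<otimes>\<^bsub>laurent R\<^esub> f) n = (\<Oplus>i\<in>{a..max a (n - b)}. t_power R a i \<otimes> f (n - i))"
    by (rule laurent_mult_coeff[OF laurent_homog_closed[OF t_power_even] _ f b]) (auto simp: t_power_def)
  also have "\<dots> = (\<Oplus>i\<in>{a..max a (n - b)}. if a = i then f (n - i) else \<zero>)"
    by (rule finsum_cong') (use laurent_coeff[OF f] in \<open>auto simp: t_power_def\<close>)
  also have "\<dots> = f (n - a)"
    by (subst finsum_singleton) (use laurent_coeff[OF f] in auto)
  finally show ?thesis .
qed

lemma t_power_Units: "t_power R a \<in> Units (even_part (laurent R))"
proof -
  have "t_power R a \<otimes>\<^bsub>laurent R\<^esub> t_power R (- a) = \<one>\<^bsub>laurent R\<^esub>"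
    by (rule ext) (simp add: t_power_mult laurent_homog_closed[OF t_power_even],
      simp add: t_power_def laurent_one)
  then show ?thesis
    using supercommutative_ring.even_Units_iff[OF laurent_supercommutative_ring] t_power_even by blast
qed

lemma t_cochar_closed: "t_cochar R l \<in> carrier (GL11 (laurent R))"
proof -
  interpret L: supercommutative_ring "laurent R" by (rule laurent_supercommutative_ring)
  show ?thesis
    using t_power_Units L.homog_zero[of 1] by (simp add: t_cochar_def L.GL11_carrier_iff del: laurent_zero)
qed

lemma powser_Units: "x \<in> Units (even_part (powser R)) \<Longrightarrow> x \<in> Units (even_part (laurent R))"
  using supercommutative_ring.even_Units_iff[OF laurent_supercommutative_ring]
    supercommutative_ring.even_Units_iff[OF powser_supercommutative_ring] powser_homogD(1)
  by (metis powser_simps(1,2))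

lemma supermatrix_mult_powser: "supermatrix_mult (powser R) = supermatrix_mult (laurent R)"
proof (intro ext)
  fix g h :: "(int \<Rightarrow> 'a) supermatrix"
  show "supermatrix_mult (powser R) g h = supermatrix_mult (laurent R) g h"
    by (cases g; cases h) (simp del: laurent_add)
qed

lemma GL11_powser_subset: "carrier (GL11 (powser R)) \<subseteq> carrier (GL11 (laurent R))"
proof
  interpret L: supercommutative_ring "laurent R" by (rule laurent_supercommutative_ring)
  interpret P: supercommutative_ring "powser R" by (rule powser_supercommutative_ring)
  fix g assume "g \<in> carrier (GL11 (powser R))"
  then show "g \<in> carrier (GL11 (laurent R))"
    by (elim P.GL11_carrierE) (simp add: L.GL11_carrier_iff powser_Units powser_homogD(1))
qed

lemma GL11_powser_subgroup: "subgroup (carrier (GL11 (powser R))) (GL11 (laurent R))"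
proof -
  let ?L = "laurent R" and ?P = "powser R"
  interpret L: supercommutative_ring "laurent R" by (rule laurent_supercommutative_ring)
  interpret P: supercommutative_ring "powser R" by (rule powser_supercommutative_ring)
  interpret G: group "GL11 ?L" by (rule L.GL11_group)
  interpret H: group "GL11 ?P" by (rule P.GL11_group)
  have one: "\<one>\<^bsub>GL11 ?P\<^esub> = \<one>\<^bsub>GL11 ?L\<^esub>"
    by (simp add: L.GL11_one P.GL11_one del: laurent_zero)
  show ?thesis
  proof (rule G.subgroupI)
    show "carrier (GL11 ?P) \<subseteq> carrier (GL11 ?L)"
      by (rule GL11_powser_subset)
    show "carrier (GL11 ?P) \<noteq> {}"
      using H.one_closed by blast
    \<comment> \<open>Product and identity agree in the two groups, so the inverse formed over power
      series is also the inverse over Laurent series.\<close>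
    show "inv\<^bsub>GL11 ?L\<^esub> g \<in> carrier (GL11 ?P)" if g: "g \<in> carrier (GL11 ?P)" for g
    proof -
      have "inv\<^bsub>GL11 ?P\<^esub> g \<otimes>\<^bsub>GL11 ?L\<^esub> g = \<one>\<^bsub>GL11 ?L\<^esub>"
        using H.l_inv[OF g] one supermatrix_mult_powser by simp
      then have "inv\<^bsub>GL11 ?L\<^esub> g = inv\<^bsub>GL11 ?P\<^esub> g"
        using g H.inv_closed[OF g] GL11_powser_subset by (intro G.inv_equality) auto
      then show ?thesis
        using H.inv_closed[OF g] by simp
    qed
    show "g \<otimes>\<^bsub>GL11 ?L\<^esub> h \<in> carrier (GL11 ?P)"
      if "g \<in> carrier (GL11 ?P)" "h \<in> carrier (GL11 ?P)" for g h
      using H.m_closed[OF that] supermatrix_mult_powser by simp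
  qed
qed

lemma Schubert_pts:
  "pts (Schubert l) R = (\<lambda>g. (g \<otimes>\<^bsub>GL11 (laurent R)\<^esub> t_cochar R l) <#\<^bsub>GL11 (laurent R)\<^esub> carrier (GL11 (powser R)))
     ` carrier (GL11 (powser R))"
proof -
  interpret L: supercommutative_ring "laurent R" by (rule laurent_supercommutative_ring)
  interpret G: group "GL11 (laurent R)" by (rule L.GL11_group)
  have "g <#\<^bsub>GL11 (laurent R)\<^esub> (t_cochar R l <#\<^bsub>GL11 (laurent R)\<^esub> carrier (GL11 (powser R)))
      = (g \<otimes>\<^bsub>GL11 (laurent R)\<^esub> t_cochar R l) <#\<^bsub>GL11 (laurent R)\<^esub> carrier (GL11 (powser R))"
    if "g \<in> carrier (GL11 (powser R))" for g
    using that GL11_powser_subset by (intro G.lcos_m_assoc t_cochar_closed) auto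
  then show ?thesis
    by (auto simp: Schubert_def orbit_def)
qed

lemma odd_polynomial_odd:
  assumes "s \<in> {..<k} \<rightarrow>\<^sub>E homog R 1"
  shows "odd_polynomial R k s \<in> homog (powser R) 1"
  using PiE_mem[OF assms] by (auto simp: odd_polynomial_def powser_homog_iff)

lemma Schubert_representative_eq:
  assumes s: "s \<in> {..<k} \<rightarrow>\<^sub>E homog R 1"
  defines "u \<equiv> Supermatrix \<one>\<^bsub>laurent R\<^esub> (odd_polynomial R k s) \<zero>\<^bsub>laurent R\<^esub> \<one>\<^bsub>laurent R\<^esub>"
  shows "u \<in> carrier (GL11 (powser R))"
    and "Schubert_representative R k s = u \<otimes>\<^bsub>GL11 (laurent R)\<^esub> t_cochar R (int k, 0)"
proof -
  interpret L: supercommutative_ring "laurent R" by (rule laurent_supercommutative_ring)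
  interpret P: supercommutative_ring "powser R" by (rule powser_supercommutative_ring)
  have odd: "odd_polynomial R k s \<in> homog (powser R) 1"
    by (rule odd_polynomial_odd[OF s])
  show "u \<in> carrier (GL11 (powser R))"
    using odd P.one_even_Unit P.homog_zero[of 1] by (simp add: u_def P.GL11_carrier_iff del: laurent_zero)
  show "Schubert_representative R k s = u \<otimes>\<^bsub>GL11 (laurent R)\<^esub> t_cochar R (int k, 0)"
    using L.homog_closed[OF powser_homogD(1)[OF odd]] laurent_homog_closed[OF t_power_even]
    by (simp add: Schubert_representative_def u_def t_cochar_def t_power_0 del: laurent_zero laurent_add)
qed

lemma Schubert_representative_closed:
  assumes "s \<in> {..<k} \<rightarrow>\<^sub>E homog R 1"
  shows "Schubert_representative R k s \<in> carrier (GL11 (laurent R))"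
proof -
  interpret L: supercommutative_ring "laurent R" by (rule laurent_supercommutative_ring)
  interpret G: group "GL11 (laurent R)" by (rule L.GL11_group)
  show ?thesis
    using Schubert_representative_eq[OF assms] t_cochar_closed GL11_powser_subset
    by (metis G.m_closed subsetD)
qed

text \<open>Right multiplication by a matrix over power series with last column (y, w) turns the
  last column (p, \<one>) of a representative into (t^k y + p w, w). The quotient of the two entries
  of the last column changes only by a multiple of t^k when w is a unit, and the polynomial p of
  degree below k is its normal form.\<close>

lemma Schubert_representative_bij:
  "bij_betw (\<lambda>s. Schubert_representative R k s <#\<^bsub>GL11 (laurent R)\<^esub> carrier (GL11 (powser R)))
     ({..<k} \<rightarrow>\<^sub>E homog R 1) (pts (Schubert (int k, 0)) R)"
proof -
  let ?L = "laurent R" and ?P = "powser R"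
  interpret L: supercommutative_ring "laurent R" by (rule laurent_supercommutative_ring)
  interpret P: supercommutative_ring "powser R" by (rule powser_supercommutative_ring)
  interpret G: group "GL11 ?L" by (rule L.GL11_group)
  let ?G = "GL11 ?L" and ?H = "carrier (GL11 ?P)"
  let ?\<theta> = "\<lambda>s. Schubert_representative R k s <#\<^bsub>?G\<^esub> ?H"
  let ?T = "t_power R (int k)"
  have TL: "?T \<in> carrier ?L" and TP: "?T \<in> homog ?P 0"
    using laurent_homog_closed[OF t_power_even] t_power_powser_even[of "int k"] by auto
  have mult: "Schubert_representative R k s \<otimes>\<^bsub>?G\<^esub> Supermatrix x y z w =
      Supermatrix (?T \<otimes>\<^bsub>?L\<^esub> x \<oplus>\<^bsub>?L\<^esub> odd_polynomial R k s \<otimes>\<^bsub>?L\<^esub> z)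
        (?T \<otimes>\<^bsub>?L\<^esub> y \<oplus>\<^bsub>?L\<^esub> odd_polynomial R k s \<otimes>\<^bsub>?L\<^esub> w) z w"
    if "x \<in> carrier ?L" "y \<in> carrier ?L" "z \<in> carrier ?L" "w \<in> carrier ?L"
    for s x y z w
    using that by (simp add: Schubert_representative_def del: laurent_zero laurent_add)
  have sub: "?\<theta> s \<in> pts (Schubert (int k, 0)) R" if "s \<in> {..<k} \<rightarrow>\<^sub>E homog R 1" for s
    using Schubert_representative_eq[OF that] by (auto simp: Schubert_pts)
  have inj: "s = s'" if s: "s \<in> {..<k} \<rightarrow>\<^sub>E homog R 1" and s': "s' \<in> {..<k} \<rightarrow>\<^sub>E homog R 1"
    and eq: "?\<theta> s = ?\<theta> s'" for s s'
  proof -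
    obtain h where h: "h \<in> ?H" "Schubert_representative R k s' = Schubert_representative R k s \<otimes>\<^bsub>?G\<^esub> h"
      using eq G.l_coset_eq_iff[OF GL11_powser_subgroup Schubert_representative_closed[OF s]
          Schubert_representative_closed[OF s']] by blast
    obtain x y z w where xyzw: "h = Supermatrix x y z w" "x \<in> Units (even_part ?P)"
      "y \<in> homog ?P 1" "z \<in> homog ?P 1" "w \<in> Units (even_part ?P)"
      using P.GL11_carrierE[OF h(1)] by blast
    have cl: "x \<in> carrier ?L" "y \<in> carrier ?L" "z \<in> carrier ?L" "w \<in> carrier ?L"
      using xyzw(2-) P.homog_closed P.even_Units_closed powser_closed by blast+
    have "w = \<one>\<^bsub>?L\<^esub>"
      and "odd_polynomial R k s' = ?T \<otimes>\<^bsub>?L\<^esub> y \<oplus>\<^bsub>?L\<^esub> odd_polynomial R k s \<otimes>\<^bsub>?L\<^esub> w"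
      using h(2) mult[OF cl, of s] unfolding xyzw(1) by (simp_all add: Schubert_representative_def del: laurent_add)
    moreover have "odd_polynomial R k s \<in> carrier ?L"
      using odd_polynomial_odd[OF s] powser_homogD(1) laurent_homog_closed by blast
    ultimately have eq: "odd_polynomial R k s' = ?T \<otimes>\<^bsub>?L\<^esub> y \<oplus>\<^bsub>?L\<^esub> odd_polynomial R k s"
      by (simp del: laurent_add)
    \<comment> \<open>The coefficient of t^i in t^k y is the coefficient of y at i - k, which is
      negative, so it vanishes for every i below k.\<close>
    have "s' i = s i" if "i < k" for i
    proof -
      have "y (int i - int k) = \<zero>"
        using xyzw(3) that by (simp add: powser_homog_iff)
      moreover have "s i \<in> carrier R"
        using PiE_mem[OF s, of i] that by auto
      ultimately show ?thesis
        using fun_cong[OF eq, of "int i"] that by (simp add: t_power_mult[OF cl(2)] odd_polynomial_def)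
    qed
    then show "s = s'"
      using PiE_ext[OF s s'] by auto
  qed
  have surj: "\<exists>s\<in>{..<k} \<rightarrow>\<^sub>E homog R 1. C = ?\<theta> s" if C: "C \<in> pts (Schubert (int k, 0)) R" for C
  proof -
    obtain g where g: "g \<in> ?H" "C = (g \<otimes>\<^bsub>?G\<^esub> t_cochar R (int k, 0)) <#\<^bsub>?G\<^esub> ?H"
      using C by (auto simp: Schubert_pts)
    obtain a b c d where abcd: "g = Supermatrix a b c d" "a \<in> Units (even_part ?P)"
      "b \<in> homog ?P 1" "c \<in> homog ?P 1" "d \<in> Units (even_part ?P)"
      using P.GL11_carrierE[OF g(1)] by blast
    obtain e where e: "e \<in> homog ?P 0" "d \<otimes>\<^bsub>?L\<^esub> e = \<one>\<^bsub>?L\<^esub>"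
      using abcd(5) unfolding P.even_Units_iff powser_simps by blast
    \<comment> \<open>This quotient of the last column is split as u = t^k w + p, where p collects
      the exponents below k and w is the rest shifted down by k. The coordinates \<open>s\<close>
      are the coefficients of p.\<close>
    define u where "u = b \<otimes>\<^bsub>?L\<^esub> e"
    have u: "u \<in> homog ?P 1"
      using P.odd_even_mult[OF abcd(3) e(1)] by (simp add: u_def)
    define s where "s = (\<lambda>i\<in>{..<k}. u (int i))"
    have s: "s \<in> {..<k} \<rightarrow>\<^sub>E homog R 1"
      using u by (auto simp: s_def powser_homog_iff)
    define p where "p = odd_polynomial R k s"
    have p: "p \<in> homog ?P 1"
      using odd_polynomial_odd[OF s] by (simp add: p_def)
    define w where "w = (\<lambda>n. if n < 0 then \<zero> else u (n + int k))"
    have w: "w \<in> homog ?P 1"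
      using u by (auto simp: w_def powser_homog_iff)
    note L = laurent_homog_closed[OF powser_homogD(1)]
    have cl: "a \<in> carrier ?L" "b \<in> carrier ?L" "c \<in> carrier ?L"
        "d \<in> carrier ?L" "e \<in> carrier ?L" "p \<in> carrier ?L" "w \<in> carrier ?L"
      using L[OF P.even_Units_even[OF abcd(2)]] L[OF abcd(3)] L[OF abcd(4)]
        L[OF P.even_Units_even[OF abcd(5)]] L[OF e(1)] L[OF p] L[OF w] by auto
    have u_eq: "u = ?T \<otimes>\<^bsub>?L\<^esub> w \<oplus>\<^bsub>?L\<^esub> p"
    proof
      fix n
      show "u n = (?T \<otimes>\<^bsub>?L\<^esub> w \<oplus>\<^bsub>?L\<^esub> p) n"
      proof -
        have un: "u n \<in> carrier R" "n < 0 \<Longrightarrow> u n = \<zero>"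
          using u homog_closed[of "u n" 1] by (simp_all add: powser_homog_iff)
        have "(?T \<otimes>\<^bsub>?L\<^esub> w) n = (if n < int k then \<zero> else u n)"
          unfolding t_power_mult[OF cl(7)] by (simp add: w_def)
        moreover have "p n = (if n < int k then u n else \<zero>)"
          using un(2) by (simp add: p_def odd_polynomial_def s_def nat_less_iff)
        ultimately show ?thesis
          using un(1) by simp
      qed
    qed
    define x where "x = a \<oplus>\<^bsub>?L\<^esub> \<ominus>\<^bsub>?L\<^esub> (p \<otimes>\<^bsub>?L\<^esub> c)"
    \<comment> \<open>Negation is not a field of the record but is determined by the carrier. The
      negatives formed in Laurent and in power series must be identified before x can be recognized
      as a power series.\<close>
    have mp: "\<ominus>\<^bsub>?L\<^esub> p = \<ominus>\<^bsub>?P\<^esub> p"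
      using L.minus_equality[of "\<ominus>\<^bsub>?P\<^esub> p" p] P.l_neg[of p] P.homog_closed[OF p]
        P.a_inv_closed[of p] powser_closed by (metis powser_simps(3,4))
    have x_eq: "x = a \<oplus>\<^bsub>?L\<^esub> (\<ominus>\<^bsub>?P\<^esub> p) \<otimes>\<^bsub>?L\<^esub> c"
      using cl by (simp add: x_def L.l_minus mp[symmetric] del: laurent_add)
    have x: "x \<in> Units (even_part ?P)"
      using P.even_Units_add_odd_mult(1)[OF abcd(2) P.homog_minus[OF p] abcd(4)]
      by (simp add: x_eq del: laurent_add)
    have xL: "x \<in> carrier ?L"
      using L[OF P.even_Units_even[OF x]] .
    \<comment> \<open>This matrix is solved from (representative) \<otimes> h = g t^\<lambda>. The
      lower row has to be that of g t^\<lambda>; then the upper row forces x = a - p c and, from b =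
      u d = t^k w d + p d, the upper right entry w d.\<close>
    let ?h = "Supermatrix x (w \<otimes>\<^bsub>?L\<^esub> d) (c \<otimes>\<^bsub>?L\<^esub> ?T) d"
    have h: "?h \<in> ?H"
      using x abcd P.odd_even_mult[OF w P.even_Units_even[OF abcd(5)]] P.odd_even_mult[OF abcd(4) TP]
      by (simp add: P.GL11_carrier_iff)
    have e1: "?T \<otimes>\<^bsub>?L\<^esub> x \<oplus>\<^bsub>?L\<^esub> p \<otimes>\<^bsub>?L\<^esub> (c \<otimes>\<^bsub>?L\<^esub> ?T) = a \<otimes>\<^bsub>?L\<^esub> ?T"
    proof -
      have "?T \<otimes>\<^bsub>?L\<^esub> x = x \<otimes>\<^bsub>?L\<^esub> ?T"
        by (rule L.even_commute[OF t_power_even xL])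
      moreover have "p \<otimes>\<^bsub>?L\<^esub> (c \<otimes>\<^bsub>?L\<^esub> ?T) = (p \<otimes>\<^bsub>?L\<^esub> c) \<otimes>\<^bsub>?L\<^esub> ?T"
        using cl TL by (simp add: L.m_assoc)
      moreover have "x \<oplus>\<^bsub>?L\<^esub> p \<otimes>\<^bsub>?L\<^esub> c = a"
        using cl by (simp add: x_def L.a_assoc L.l_neg del: laurent_add laurent_zero)
      ultimately show ?thesis
        using cl TL xL L.l_distr[of x "p \<otimes>\<^bsub>?L\<^esub> c" ?T] by (simp del: laurent_add)
    qed
    have e2: "?T \<otimes>\<^bsub>?L\<^esub> (w \<otimes>\<^bsub>?L\<^esub> d) \<oplus>\<^bsub>?L\<^esub> p \<otimes>\<^bsub>?L\<^esub> d = b"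
    proof -
      have "?T \<otimes>\<^bsub>?L\<^esub> (w \<otimes>\<^bsub>?L\<^esub> d) \<oplus>\<^bsub>?L\<^esub> p \<otimes>\<^bsub>?L\<^esub> d = u \<otimes>\<^bsub>?L\<^esub> d"
        using cl TL by (simp add: u_eq L.l_distr L.m_assoc del: laurent_add)
      also have "\<dots> = b \<otimes>\<^bsub>?L\<^esub> (d \<otimes>\<^bsub>?L\<^esub> e)"
        using cl L.even_commute[OF powser_homogD(1)[OF e(1)] cl(4)] by (simp add: u_def L.m_assoc)
      finally show ?thesis
        using e cl by simp
    qed
    have "g \<otimes>\<^bsub>?G\<^esub> t_cochar R (int k, 0) = Supermatrix (a \<otimes>\<^bsub>?L\<^esub> ?T) b (c \<otimes>\<^bsub>?L\<^esub> ?T) d"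
      using cl TL by (simp add: abcd(1) t_cochar_def t_power_0 del: laurent_add laurent_zero)
    also have "\<dots> = Schubert_representative R k s \<otimes>\<^bsub>?G\<^esub> ?h"
      using mult[OF xL, of "w \<otimes>\<^bsub>?L\<^esub> d" "c \<otimes>\<^bsub>?L\<^esub> ?T" d s] cl TL e1 e2
      unfolding p_def[symmetric] by (simp del: laurent_add)
    finally have "Schubert_representative R k s <#\<^bsub>?G\<^esub> ?H = C"
      using G.l_coset_eq_iff[OF GL11_powser_subgroup Schubert_representative_closed[OF s],
          of "g \<otimes>\<^bsub>?G\<^esub> t_cochar R (int k, 0)"] h g G.m_closed[OF subsetD[OF GL11_powser_subset g(1)] t_cochar_closed]
      by blast
    then show ?thesis
      using s by blast
  qed
  show ?thesis
    using sub inj surj unfolding bij_betw_def inj_on_def by blast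
qed

lemma swap_t_cochar: "swap_supermatrix (t_cochar R (a, b)) = t_cochar R (b, a)"
  by (simp add: t_cochar_def)

lemma swap_GL11_powser: "swap_supermatrix ` carrier (GL11 (powser R)) = carrier (GL11 (powser R))"
proof -
  interpret P: supercommutative_ring "powser R" by (rule powser_supercommutative_ring)
  have "swap_supermatrix g \<in> carrier (GL11 (powser R))" if "g \<in> carrier (GL11 (powser R))" for g
    using P.swap_supermatrix_hom that by (auto simp: hom_def)
  then show ?thesis
    by (metis image_subsetI image_eqI subset_antisym subsetI swap_swap_supermatrix)
qed

lemma swap_Schubert_pts:
  assumes "C \<in> pts (Schubert (a, b)) R"
  shows "swap_supermatrix ` C \<in> pts (Schubert (b, a)) R"
proof -
  interpret L: supercommutative_ring "laurent R" by (rule laurent_supercommutative_ring)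
  interpret G: group "GL11 (laurent R)" by (rule L.GL11_group)
  let ?G = "GL11 (laurent R)" and ?H = "carrier (GL11 (powser R))"
  obtain g where g: "g \<in> ?H" "C = (g \<otimes>\<^bsub>?G\<^esub> t_cochar R (a, b)) <#\<^bsub>?G\<^esub> ?H"
    using assms by (auto simp: Schubert_pts)
  have gG: "g \<in> carrier ?G"
    using g(1) GL11_powser_subset by blast
  have "swap_supermatrix ` C = swap_supermatrix (g \<otimes>\<^bsub>?G\<^esub> t_cochar R (a, b)) <#\<^bsub>?G\<^esub> ?H"
    unfolding g(2)
    by (subst l_coset_image_hom[OF L.swap_supermatrix_hom _ GL11_powser_subset])
       (use G.m_closed[OF gG t_cochar_closed] in \<open>auto simp: swap_GL11_powser\<close>)
  also have "swap_supermatrix (g \<otimes>\<^bsub>?G\<^esub> t_cochar R (a, b)) = swap_supermatrix g \<otimes>\<^bsub>?G\<^esub> t_cochar R (b, a)"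
    using hom_mult[OF L.swap_supermatrix_hom gG t_cochar_closed] by (simp only: swap_t_cochar)
  finally show ?thesis
    using g(1) swap_GL11_powser by (auto simp: Schubert_pts)
qed

lemma swap_Schubert_bij:
  "bij_betw (image swap_supermatrix) (pts (Schubert (a, b)) R) (pts (Schubert (b, a)) R)"
  by (rule bij_betw_byWitness[of _ "image swap_supermatrix"])
     (auto simp: image_image swap_Schubert_pts)

lemma Schubert_pts_subset: "C \<in> pts (Schubert l) R \<Longrightarrow> C \<subseteq> carrier (GL11 (laurent R))"
proof -
  interpret L: supercommutative_ring "laurent R" by (rule laurent_supercommutative_ring)
  interpret G: group "GL11 (laurent R)" by (rule L.GL11_group)
  assume "C \<in> pts (Schubert l) R"
  then obtain g where g: "g \<in> carrier (GL11 (powser R))"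
    "C = (g \<otimes>\<^bsub>GL11 (laurent R)\<^esub> t_cochar R l) <#\<^bsub>GL11 (laurent R)\<^esub> carrier (GL11 (powser R))"
    by (auto simp: Schubert_pts)
  show "C \<subseteq> carrier (GL11 (laurent R))"
    unfolding g(2) using g(1) GL11_powser_subset
    by (intro G.l_coset_subset_G[OF GL11_powser_subset] G.m_closed[OF _ t_cochar_closed]) auto
qed

end

text \<open>The exchange commutes with the coefficientwise action of \<phi>, respects products of
  sets and preserves the matrices over power series. The map on points is that of the Grassmannian
  for every cocharacter, which is why \<open>l'\<close> can be arbitrary.\<close>

lemma Schubert_map_swap:
  assumes "supercommutative_ring R" "supercommutative_ring S" and phi: "\<phi> \<in> graded_ring_hom R S"
    and C: "C \<in> pts (Schubert l) R"
  shows "swap_supermatrix ` pts_map (Schubert l) R S \<phi> C = pts_map (Schubert l') R S \<phi> (swap_supermatrix ` C)"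
proof -
  interpret R: supercommutative_ring R by fact
  interpret S: supercommutative_ring S by fact
  interpret LS: supercommutative_ring "laurent S" by (rule S.laurent_supercommutative_ring)
  let ?\<psi> = "map_supermatrix (\<lambda>f. \<phi> \<circ> f)"
  have "?\<psi> ` C \<subseteq> carrier (GL11 (laurent S))"
    using R.Schubert_pts_subset[OF C]
      GL11_hom[OF R.laurent_supercommutative_ring LS.supercommutative_ring_axioms laurent_map_hom[OF assms(1-3)]]
    by (auto simp: hom_def)
  then show ?thesis
    by (simp add: Schubert_def affine_Grassmannian_def S.swap_GL11_powser
        set_mult_image_hom[OF LS.swap_supermatrix_hom _ S.GL11_powser_subset])
       (simp add: image_image swap_map_supermatrix)
qed

lemma Schubert_map_representative:
  assumes "supercommutative_ring R" "supercommutative_ring S" and phi: "\<phi> \<in> graded_ring_hom R S"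
    and s: "s \<in> {..<k} \<rightarrow>\<^sub>E homog R 1"
  shows "pts_map (Schubert l) R S \<phi> (Schubert_representative R k s <#\<^bsub>GL11 (laurent R)\<^esub> carrier (GL11 (powser R)))
    = Schubert_representative S k (\<lambda>i\<in>{..<k}. \<phi> (s i)) <#\<^bsub>GL11 (laurent S)\<^esub> carrier (GL11 (powser S))"
proof -
  interpret R: supercommutative_ring R by fact
  interpret S: supercommutative_ring S by fact
  interpret LR: supercommutative_ring "laurent R" by (rule R.laurent_supercommutative_ring)
  interpret LS: supercommutative_ring "laurent S" by (rule S.laurent_supercommutative_ring)
  let ?H = "carrier (GL11 (powser R))" and ?K = "carrier (GL11 (powser S))"
    and ?GR = "GL11 (laurent R)" and ?GS = "GL11 (laurent S)"
  let ?\<psi> = "map_supermatrix (\<lambda>f. \<phi> \<circ> f)"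
  have hom: "?\<psi> \<in> hom ?GR ?GS"
    by (rule GL11_hom[OF LR.supercommutative_ring_axioms LS.supercommutative_ring_axioms
          laurent_map_hom[OF assms(1-3)]])
  have "?\<psi> \<in> hom (GL11 (powser R)) (GL11 (powser S))"
    by (rule GL11_hom[OF R.powser_supercommutative_ring S.powser_supercommutative_ring
          powser_map_hom[OF assms(1-3)]])
  then have "?\<psi> ` ?H \<subseteq> ?K"
    by (auto simp: hom_def)
  then have "?\<psi> ` (Schubert_representative R k s <#\<^bsub>?GR\<^esub> ?H)
      <#>\<^bsub>?GS\<^esub> ?K
    = ?\<psi> (Schubert_representative R k s) <#\<^bsub>?GS\<^esub> ?K"
    by (intro coset_push_forward LR.GL11_group LS.GL11_group hom R.GL11_powser_subgroup
        S.GL11_powser_subgroup R.Schubert_representative_closed[OF s])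
  moreover have "?\<psi> (Schubert_representative R k s) = Schubert_representative S k (\<lambda>i\<in>{..<k}. \<phi> (s i))"
    using graded_ring_homD(4)[OF phi] graded_ring_hom_zero[OF assms(1-3)]
    by (auto simp: Schubert_representative_def odd_polynomial_def t_power_def R.laurent_one S.laurent_one
        fun_eq_iff)
  ultimately show ?thesis
    by (simp add: Schubert_def affine_Grassmannian_def)
qed


section \<open>Maximal ideals and free modules\<close>

lemma (in cring) cring_idealI:
  assumes "I \<subseteq> carrier R" "\<zero> \<in> I" "\<And>a b. a \<in> I \<Longrightarrow> b \<in> I \<Longrightarrow> a \<oplus> b \<in> I"
    and mult: "\<And>a x. a \<in> I \<Longrightarrow> x \<in> carrier R \<Longrightarrow> x \<otimes> a \<in> I"
  shows "ideal I R"
proof (rule idealI[OF ring_axioms])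
  show "subgroup I (add_monoid R)"
  proof (rule add.subgroupI)
    show "I \<noteq> {}" using assms(2) by blast
    show "\<ominus> a \<in> I" if "a \<in> I" for a
      using mult[OF that, of "\<ominus> \<one>"] assms(1) that by (simp add: l_minus subset_iff)
  qed (use assms in auto)
  show "a \<otimes> x \<in> I" if "a \<in> I" "x \<in> carrier R" for a x
    using mult[OF that] m_comm[of a x] assms(1) that by (simp add: subset_iff)
qed (rule mult)

text \<open>Zorn's lemma applies to the ideals above I that omit \<one>: properness stated in this
  form passes to unions of chains.\<close>

lemma (in cring) ex_maximalideal:
  assumes I: "ideal I R" "\<one> \<notin> I"
  shows "\<exists>M. maximalideal M R \<and> I \<subseteq> M"
proof -
  define A where "A = {J. ideal J R \<and> I \<subseteq> J \<and> \<one> \<notin> J}"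
  have "\<exists>M\<in>A. \<forall>J\<in>A. M \<subseteq> J \<longrightarrow> J = M"
  proof (rule subset_Zorn_nonempty)
    show "A \<noteq> {}" using I by (auto simp: A_def)
    fix C assume C: "C \<noteq> {}" "subset.chain A C"
    have A: "ideal J R" "I \<subseteq> J" "\<one> \<notin> J" if "J \<in> C" for J
      using C(2) that unfolding subset_chain_def A_def by blast+
    have dir: "\<exists>L\<in>C. J \<subseteq> L \<and> K \<subseteq> L" if J: "J \<in> C" and K: "K \<in> C" for J K
    proof -
      have "J \<subseteq> K \<or> K \<subseteq> J"
        using C(2) J K by (simp add: subset_chain_def)
      then show ?thesis
        using J K by blast
    qed
    have "ideal (\<Union>C) R"
    proof (rule cring_idealI)
      show "\<Union>C \<subseteq> carrier R"
        using A(1) ideal.Icarr by fastforce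
      show "\<zero> \<in> \<Union>C"
        using C(1) A(1) additive_subgroup.zero_closed[OF ideal.axioms(1)] by blast
      show "a \<oplus> b \<in> \<Union>C" if ab: "a \<in> \<Union>C" "b \<in> \<Union>C" for a b
      proof -
        obtain L where "L \<in> C" "a \<in> L" "b \<in> L"
          using ab dir by blast
        then show ?thesis
          using additive_subgroup.a_closed[OF ideal.axioms(1)[OF A(1)]] by blast
      qed
      show "x \<otimes> a \<in> \<Union>C" if "a \<in> \<Union>C" "x \<in> carrier R" for a x
        using that ideal.I_l_closed[OF A(1)] by blast
    qed
    moreover have "I \<subseteq> \<Union>C" "\<one> \<notin> \<Union>C"
      using A(2,3) C(1) by blast+
    ultimately show "\<Union>C \<in> A"
      by (simp add: A_def)
  qed
  then obtain M where M: "M \<in> A" "\<And>J. J \<in> A \<Longrightarrow> M \<subseteq> J \<Longrightarrow> J = M" by blast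
  have "maximalideal M R"
  proof (rule maximalidealI)
    show "ideal M R" "carrier R \<noteq> M"
      using M(1) one_closed by (auto simp: A_def)
    show "J = M \<or> J = carrier R" if "ideal J R" "M \<subseteq> J" "J \<subseteq> carrier R" for J
    proof (cases "\<one> \<in> J")
      case True
      then show ?thesis using ideal.one_imp_carrier[OF that(1)] by blast
    next
      case False
      then show ?thesis using M that by (auto simp: A_def)
    qed
  qed
  then show ?thesis
    using M(1) by (auto simp: A_def)
qed

context supercommutative_ring
begin

lemma even_part_simps [simp]:
  "carrier (even_part R) = homog R 0" "\<zero>\<^bsub>even_part R\<^esub> = \<zero>" "\<one>\<^bsub>even_part R\<^esub> = \<one>"
  "a \<otimes>\<^bsub>even_part R\<^esub> b = a \<otimes> b" "a \<oplus>\<^bsub>even_part R\<^esub> b = a \<oplus> b"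
  by (simp_all add: even_part_def)

text \<open>This is the local-global principle of the classification. To obtain \<one> in an ideal
  of even elements it suffices to find, for each prime, a member outside that prime. It is applied
  to an ideal of first coordinates and to an annihilator.\<close>

lemma even_ideal_eq_unit:
  assumes "I \<subseteq> homog R 0" "\<zero> \<in> I" "\<And>a b. a \<in> I \<Longrightarrow> b \<in> I \<Longrightarrow> a \<oplus> b \<in> I"
    and "\<And>a x. a \<in> I \<Longrightarrow> x \<in> homog R 0 \<Longrightarrow> x \<otimes> a \<in> I"
    and no_prime: "\<And>P. primeideal P (even_part R) \<Longrightarrow> \<not> I \<subseteq> P"
  shows "\<one> \<in> I"
proof (rule ccontr)
  interpret E: cring "even_part R" by (rule even_part_cring)
  assume "\<one> \<notin> I"
  moreover have "ideal I (even_part R)"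
    by (rule E.cring_idealI) (use assms in auto)
  ultimately obtain M where "maximalideal M (even_part R)" "I \<subseteq> M"
    using E.ex_maximalideal[of I] by auto
  then show False
    using no_prime E.maximalideal_prime by blast
qed

lemma even_primeidealD:
  assumes "primeideal P (even_part R)"
  shows "P \<subseteq> homog R 0" "\<zero> \<in> P" "\<one> \<notin> P"
    "a \<in> P \<Longrightarrow> b \<in> P \<Longrightarrow> a \<oplus> b \<in> P" "a \<in> P \<Longrightarrow> \<ominus> a \<in> P"
    "a \<in> P \<Longrightarrow> x \<in> homog R 0 \<Longrightarrow> x \<otimes> a \<in> P" "a \<in> P \<Longrightarrow> x \<in> homog R 0 \<Longrightarrow> a \<otimes> x \<in> P"
    "x \<in> homog R 0 \<Longrightarrow> y \<in> homog R 0 \<Longrightarrow> x \<otimes> y \<in> P \<Longrightarrow> x \<in> P \<or> y \<in> P"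
proof -
  interpret P: primeideal P "even_part R" by fact
  show "P \<subseteq> homog R 0" using P.a_subset by simp
  show "\<zero> \<in> P" using additive_subgroup.zero_closed[OF P.additive_subgroup_axioms] by simp
  show "\<one> \<notin> P" using P.one_imp_carrier P.I_notcarr by auto
  show "a \<in> P \<Longrightarrow> b \<in> P \<Longrightarrow> a \<oplus> b \<in> P" using additive_subgroup.a_closed[OF P.additive_subgroup_axioms, of a b] by simp
  show l: "a \<in> P \<Longrightarrow> x \<in> homog R 0 \<Longrightarrow> x \<otimes> a \<in> P" for x using P.I_l_closed[of a x] by simp
  show "a \<in> P \<Longrightarrow> x \<in> homog R 0 \<Longrightarrow> a \<otimes> x \<in> P" using P.I_r_closed[of a x] by simp
  show "a \<in> P \<Longrightarrow> \<ominus> a \<in> P"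
  proof -
    assume a: "a \<in> P"
    then have "a \<in> carrier R" using \<open>P \<subseteq> homog R 0\<close> by auto
    then show "\<ominus> a \<in> P" using l[OF a, of "\<ominus> \<one>"] by (simp add: l_minus)
  qed
  show "x \<in> homog R 0 \<Longrightarrow> y \<in> homog R 0 \<Longrightarrow> x \<otimes> y \<in> P \<Longrightarrow> x \<in> P \<or> y \<in> P"
    using P.I_prime[of x y] by simp
qed

section \<open>Free supermodules and their submodules\<close>

lemma free_module_simps:
  "carrier (free_module R p q) = {..<p + q} \<rightarrow>\<^sub>E carrier R"
  "\<zero>\<^bsub>free_module R p q\<^esub> = (\<lambda>i\<in>{..<p + q}. \<zero>)"
  "v \<oplus>\<^bsub>free_module R p q\<^esub> w = (\<lambda>i\<in>{..<p + q}. v i \<oplus> w i)"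
  "r \<odot>\<^bsub>free_module R p q\<^esub> v = (\<lambda>i\<in>{..<p + q}. r \<otimes> v i)"
  "homog (free_module R p q) j = (\<Pi>\<^sub>E i\<in>{..<p + q}. homog R (j + coord_parity p i))"
  by (simp_all add: free_module_def)

lemma free_module_closed:
  assumes "v \<in> carrier (free_module R p q)" "i < p + q"
  shows "v i \<in> carrier R"
  using PiE_mem[of v "{..<p + q}"] assms by (auto simp: free_module_simps)

lemma free_module_ext:
  assumes "v \<in> carrier (free_module R p q)" "w \<in> carrier (free_module R p q)"
    and "\<And>i. i < p + q \<Longrightarrow> v i = w i"
  shows "v = w"
  by (rule PiE_ext[where k = "{..<p + q}"]) (use assms in \<open>auto simp: free_module_simps\<close>)

text \<open>A superalgebra need not be commutative, whereas the scalars of the locale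
  \<open>module\<close> form a \<open>cring\<close>. The module laws are therefore proved directly
  on coordinates.\<close>

lemma free_module_abelian_group: "abelian_group (free_module R p q)"
proof (rule abelian_groupI)
  let ?F = "free_module R p q"
  show zero: "\<zero>\<^bsub>?F\<^esub> \<in> carrier ?F"
    by (auto simp: free_module_simps)
  show add: "v \<oplus>\<^bsub>?F\<^esub> w \<in> carrier ?F" if "v \<in> carrier ?F" "w \<in> carrier ?F" for v w
    using free_module_closed[OF that(1)] free_module_closed[OF that(2)] by (auto simp: free_module_simps)
  show "v \<oplus>\<^bsub>?F\<^esub> w \<oplus>\<^bsub>?F\<^esub> u = v \<oplus>\<^bsub>?F\<^esub> (w \<oplus>\<^bsub>?F\<^esub> u)"
    if "v \<in> carrier ?F" "w \<in> carrier ?F" "u \<in> carrier ?F" for v w u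
    using free_module_closed[OF that(1)] free_module_closed[OF that(2)] free_module_closed[OF that(3)]
    by (auto simp: free_module_simps a_assoc)
  show "v \<oplus>\<^bsub>?F\<^esub> w = w \<oplus>\<^bsub>?F\<^esub> v" if "v \<in> carrier ?F" "w \<in> carrier ?F" for v w
    using free_module_closed[OF that(1)] free_module_closed[OF that(2)]
    by (auto simp: free_module_simps a_comm)
  show "\<zero>\<^bsub>?F\<^esub> \<oplus>\<^bsub>?F\<^esub> v = v" if "v \<in> carrier ?F" for v
    by (rule free_module_ext[OF add[OF zero that] that])
       (simp add: free_module_simps free_module_closed[OF that])
  show "\<exists>w\<in>carrier ?F. w \<oplus>\<^bsub>?F\<^esub> v = \<zero>\<^bsub>?F\<^esub>" if "v \<in> carrier ?F" for v
  proof (rule bexI)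
    show "(\<lambda>i\<in>{..<p + q}. \<ominus> v i) \<oplus>\<^bsub>?F\<^esub> v = \<zero>\<^bsub>?F\<^esub>"
      using free_module_closed[OF that] by (auto simp: free_module_simps l_neg)
    show "(\<lambda>i\<in>{..<p + q}. \<ominus> v i) \<in> carrier ?F"
      using free_module_closed[OF that] by (auto simp: free_module_simps)
  qed
qed

lemma free_module_smult_closed:
  "r \<in> carrier R \<Longrightarrow> v \<in> carrier (free_module R p q) \<Longrightarrow> r \<odot>\<^bsub>free_module R p q\<^esub> v \<in> carrier (free_module R p q)"
  using free_module_closed[of v p q] by (auto simp: free_module_simps)

lemma free_module_smult_r_distr:
  assumes "r \<in> carrier R" "v \<in> carrier (free_module R p q)" "w \<in> carrier (free_module R p q)"
  shows "r \<odot>\<^bsub>free_module R p q\<^esub> (v \<oplus>\<^bsub>free_module R p q\<^esub> w)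
    = r \<odot>\<^bsub>free_module R p q\<^esub> v \<oplus>\<^bsub>free_module R p q\<^esub> r \<odot>\<^bsub>free_module R p q\<^esub> w"
  using assms(1) free_module_closed[OF assms(2)] free_module_closed[OF assms(3)]
  by (auto simp: free_module_simps r_distr)

lemma free_module_smult_l_distr:
  assumes "r \<in> carrier R" "s \<in> carrier R" "v \<in> carrier (free_module R p q)"
  shows "(r \<oplus> s) \<odot>\<^bsub>free_module R p q\<^esub> v
    = r \<odot>\<^bsub>free_module R p q\<^esub> v \<oplus>\<^bsub>free_module R p q\<^esub> s \<odot>\<^bsub>free_module R p q\<^esub> v"
  using assms(1,2) free_module_closed[OF assms(3)] by (auto simp: free_module_simps l_distr)

lemma free_module_smult_assoc:
  assumes "r \<in> carrier R" "s \<in> carrier R" "v \<in> carrier (free_module R p q)"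
  shows "(r \<otimes> s) \<odot>\<^bsub>free_module R p q\<^esub> v = r \<odot>\<^bsub>free_module R p q\<^esub> (s \<odot>\<^bsub>free_module R p q\<^esub> v)"
  using assms(1,2) free_module_closed[OF assms(3)] by (auto simp: free_module_simps m_assoc)

lemma free_module_smult_one:
  assumes "v \<in> carrier (free_module R p q)"
  shows "\<one> \<odot>\<^bsub>free_module R p q\<^esub> v = v"
  using free_module_closed[OF assms]
  by (intro free_module_ext[OF free_module_smult_closed[OF one_closed assms] assms]) (auto simp: free_module_simps)

lemma free_module_minus:
  assumes v: "v \<in> carrier (free_module R p q)"
  shows "\<ominus>\<^bsub>free_module R p q\<^esub> v = (\<ominus> \<one>) \<odot>\<^bsub>free_module R p q\<^esub> v"
proof -
  interpret F: abelian_group "free_module R p q" by (rule free_module_abelian_group)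
  have "(\<ominus> \<one>) \<odot>\<^bsub>free_module R p q\<^esub> v \<oplus>\<^bsub>free_module R p q\<^esub> v = \<zero>\<^bsub>free_module R p q\<^esub>"
    using free_module_closed[OF v] by (auto simp: free_module_simps l_minus l_neg)
  then show ?thesis
    using v free_module_smult_closed[OF _ v, of "\<ominus> \<one>"] by (intro F.minus_equality) auto
qed

text \<open>Negation is multiplication by the scalar \<ominus> \<one>, so closure under scalars
  supplies the inverses needed for a subgroup.\<close>

lemma free_submoduleI:
  assumes sub: "N \<subseteq> carrier (free_module R p q)" and "N \<noteq> {}"
    and "\<And>v w. v \<in> N \<Longrightarrow> w \<in> N \<Longrightarrow> v \<oplus>\<^bsub>free_module R p q\<^esub> w \<in> N"
    and smult: "\<And>r v. r \<in> carrier R \<Longrightarrow> v \<in> N \<Longrightarrow> r \<odot>\<^bsub>free_module R p q\<^esub> v \<in> N"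
  shows "submodule N R (free_module R p q)"
proof -
  interpret F: abelian_group "free_module R p q" by (rule free_module_abelian_group)
  show ?thesis
  proof (intro submodule.intro submodule_axioms.intro F.add.subgroupI)
    show "\<ominus>\<^bsub>free_module R p q\<^esub> v \<in> N" if "v \<in> N" for v
      using smult[OF _ that, of "\<ominus> \<one>"] free_module_minus[of v] sub that by auto
  qed (use assms in auto)
qed

lemma free_submoduleD:
  assumes "submodule N R (free_module R p q)"
  shows "N \<subseteq> carrier (free_module R p q)" "\<zero>\<^bsub>free_module R p q\<^esub> \<in> N"
    "v \<in> N \<Longrightarrow> w \<in> N \<Longrightarrow> v \<oplus>\<^bsub>free_module R p q\<^esub> w \<in> N"
    "r \<in> carrier R \<Longrightarrow> v \<in> N \<Longrightarrow> r \<odot>\<^bsub>free_module R p q\<^esub> v \<in> N"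
  using subgroup.subset[OF submodule.axioms(1)[OF assms]] subgroup.one_closed[OF submodule.axioms(1)[OF assms]]
    subgroup.m_closed[OF submodule.axioms(1)[OF assms]] submodule.smult_closed[OF assms] by auto

end

text \<open>\<^const>\<open>finsum\<close> over one index, for a record that is not known to be a commutative monoid.\<close>

lemma finsum_singleton_raw:
  assumes "\<zero>\<^bsub>G\<^esub> \<in> carrier G" "f a \<in> carrier G" "f a \<oplus>\<^bsub>G\<^esub> \<zero>\<^bsub>G\<^esub> = f a"
  shows "finsum G f {a} = f a"
proof -
  let ?D = "carrier (add_monoid G)" and ?f = "monoid.mult (add_monoid G) \<circ> f" and ?e = "\<one>\<^bsub>add_monoid G\<^esub>"
  have "({a}, f a) \<in> foldSetD ?D ?f ?e"
    using foldSetD.insertI[of a "{}" ?f ?e ?D] assms by (auto intro: foldSetD.emptyI)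
  moreover have uniq: "z = f a" if "({a}, z) \<in> foldSetD ?D ?f ?e" for z
    using that
  proof cases
    case (insertI x A y)
    then have "x = a" "A = {}" by auto
    moreover have "(A, y) \<in> foldSetD ?D ?f ?e" by fact
    ultimately have "({}, y) \<in> foldSetD ?D ?f ?e" by simp
    then have "y = \<zero>\<^bsub>G\<^esub>" by (elim empty_foldSetDE) simp
    moreover have "z = ?f x y" by fact
    ultimately show ?thesis using \<open>x = a\<close> assms(3) by simp
  qed auto
  ultimately have "foldD ?D ?f ?e {a} = f a"
    unfolding foldD_def by (rule the_equality)
  then show ?thesis
    by (simp add: finsum_def finprod_def)
qed


section \<open>Localization\<close>

text \<open>The operations of a localization are unions over representatives. Once all
  representatives are shown to give the same fraction, the union collapses to that fraction.\<close>

lemma UN_UN_eq_const: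
  assumes "p \<in> A" "q \<in> B"
    and "\<And>x y z w. (x, y) \<in> A \<Longrightarrow> (z, w) \<in> B \<Longrightarrow> g x y z w = c"
  shows "(\<Union>(x, y)\<in>A. \<Union>(z, w)\<in>B. g x y z w) = c"
proof -
  have inner: "(\<Union>(z, w)\<in>B. g x y z w) = c" if "(x, y) \<in> A" for x y
    using assms(2,3) that by (intro SUP_eq_const) auto
  show ?thesis
  proof (rule SUP_eq_const)
    show "A \<noteq> {}" using assms(1) by blast
    show "(case p of (x, y) \<Rightarrow> \<Union>(z, w)\<in>B. g x y z w) = c" if "p \<in> A" for p
    proof (cases p)
      case (Pair x y)
      then show ?thesis using inner[of x y] that by (simp only: prod.case)
    qed
  qed
qed

text \<open>Used to replace coefficient functions on a one-element index set by single coefficients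
  in a statement of unique existence.\<close>

lemma ex1_transfer:
  assumes "\<And>c. P c \<Longrightarrow> Q (f c)" "\<And>c. P c \<Longrightarrow> g (f c) = c"
    and "\<And>d. Q d \<Longrightarrow> f (g d) = d" "\<And>d. Q d \<Longrightarrow> P (g d)"
  shows "(\<exists>!c. P c) \<longleftrightarrow> (\<exists>!d. Q d)"
  using assms by metis

text \<open>The same calculus serves the submodule under study and the ring as a module over itself.
  Denominators are even, hence central, so the usual arguments for fractions survive over scalars
  that need not commute.\<close>

locale module_localization = supercommutative_ring R for R :: "'a superalgebra" (structure) +
  fixes M :: "('a, 'm) graded_module" and S :: "'a set"
  assumes S_even: "S \<subseteq> homog R 0"
    and one_S: "\<one> \<in> S"
    and mult_S: "s \<in> S \<Longrightarrow> t \<in> S \<Longrightarrow> s \<otimes> t \<in> S"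
    and M_group: "abelian_group M"
    and M_smult_closed: "r \<in> carrier R \<Longrightarrow> m \<in> carrier M \<Longrightarrow> r \<odot>\<^bsub>M\<^esub> m \<in> carrier M"
    and M_smult_add: "r \<in> carrier R \<Longrightarrow> m \<in> carrier M \<Longrightarrow> n \<in> carrier M \<Longrightarrow>
      r \<odot>\<^bsub>M\<^esub> (m \<oplus>\<^bsub>M\<^esub> n) = r \<odot>\<^bsub>M\<^esub> m \<oplus>\<^bsub>M\<^esub> r \<odot>\<^bsub>M\<^esub> n"
    and M_smult_assoc: "r \<in> carrier R \<Longrightarrow> s \<in> carrier R \<Longrightarrow> m \<in> carrier M \<Longrightarrow>
      (r \<otimes> s) \<odot>\<^bsub>M\<^esub> m = r \<odot>\<^bsub>M\<^esub> (s \<odot>\<^bsub>M\<^esub> m)"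
    and M_smult_one: "m \<in> carrier M \<Longrightarrow> \<one> \<odot>\<^bsub>M\<^esub> m = m"
begin

lemma S_closed: "s \<in> S \<Longrightarrow> s \<in> carrier R"
  using S_even homog_closed by blast

lemma M_zero: "\<zero>\<^bsub>M\<^esub> \<in> carrier M"
  by (rule abelian_monoid.zero_closed[OF abelian_group.axioms(1)[OF M_group]])

lemma M_smult_zero:
  assumes "r \<in> carrier R"
  shows "r \<odot>\<^bsub>M\<^esub> \<zero>\<^bsub>M\<^esub> = \<zero>\<^bsub>M\<^esub>"
proof -
  interpret M: abelian_group M by (rule M_group)
  have "r \<odot>\<^bsub>M\<^esub> \<zero>\<^bsub>M\<^esub> \<oplus>\<^bsub>M\<^esub> r \<odot>\<^bsub>M\<^esub> \<zero>\<^bsub>M\<^esub> = r \<odot>\<^bsub>M\<^esub> \<zero>\<^bsub>M\<^esub>"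
    using M_smult_add[OF assms M_zero M_zero] by simp
  then show ?thesis
    using M_smult_closed[OF assms M_zero] M.add.r_cancel_one' by metis
qed

lemma S_smult_commute:
  assumes "s \<in> S" "r \<in> carrier R" "m \<in> carrier M"
  shows "r \<odot>\<^bsub>M\<^esub> (s \<odot>\<^bsub>M\<^esub> m) = s \<odot>\<^bsub>M\<^esub> (r \<odot>\<^bsub>M\<^esub> m)"
  using M_smult_assoc[of r s m] M_smult_assoc[of s r m] even_commute[of s r] assms S_closed S_even
  by (auto simp: subset_iff)

text \<open>From m/s = n/t with witness u and n/t = l/r with witness v, the witness for m/s = l/r is
  u \<otimes> v \<otimes> t. The factor t is what allows both given equations to be applied.\<close>

lemma fraction_trans:
  assumes mnl: "m \<in> carrier M" "n \<in> carrier M" "l \<in> carrier M" and str: "s \<in> S" "t \<in> S" "r \<in> S"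
    and u: "u \<in> S" "u \<odot>\<^bsub>M\<^esub> (t \<odot>\<^bsub>M\<^esub> m) = u \<odot>\<^bsub>M\<^esub> (s \<odot>\<^bsub>M\<^esub> n)"
    and v: "v \<in> S" "v \<odot>\<^bsub>M\<^esub> (r \<odot>\<^bsub>M\<^esub> n) = v \<odot>\<^bsub>M\<^esub> (t \<odot>\<^bsub>M\<^esub> l)"
  shows "\<exists>w\<in>S. w \<odot>\<^bsub>M\<^esub> (r \<odot>\<^bsub>M\<^esub> m) = w \<odot>\<^bsub>M\<^esub> (s \<odot>\<^bsub>M\<^esub> l)"
proof (rule bexI)
  note cl = S_closed M_smult_closed mnl str u(1) v(1)
  have assoc: "(u \<otimes> v \<otimes> t) \<odot>\<^bsub>M\<^esub> x = u \<odot>\<^bsub>M\<^esub> (v \<odot>\<^bsub>M\<^esub> (t \<odot>\<^bsub>M\<^esub> x))" if "x \<in> carrier M" for x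
    using that by (simp add: M_smult_assoc cl)
  have "(u \<otimes> v \<otimes> t) \<odot>\<^bsub>M\<^esub> (r \<odot>\<^bsub>M\<^esub> m) = v \<odot>\<^bsub>M\<^esub> (r \<odot>\<^bsub>M\<^esub> (u \<odot>\<^bsub>M\<^esub> (t \<odot>\<^bsub>M\<^esub> m)))"
    using S_smult_commute[of t r m] S_smult_commute[of u r "t \<odot>\<^bsub>M\<^esub> m"]
      S_smult_commute[of u v "r \<odot>\<^bsub>M\<^esub> (t \<odot>\<^bsub>M\<^esub> m)"] by (simp add: assoc cl)
  also have "\<dots> = v \<odot>\<^bsub>M\<^esub> (r \<odot>\<^bsub>M\<^esub> (u \<odot>\<^bsub>M\<^esub> (s \<odot>\<^bsub>M\<^esub> n)))"
    by (simp only: u(2))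
  also have "\<dots> = u \<odot>\<^bsub>M\<^esub> (s \<odot>\<^bsub>M\<^esub> (v \<odot>\<^bsub>M\<^esub> (r \<odot>\<^bsub>M\<^esub> n)))"
    using S_smult_commute[of u r "s \<odot>\<^bsub>M\<^esub> n"] S_smult_commute[of u v "r \<odot>\<^bsub>M\<^esub> (s \<odot>\<^bsub>M\<^esub> n)"]
      S_smult_commute[of s r n] S_smult_commute[of s v "r \<odot>\<^bsub>M\<^esub> n"] by (simp add: cl)
  also have "\<dots> = u \<odot>\<^bsub>M\<^esub> (s \<odot>\<^bsub>M\<^esub> (v \<odot>\<^bsub>M\<^esub> (t \<odot>\<^bsub>M\<^esub> l)))"
    by (simp only: v(2))
  also have "\<dots> = (u \<otimes> v \<otimes> t) \<odot>\<^bsub>M\<^esub> (s \<odot>\<^bsub>M\<^esub> l)"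
    using S_smult_commute[of t s l] S_smult_commute[of s v "t \<odot>\<^bsub>M\<^esub> l"] by (simp add: assoc cl)
  finally show "(u \<otimes> v \<otimes> t) \<odot>\<^bsub>M\<^esub> (r \<odot>\<^bsub>M\<^esub> m) = (u \<otimes> v \<otimes> t) \<odot>\<^bsub>M\<^esub> (s \<odot>\<^bsub>M\<^esub> l)" .
  show "u \<otimes> v \<otimes> t \<in> S"
    using u(1) v(1) str mult_S by blast
qed

lemma fraction_eq_iff:
  assumes mn: "m \<in> carrier M" "n \<in> carrier M" and st: "s \<in> S" "t \<in> S"
  shows "fraction R S M m s = fraction R S M n t \<longleftrightarrow>
    (\<exists>u\<in>S. u \<odot>\<^bsub>M\<^esub> (t \<odot>\<^bsub>M\<^esub> m) = u \<odot>\<^bsub>M\<^esub> (s \<odot>\<^bsub>M\<^esub> n))"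
proof
  assume "fraction R S M m s = fraction R S M n t"
  moreover have "(n, t) \<in> fraction R S M n t"
    using mn st one_S by (auto simp: fraction_def)
  ultimately have "(n, t) \<in> fraction R S M m s"
    by simp
  then show "\<exists>u\<in>S. u \<odot>\<^bsub>M\<^esub> (t \<odot>\<^bsub>M\<^esub> m) = u \<odot>\<^bsub>M\<^esub> (s \<odot>\<^bsub>M\<^esub> n)"
    by (auto simp: fraction_def)
next
  have sub: "fraction R S M m s \<subseteq> fraction R S M n t"
    if mn: "m \<in> carrier M" "n \<in> carrier M" and st: "s \<in> S" "t \<in> S"
    and ex: "\<exists>u\<in>S. u \<odot>\<^bsub>M\<^esub> (t \<odot>\<^bsub>M\<^esub> m) = u \<odot>\<^bsub>M\<^esub> (s \<odot>\<^bsub>M\<^esub> n)" for m n s t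
  proof
    fix x assume "x \<in> fraction R S M m s"
    then obtain l r v where x: "x = (l, r)" "l \<in> carrier M" "r \<in> S" "v \<in> S"
      "v \<odot>\<^bsub>M\<^esub> (r \<odot>\<^bsub>M\<^esub> m) = v \<odot>\<^bsub>M\<^esub> (s \<odot>\<^bsub>M\<^esub> l)"
      by (auto simp: fraction_def)
    obtain u where u: "u \<in> S" "u \<odot>\<^bsub>M\<^esub> (s \<odot>\<^bsub>M\<^esub> n) = u \<odot>\<^bsub>M\<^esub> (t \<odot>\<^bsub>M\<^esub> m)"
      using ex by auto
    show "x \<in> fraction R S M n t"
      using fraction_trans[OF mn(2,1) x(2) st(2,1) x(3) u x(4,5)] x by (auto simp: fraction_def)
  qed
  assume u: "\<exists>u\<in>S. u \<odot>\<^bsub>M\<^esub> (t \<odot>\<^bsub>M\<^esub> m) = u \<odot>\<^bsub>M\<^esub> (s \<odot>\<^bsub>M\<^esub> n)"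
  then have u': "\<exists>u\<in>S. u \<odot>\<^bsub>M\<^esub> (s \<odot>\<^bsub>M\<^esub> n) = u \<odot>\<^bsub>M\<^esub> (t \<odot>\<^bsub>M\<^esub> m)"
    by metis
  show "fraction R S M m s = fraction R S M n t"
    using sub[OF mn st u] sub[OF mn(2,1) st(2,1) u'] by blast
qed

lemma fraction_self: "m \<in> carrier M \<Longrightarrow> s \<in> S \<Longrightarrow> (m, s) \<in> fraction R S M m s"
  using one_S by (auto simp: fraction_def)

text \<open>If u and v witness the change of representative of the scalar and of the vector, then u
  \<otimes> v witnesses that of their product. The auxiliary fact \<open>comm\<close> moves the
  central denominators and witnesses past the scalars to which they are not adjacent.\<close>

lemma fraction_smult:
  assumes rm: "r \<in> carrier R" "m \<in> carrier M" and ts: "t \<in> S" "s \<in> S"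
  shows "fraction R S (regular_module R) r t \<odot>\<^bsub>localization R S M\<^esub> fraction R S M m s
    = fraction R S M (r \<odot>\<^bsub>M\<^esub> m) (t \<otimes> s)"
proof -
  have "fraction R S M (r' \<odot>\<^bsub>M\<^esub> m') (t' \<otimes> s') = fraction R S M (r \<odot>\<^bsub>M\<^esub> m) (t \<otimes> s)"
    if A: "(r', t') \<in> fraction R S (regular_module R) r t" and V: "(m', s') \<in> fraction R S M m s" for r' t' m' s'
  proof -
    obtain u where u: "r' \<in> carrier R" "t' \<in> S" "u \<in> S" "u \<otimes> (t' \<otimes> r) = u \<otimes> (t \<otimes> r')"
      using A by (auto simp: fraction_def regular_module_def)
    obtain v where v: "m' \<in> carrier M" "s' \<in> S" "v \<in> S" "v \<odot>\<^bsub>M\<^esub> (s' \<odot>\<^bsub>M\<^esub> m) = v \<odot>\<^bsub>M\<^esub> (s \<odot>\<^bsub>M\<^esub> m')"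
      using V by (auto simp: fraction_def)
    note cl = S_closed M_smult_closed rm ts u(1-3) v(1-3) M_smult_assoc
    have comm: "a \<otimes> (b \<otimes> c) \<odot>\<^bsub>M\<^esub> (v \<odot>\<^bsub>M\<^esub> (x \<odot>\<^bsub>M\<^esub> y)) = (u \<otimes> v) \<odot>\<^bsub>M\<^esub> ((b \<otimes> x) \<odot>\<^bsub>M\<^esub> (c \<odot>\<^bsub>M\<^esub> y))"
      if "a = u" "b \<in> S" "x \<in> S" "c \<in> carrier R" "y \<in> carrier M" for a b c x y
      using that S_smult_commute[of v c "x \<odot>\<^bsub>M\<^esub> y"] S_smult_commute[of v b "c \<odot>\<^bsub>M\<^esub> (x \<odot>\<^bsub>M\<^esub> y)"]
        S_smult_commute[of x c y] by (simp add: cl)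
    have "(u \<otimes> v) \<odot>\<^bsub>M\<^esub> ((t \<otimes> s) \<odot>\<^bsub>M\<^esub> (r' \<odot>\<^bsub>M\<^esub> m')) = u \<otimes> (t \<otimes> r') \<odot>\<^bsub>M\<^esub> (v \<odot>\<^bsub>M\<^esub> (s \<odot>\<^bsub>M\<^esub> m'))"
      using comm[of u t s r' m'] by (simp add: cl)
    also have "\<dots> = u \<otimes> (t' \<otimes> r) \<odot>\<^bsub>M\<^esub> (v \<odot>\<^bsub>M\<^esub> (s' \<odot>\<^bsub>M\<^esub> m))"
      by (simp only: u(4) v(4))
    also have "\<dots> = (u \<otimes> v) \<odot>\<^bsub>M\<^esub> ((t' \<otimes> s') \<odot>\<^bsub>M\<^esub> (r \<odot>\<^bsub>M\<^esub> m))"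
      using comm[of u t' s' r m] by (simp add: cl)
    finally show ?thesis
      using u v rm ts mult_S M_smult_closed by (subst fraction_eq_iff) blast+
  qed
  note eq = this
  have "(r, t) \<in> fraction R S (regular_module R) r t"
    using rm ts one_S by (auto simp: fraction_def regular_module_def)
  from UN_UN_eq_const[OF this fraction_self[OF rm(2) ts(2)] eq] show ?thesis
    by (simp add: localization_def)
qed

text \<open>This law of the localized addition is what evaluates \<open>finsum\<close> over a single
  index. A representative (n, t) of zero has v n = 0 for some v in S, and multiplying the witness u
  of the other fraction by v removes the extra summand.\<close>

lemma fraction_add_zero:
  assumes m: "m \<in> carrier M" "s \<in> S"
  shows "fraction R S M m s \<oplus>\<^bsub>localization R S M\<^esub> \<zero>\<^bsub>localization R S M\<^esub> = fraction R S M m s"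
proof -
  interpret M: abelian_group M by (rule M_group)
  have "fraction R S M (t \<odot>\<^bsub>M\<^esub> m' \<oplus>\<^bsub>M\<^esub> s' \<odot>\<^bsub>M\<^esub> n) (s' \<otimes> t) = fraction R S M m s"
    if A: "(m', s') \<in> fraction R S M m s" and V: "(n, t) \<in> fraction R S M \<zero>\<^bsub>M\<^esub> \<one>" for m' s' n t
  proof -
    obtain u where u: "m' \<in> carrier M" "s' \<in> S" "u \<in> S" "u \<odot>\<^bsub>M\<^esub> (s' \<odot>\<^bsub>M\<^esub> m) = u \<odot>\<^bsub>M\<^esub> (s \<odot>\<^bsub>M\<^esub> m')"
      using A by (auto simp: fraction_def)
    obtain v where v: "n \<in> carrier M" "t \<in> S" "v \<in> S" "v \<odot>\<^bsub>M\<^esub> n = \<zero>\<^bsub>M\<^esub>"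
      using V M_smult_zero S_closed M_smult_one by (auto simp: fraction_def)
    note cl = S_closed M_smult_closed m u(1-3) v(1-3) M_smult_assoc
    have "(u \<otimes> v) \<odot>\<^bsub>M\<^esub> (s \<odot>\<^bsub>M\<^esub> (t \<odot>\<^bsub>M\<^esub> m' \<oplus>\<^bsub>M\<^esub> s' \<odot>\<^bsub>M\<^esub> n))
        = (u \<otimes> v) \<odot>\<^bsub>M\<^esub> (s \<odot>\<^bsub>M\<^esub> (t \<odot>\<^bsub>M\<^esub> m')) \<oplus>\<^bsub>M\<^esub> (u \<otimes> v) \<odot>\<^bsub>M\<^esub> (s \<odot>\<^bsub>M\<^esub> (s' \<odot>\<^bsub>M\<^esub> n))"
      by (simp add: M_smult_add cl)
    also have "(u \<otimes> v) \<odot>\<^bsub>M\<^esub> (s \<odot>\<^bsub>M\<^esub> (s' \<odot>\<^bsub>M\<^esub> n)) = u \<odot>\<^bsub>M\<^esub> (s \<odot>\<^bsub>M\<^esub> (s' \<odot>\<^bsub>M\<^esub> (v \<odot>\<^bsub>M\<^esub> n)))"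
      using S_smult_commute[of v s "s' \<odot>\<^bsub>M\<^esub> n"] S_smult_commute[of v s' n] by (simp add: cl)
    also have "\<dots> = \<zero>\<^bsub>M\<^esub>"
      by (simp add: v(4) M_smult_zero cl)
    also have "(u \<otimes> v) \<odot>\<^bsub>M\<^esub> (s \<odot>\<^bsub>M\<^esub> (t \<odot>\<^bsub>M\<^esub> m')) = v \<odot>\<^bsub>M\<^esub> (t \<odot>\<^bsub>M\<^esub> (u \<odot>\<^bsub>M\<^esub> (s \<odot>\<^bsub>M\<^esub> m')))"
      using S_smult_commute[of t s m'] S_smult_commute[of u t "s \<odot>\<^bsub>M\<^esub> m'"]
        S_smult_commute[of u v "t \<odot>\<^bsub>M\<^esub> (s \<odot>\<^bsub>M\<^esub> m')"] by (simp add: cl)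
    also have "\<dots> = v \<odot>\<^bsub>M\<^esub> (t \<odot>\<^bsub>M\<^esub> (u \<odot>\<^bsub>M\<^esub> (s' \<odot>\<^bsub>M\<^esub> m)))"
      by (simp only: u(4))
    also have "\<dots> = (u \<otimes> v) \<odot>\<^bsub>M\<^esub> ((s' \<otimes> t) \<odot>\<^bsub>M\<^esub> m)"
      using S_smult_commute[of t s' m] S_smult_commute[of u t "s' \<odot>\<^bsub>M\<^esub> m"]
        S_smult_commute[of u v "t \<odot>\<^bsub>M\<^esub> (s' \<odot>\<^bsub>M\<^esub> m)"] by (simp add: cl)
    finally have "(u \<otimes> v) \<odot>\<^bsub>M\<^esub> (s \<odot>\<^bsub>M\<^esub> (t \<odot>\<^bsub>M\<^esub> m' \<oplus>\<^bsub>M\<^esub> s' \<odot>\<^bsub>M\<^esub> n)) = (u \<otimes> v) \<odot>\<^bsub>M\<^esub> ((s' \<otimes> t) \<odot>\<^bsub>M\<^esub> m)"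
      by (simp add: cl)
    then show ?thesis
      using u(1-3) v(1-3) m mult_S M_smult_closed S_closed M.a_closed
      by (subst fraction_eq_iff) blast+
  qed
  from UN_UN_eq_const[OF fraction_self[OF m] fraction_self[OF M_zero one_S] this] show ?thesis
    by (simp add: localization_def)
qed

lemma localization_carrier:
  "carrier (localization R S M) = {fraction R S M m s | m s. m \<in> carrier M \<and> s \<in> S}"
  "homog (localization R S M) i = {fraction R S M m s | m s. m \<in> homog M i \<and> s \<in> S}"
  "\<zero>\<^bsub>localization R S M\<^esub> = fraction R S M \<zero>\<^bsub>M\<^esub> \<one>"
  by (simp_all add: localization_def)

lemma regular_localization: "module_localization R (regular_module R) S"
proof -
  have "abelian_group (regular_module R)"
  proof (rule abelian_groupI)
    show "\<exists>y\<in>carrier (regular_module R). y \<oplus>\<^bsub>regular_module R\<^esub> x = \<zero>\<^bsub>regular_module R\<^esub>"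
      if "x \<in> carrier (regular_module R)" for x
      using that by (intro bexI[of _ "\<ominus> x"]) (simp_all add: regular_module_def l_neg)
  qed (simp_all add: regular_module_def a_ac)
  then show ?thesis
    by (intro module_localization.intro module_localization_axioms.intro supercommutative_ring_axioms
        S_even one_S mult_S) (simp_all add: regular_module_def r_distr m_assoc)
qed

lemma regular_localization_carrier:
  "carrier (localization R S (regular_module R)) = {fraction R S (regular_module R) r t | r t. r \<in> carrier R \<and> t \<in> S}"
  by (simp add: module_localization.localization_carrier[OF regular_localization]) (simp add: regular_module_def)

text \<open>A basis of rank 1|0 is one even element. Evaluation at index 0 identifies the
  extensional coefficient functions on \<open>{..<1 + 0}\<close> with scalars, and the sum is
  evaluated without any claim that the localization is an abelian group.\<close>

lemma free_of_rank_one_iff: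
  "free_of_rank (carrier (localization R S (regular_module R))) (localization R S M) 1 0 \<longleftrightarrow>
    (\<exists>f\<in>homog (localization R S M) 0. \<forall>x\<in>carrier (localization R S M).
       \<exists>!c. c \<in> carrier (localization R S (regular_module R)) \<and> x = c \<odot>\<^bsub>localization R S M\<^esub> f)"
  if homM: "homog M 0 \<subseteq> carrier M"
proof -
  let ?A = "carrier (localization R S (regular_module R))" and ?L = "localization R S M" and ?E = "{..<1 + 0::nat} \<rightarrow>\<^sub>E carrier (localization R S (regular_module R))"
  have sum: "(\<Oplus>\<^bsub>?L\<^esub>i\<in>{..<1 + 0}. c i \<odot>\<^bsub>?L\<^esub> e i) = c 0 \<odot>\<^bsub>?L\<^esub> e 0"
    if "c 0 \<in> ?A" "e 0 \<in> homog ?L 0" for c :: "nat \<Rightarrow> ('a \<times> 'a) set" and e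
  proof -
    obtain r t where c: "c 0 = fraction R S (regular_module R) r t" "r \<in> carrier R" "t \<in> S"
      using \<open>c 0 \<in> ?A\<close> unfolding regular_localization_carrier by blast
    obtain m s where e: "e 0 = fraction R S M m s" "m \<in> carrier M" "s \<in> S"
      using \<open>e 0 \<in> homog ?L 0\<close> homM by (auto simp: localization_carrier)
    have ce: "c 0 \<odot>\<^bsub>?L\<^esub> e 0 = fraction R S M (r \<odot>\<^bsub>M\<^esub> m) (t \<otimes> s)"
      unfolding c(1) e(1) by (rule fraction_smult) (use c e in auto)
    have "(\<Oplus>\<^bsub>?L\<^esub>i\<in>{0}. c i \<odot>\<^bsub>?L\<^esub> e i) = c 0 \<odot>\<^bsub>?L\<^esub> e 0"
    proof (rule finsum_singleton_raw)
      show "\<zero>\<^bsub>?L\<^esub> \<in> carrier ?L"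
        using M_zero one_S by (auto simp: localization_carrier)
      show "c 0 \<odot>\<^bsub>?L\<^esub> e 0 \<in> carrier ?L"
        unfolding ce localization_carrier using c e mult_S M_smult_closed by blast
      show "c 0 \<odot>\<^bsub>?L\<^esub> e 0 \<oplus>\<^bsub>?L\<^esub> \<zero>\<^bsub>?L\<^esub> = c 0 \<odot>\<^bsub>?L\<^esub> e 0"
        unfolding ce by (rule fraction_add_zero) (use c e mult_S M_smult_closed in auto)
    qed
    moreover have "{..<1 + 0} = {0::nat}" by auto
    ultimately show ?thesis by simp
  qed
  have ext: "(\<exists>!c. c \<in> ?E \<and> x = (\<Oplus>\<^bsub>?L\<^esub>i\<in>{..<1 + 0}. c i \<odot>\<^bsub>?L\<^esub> e i)) \<longleftrightarrow>
      (\<exists>!c. c \<in> ?A \<and> x = c \<odot>\<^bsub>?L\<^esub> e 0)" if e: "e 0 \<in> homog ?L 0" for e x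
  proof (rule ex1_transfer)
    fix c assume c: "c \<in> ?E \<and> x = (\<Oplus>\<^bsub>?L\<^esub>i\<in>{..<1 + 0}. c i \<odot>\<^bsub>?L\<^esub> e i)"
    then have c0: "c 0 \<in> ?A"
      using PiE_mem[of c "{..<1 + 0}" "\<lambda>_. ?A" 0] by simp
    then show "c 0 \<in> ?A \<and> x = c 0 \<odot>\<^bsub>?L\<^esub> e 0"
      using c sum[of c e, OF c0 e] by simp
    show "(\<lambda>i\<in>{..<1 + 0}. c 0) = c"
      by (rule PiE_ext[where k = "{..<1 + 0}" and s = "\<lambda>_. ?A"]) (use c c0 in simp_all)
  next
    fix d assume d: "d \<in> ?A \<and> x = d \<odot>\<^bsub>?L\<^esub> e 0"
    show d0: "(\<lambda>i\<in>{..<1 + 0::nat}. d) 0 = d" by simp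
    show "(\<lambda>i\<in>{..<1 + 0}. d) \<in> ?E \<and>
        x = (\<Oplus>\<^bsub>?L\<^esub>i\<in>{..<1 + 0}. (\<lambda>i\<in>{..<1 + 0}. d) i \<odot>\<^bsub>?L\<^esub> e i)"
      using sum[of "\<lambda>i\<in>{..<1 + 0}. d" e, unfolded d0] d e
      by (intro conjI restrict_PiE_iff[THEN iffD2]) simp_all
  qed
  show ?thesis
  proof
    assume "free_of_rank ?A ?L 1 0"
    then obtain e where e0: "\<forall>i<1 + 0. e i \<in> homog ?L (coord_parity 1 i)"
      and ex: "\<forall>x\<in>carrier ?L. \<exists>!c. c \<in> ?E \<and> x = (\<Oplus>\<^bsub>?L\<^esub>i\<in>{..<1 + 0}. c i \<odot>\<^bsub>?L\<^esub> e i)"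
      unfolding free_of_rank_def by (elim exE conjE)
    from e0 have e: "e 0 \<in> homog ?L 0"
      by (simp add: coord_parity_def)
    show "\<exists>f\<in>homog ?L 0. \<forall>x\<in>carrier ?L. \<exists>!c. c \<in> ?A \<and> x = c \<odot>\<^bsub>?L\<^esub> f"
      using ex[unfolded ext[of e, OF e]] e by (intro bexI[of _ "e 0"])
  next
    assume "\<exists>f\<in>homog ?L 0. \<forall>x\<in>carrier ?L. \<exists>!c. c \<in> ?A \<and> x = c \<odot>\<^bsub>?L\<^esub> f"
    then obtain f where f: "f \<in> homog ?L 0" "\<forall>x\<in>carrier ?L. \<exists>!c. c \<in> ?A \<and> x = c \<odot>\<^bsub>?L\<^esub> f" by blast
    show "free_of_rank ?A ?L 1 0"
      unfolding free_of_rank_def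
    proof (intro exI[of _ "\<lambda>_. f"] conjI)
      show "\<forall>i<1 + 0. f \<in> homog ?L (coord_parity 1 i)"
        using f(1) by (simp add: coord_parity_def)
      show "\<forall>x\<in>carrier ?L. \<exists>!c. c \<in> ?E \<and> x = (\<Oplus>\<^bsub>?L\<^esub>i\<in>{..<1 + 0}. c i \<odot>\<^bsub>?L\<^esub> f)"
        unfolding ext[of "\<lambda>_. f", OF f(1)] by (rule f(2))
    qed
  qed
qed

end


section \<open>Lines generated by an even vector with invertible first coordinate\<close>

text \<open>These are the vectors of the chart where the even coordinate equals \<one>. That
  coordinate has index 0, so the odd ones are shifted by one.\<close>

definition line_generator :: "'a superalgebra \<Rightarrow> nat \<Rightarrow> (nat \<Rightarrow> 'a) \<Rightarrow> nat \<Rightarrow> 'a" where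
  "line_generator R k s = (\<lambda>i\<in>{..<1 + k}. if i = 0 then \<one>\<^bsub>R\<^esub> else s (i - 1))"

definition line :: "'a superalgebra \<Rightarrow> nat \<Rightarrow> (nat \<Rightarrow> 'a) \<Rightarrow> (nat \<Rightarrow> 'a) set" where
  "line R k s = (\<lambda>r. r \<odot>\<^bsub>free_module R 1 k\<^esub> line_generator R k s) ` carrier R"

context supercommutative_ring
begin

lemma free_module_add_nth [simp]: "i < p + q \<Longrightarrow> (v \<oplus>\<^bsub>free_module R p q\<^esub> w) i = v i \<oplus> w i"
  by (simp add: free_module_simps)

lemma free_module_smult_nth [simp]: "i < p + q \<Longrightarrow> (r \<odot>\<^bsub>free_module R p q\<^esub> v) i = r \<otimes> v i"
  by (simp add: free_module_simps)

lemma free_module_zero_nth [simp]: "i < p + q \<Longrightarrow> \<zero>\<^bsub>free_module R p q\<^esub> i = \<zero>"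
  by (simp add: free_module_simps)

lemma free_module_zero_closed: "\<zero>\<^bsub>free_module R p q\<^esub> \<in> carrier (free_module R p q)"
  by (auto simp: free_module_simps)

lemma free_module_smult_zero:
  assumes "r \<in> carrier R"
  shows "r \<odot>\<^bsub>free_module R p q\<^esub> \<zero>\<^bsub>free_module R p q\<^esub> = \<zero>\<^bsub>free_module R p q\<^esub>"
  using assms by (auto simp: free_module_simps)

lemma free_module_zero_smult:
  assumes "v \<in> carrier (free_module R p q)"
  shows "\<zero> \<odot>\<^bsub>free_module R p q\<^esub> v = \<zero>\<^bsub>free_module R p q\<^esub>"
  using free_module_closed[OF assms] by (auto simp: free_module_simps)

lemma free_module_add_closed:
  "v \<in> carrier (free_module R p q) \<Longrightarrow> w \<in> carrier (free_module R p q) \<Longrightarrow>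
    v \<oplus>\<^bsub>free_module R p q\<^esub> w \<in> carrier (free_module R p q)"
  using free_module_closed[of v p q] free_module_closed[of w p q] by (auto simp: free_module_simps)

lemma free_module_homog_nth:
  assumes "v \<in> homog (free_module R p q) j" "i < p + q"
  shows "v i \<in> homog R (j + coord_parity p i)"
  using PiE_mem[OF assms(1)[unfolded free_module_simps], of i] assms(2) by (simp only: lessThan_iff)

lemma free_module_homogI:
  assumes "v \<in> carrier (free_module R p q)" "\<And>i. i < p + q \<Longrightarrow> v i \<in> homog R (j + coord_parity p i)"
  shows "v \<in> homog (free_module R p q) j"
  using assms by (auto simp: free_module_simps PiE_iff)

lemma free_module_homog_closed:
  assumes "v \<in> homog (free_module R p q) j"
  shows "v \<in> carrier (free_module R p q)"
  using assms by (auto simp: free_module_simps PiE_iff intro: homog_closed)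

lemma free_module_homog_smult:
  assumes r: "r \<in> homog R i" and v: "v \<in> homog (free_module R p q) j"
  shows "r \<odot>\<^bsub>free_module R p q\<^esub> v \<in> homog (free_module R p q) (i + j)"
proof (rule free_module_homogI)
  show "r \<odot>\<^bsub>free_module R p q\<^esub> v \<in> carrier (free_module R p q)"
    using homog_closed[OF r] free_module_homog_closed[OF v] by (rule free_module_smult_closed)
  fix l assume l: "l < p + q"
  show "(r \<odot>\<^bsub>free_module R p q\<^esub> v) l \<in> homog R (i + j + coord_parity p l)"
    using homog_mult[OF r free_module_homog_nth[OF v l]] by (simp only: add.assoc free_module_smult_nth[OF l])
qed

text \<open>In an odd coordinate an even vector has an odd entry, so the two components of x
  exchange their roles for j = 1.\<close>

lemma homog_split_shift:
  assumes x: "x \<in> carrier R"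
  shows "\<exists>a b. a \<in> homog R j \<and> b \<in> homog R (1 + j) \<and> x = a \<oplus> b \<and> (x = \<zero> \<longrightarrow> a = \<zero> \<and> b = \<zero>)"
proof -
  obtain a b where ab: "a \<in> homog R 0" "b \<in> homog R 1" "x = a \<oplus> b"
    using homog_split[OF x] by blast
  have z: "x = \<zero> \<longrightarrow> a = \<zero> \<and> b = \<zero>"
    using homog_decomp_unique[OF ab(1,2) homog_zero homog_zero] ab(3) by auto
  show ?thesis
  proof (cases "j = 0")
    case True
    then have "a \<in> homog R j" "b \<in> homog R (1 + j)"
      using ab by simp_all
    then show ?thesis using ab(3) z by blast
  next
    case False
    then have "j = 1" by simp
    then have "b \<in> homog R j" "a \<in> homog R (1 + j)" "x = b \<oplus> a"
      using ab by (simp_all add: a_comm)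
    then show ?thesis using z by blast
  qed
qed

text \<open>The components vanish wherever v does. For this reason the vectors with first coordinate
  zero form a graded submodule.\<close>

lemma free_module_split:
  assumes v: "v \<in> carrier (free_module R p q)"
  shows "\<exists>y\<in>homog (free_module R p q) 0. \<exists>z\<in>homog (free_module R p q) 1.
    v = y \<oplus>\<^bsub>free_module R p q\<^esub> z \<and> (\<forall>i<p + q. v i = \<zero> \<longrightarrow> y i = \<zero> \<and> z i = \<zero>)"
proof -
  define Q where "Q i ab \<longleftrightarrow> fst ab \<in> homog R (0 + coord_parity p i) \<and> snd ab \<in> homog R (1 + coord_parity p i) \<and>
      v i = fst ab \<oplus> snd ab \<and> (v i = \<zero> \<longrightarrow> fst ab = \<zero> \<and> snd ab = \<zero>)" for i ab
  have "\<forall>i\<in>{..<p + q}. \<exists>ab. Q i ab"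
  proof
    fix i assume i: "i \<in> {..<p + q}"
    obtain a b where ab: "a \<in> homog R (coord_parity p i)" "b \<in> homog R (1 + coord_parity p i)"
        "v i = a \<oplus> b" "v i = \<zero> \<longrightarrow> a = \<zero> \<and> b = \<zero>"
      using homog_split_shift[OF free_module_closed[OF v i[unfolded lessThan_iff]], of "coord_parity p i"] by blast
    have "Q i (a, b)"
      unfolding Q_def fst_conv snd_conv add_0 by (intro conjI ab)
    then show "\<exists>ab. Q i ab" ..
  qed
  from bchoice[OF this] obtain h where h: "\<forall>i\<in>{..<p + q}. Q i (h i)" ..
  define y z where "y i = fst (h i)" and "z i = snd (h i)" for i
  have yz: "y i \<in> homog R (0 + coord_parity p i)" "z i \<in> homog R (1 + coord_parity p i)"
    "v i = y i \<oplus> z i" "v i = \<zero> \<longrightarrow> y i = \<zero> \<and> z i = \<zero>" if "i < p + q" for i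
    using bspec[OF h, of i] that unfolding y_def z_def Q_def by blast+
  let ?y = "\<lambda>i\<in>{..<p + q}. y i" and ?z = "\<lambda>i\<in>{..<p + q}. z i"
  have y: "?y \<in> homog (free_module R p q) 0" and z: "?z \<in> homog (free_module R p q) 1"
    using yz(1,2) by (simp_all add: free_module_simps PiE_iff)
  have "v = ?y \<oplus>\<^bsub>free_module R p q\<^esub> ?z"
    by (rule free_module_ext[OF v free_module_add_closed])
       (use yz(3) free_module_homog_closed[OF y] free_module_homog_closed[OF z] in auto)
  then show ?thesis
    using y z yz(4) by (intro bexI[of _ ?y] bexI[of _ ?z]) auto
qed

lemma line_generator_nth [simp]:
  "line_generator R k s 0 = \<one>" "i < k \<Longrightarrow> line_generator R k s (Suc i) = s i"
  by (simp_all add: line_generator_def)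

lemma line_generator_even:
  assumes s: "s \<in> {..<k} \<rightarrow>\<^sub>E homog R 1"
  shows "line_generator R k s \<in> homog (free_module R 1 k) 0"
  using PiE_mem[OF s] by (auto simp: free_module_simps line_generator_def PiE_iff coord_parity_def)

lemma line_generator_closed:
  "s \<in> {..<k} \<rightarrow>\<^sub>E homog R 1 \<Longrightarrow> line_generator R k s \<in> carrier (free_module R 1 k)"
  using line_generator_even free_module_homog_closed by blast

lemma line_generator_in_line:
  assumes "s \<in> {..<k} \<rightarrow>\<^sub>E homog R 1"
  shows "line_generator R k s \<in> line R k s"
  using free_module_smult_one[OF line_generator_closed[OF assms]]
  by (auto simp: line_def intro: image_eqI[of _ _ \<one>])

lemma line_submodule:
  assumes s: "s \<in> {..<k} \<rightarrow>\<^sub>E homog R 1"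
  shows "submodule (line R k s) R (free_module R 1 k)"
proof (rule free_submoduleI)
  note e = line_generator_closed[OF s]
  show "line R k s \<subseteq> carrier (free_module R 1 k)"
    using free_module_smult_closed[OF _ e] by (auto simp: line_def)
  show "line R k s \<noteq> {}"
    by (auto simp: line_def)
  show "v \<oplus>\<^bsub>free_module R 1 k\<^esub> w \<in> line R k s" if "v \<in> line R k s" "w \<in> line R k s" for v w
    using that free_module_smult_l_distr[OF _ _ e, symmetric] by (auto simp: line_def)
  show "r \<odot>\<^bsub>free_module R 1 k\<^esub> v \<in> line R k s" if "r \<in> carrier R" "v \<in> line R k s" for r v
    using that free_module_smult_assoc[OF _ _ e, symmetric] by (auto simp: line_def)
qed

text \<open>The complement consists of the vectors with first coordinate zero. With e the generator,
  v = v 0 \<odot> e + (v - v 0 \<odot> e), and the intersection is zero because e has first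
  coordinate \<one>. Homogeneous parts of r \<odot> e come from those of r, since e is even.\<close>

lemma line_direct_summand:
  assumes s: "s \<in> {..<k} \<rightarrow>\<^sub>E homog R 1"
  shows "direct_summand R (free_module R 1 k) (line R k s)"
proof -
  let ?F = "free_module R 1 k" and ?e = "line_generator R k s"
  note e = line_generator_closed[OF s] line_generator_even[OF s]
  have "\<exists>y\<in>line R k s \<inter> homog ?F 0. \<exists>z\<in>line R k s \<inter> homog ?F 1. v = y \<oplus>\<^bsub>?F\<^esub> z" if v: "v \<in> line R k s" for v
  proof -
    obtain r where r: "r \<in> carrier R" "v = r \<odot>\<^bsub>?F\<^esub> ?e"
      using v by (auto simp: line_def)
    obtain a b where ab: "a \<in> homog R 0" "b \<in> homog R 1" "r = a \<oplus> b"
      using homog_split[OF r(1)] by blast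
    have "a \<odot>\<^bsub>?F\<^esub> ?e \<in> homog ?F 0" "b \<odot>\<^bsub>?F\<^esub> ?e \<in> homog ?F 1"
      using free_module_homog_smult[OF ab(1) e(2)] free_module_homog_smult[OF ab(2) e(2)] by simp_all
    moreover have "a \<odot>\<^bsub>?F\<^esub> ?e \<in> line R k s" "b \<odot>\<^bsub>?F\<^esub> ?e \<in> line R k s"
      using ab by (auto simp: line_def)
    moreover have "v = a \<odot>\<^bsub>?F\<^esub> ?e \<oplus>\<^bsub>?F\<^esub> b \<odot>\<^bsub>?F\<^esub> ?e"
      unfolding r(2) ab(3) by (rule free_module_smult_l_distr) (use ab e in auto)
    ultimately show ?thesis by blast
  qed
  then have L: "graded_submodule R ?F (line R k s)"
    using line_submodule[OF s] by (simp add: graded_submodule_def)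
  define N where "N = {v \<in> carrier ?F. v 0 = \<zero>}"
  have "submodule N R ?F"
    by (rule free_submoduleI)
       (auto simp: N_def free_module_add_closed free_module_smult_closed
         intro!: exI[of _ "\<zero>\<^bsub>?F\<^esub>"] free_module_zero_closed)
  moreover have "\<exists>y\<in>N \<inter> homog ?F 0. \<exists>z\<in>N \<inter> homog ?F 1. v = y \<oplus>\<^bsub>?F\<^esub> z" if v: "v \<in> N" for v
  proof -
    obtain y z where yz: "y \<in> homog ?F 0" "z \<in> homog ?F 1" "v = y \<oplus>\<^bsub>?F\<^esub> z"
      "\<forall>i<1 + k. v i = \<zero> \<longrightarrow> y i = \<zero> \<and> z i = \<zero>"
      using free_module_split[of v 1 k] v unfolding N_def by blast
    have "y \<in> N" "z \<in> N"
      using yz(4) v free_module_homog_closed[OF yz(1)] free_module_homog_closed[OF yz(2)]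
      by (auto simp: N_def)
    then show ?thesis using yz by blast
  qed
  ultimately have N: "graded_submodule R ?F N"
    by (simp add: graded_submodule_def)
  have "v = \<zero>\<^bsub>?F\<^esub>" if v: "v \<in> line R k s" "v \<in> N" for v
  proof -
    obtain r where r: "r \<in> carrier R" "v = r \<odot>\<^bsub>?F\<^esub> ?e"
      using v(1) by (auto simp: line_def)
    then have "r = \<zero>"
      using v(2) by (simp add: N_def)
    then show ?thesis
      using r(2) free_module_zero_smult[OF e(1)] by simp
  qed
  have inter: "line R k s \<inter> N = {\<zero>\<^bsub>?F\<^esub>}"
  proof -
    have "\<zero>\<^bsub>?F\<^esub> \<in> N"
      using free_module_zero_closed by (simp add: N_def)
    then show ?thesis
      using free_submoduleD(2)[OF line_submodule[OF s]] \<open>\<And>v. v \<in> line R k s \<Longrightarrow> v \<in> N \<Longrightarrow> v = \<zero>\<^bsub>?F\<^esub>\<close> by blast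
  qed
  have "v \<in> line R k s <+>\<^bsub>?F\<^esub> N" if v: "v \<in> carrier ?F" for v
  proof -
    have v0: "v 0 \<in> carrier R" using free_module_closed[OF v, of 0] by simp
    let ?w = "v \<oplus>\<^bsub>?F\<^esub> (\<ominus> v 0) \<odot>\<^bsub>?F\<^esub> ?e"
    have w: "?w \<in> carrier ?F"
      using v v0 e by (intro free_module_add_closed free_module_smult_closed) auto
    then have "?w \<in> N"
      using v0 by (simp add: N_def r_neg)
    moreover have "v 0 \<odot>\<^bsub>?F\<^esub> ?e \<in> line R k s"
      using v0 by (simp add: line_def)
    moreover have "v = v 0 \<odot>\<^bsub>?F\<^esub> ?e \<oplus>\<^bsub>?F\<^esub> ?w"
    proof (rule free_module_ext[OF v])
      show "v 0 \<odot>\<^bsub>?F\<^esub> ?e \<oplus>\<^bsub>?F\<^esub> ?w \<in> carrier ?F"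
        by (rule free_module_add_closed[OF free_module_smult_closed[OF v0 e(1)] w])
      fix i assume i: "i < 1 + k"
      have "v i \<in> carrier R" "?e i \<in> carrier R"
        using free_module_closed[OF v i] free_module_closed[OF e(1) i] .
      then show "v i = (v 0 \<odot>\<^bsub>?F\<^esub> ?e \<oplus>\<^bsub>?F\<^esub> ?w) i"
        using i v0 a_lcomm[of "v 0 \<otimes> ?e i" "v i"] by (simp add: l_minus r_neg)
    qed
    ultimately show ?thesis
      unfolding set_add_def' by blast
  qed
  moreover have "line R k s <+>\<^bsub>?F\<^esub> N \<subseteq> carrier ?F"
    using free_submoduleD(1)[OF line_submodule[OF s]] free_module_add_closed
    by (auto simp: set_add_def' N_def)
  ultimately have "line R k s <+>\<^bsub>?F\<^esub> N = carrier ?F"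
    by blast
  then show ?thesis
    using L N inter by (auto simp: direct_summand_def)
qed

lemma restrict_module_simps [simp]:
  "carrier (restrict_module M L) = L" "add (restrict_module M L) = add M"
  "\<zero>\<^bsub>restrict_module M L\<^esub> = \<zero>\<^bsub>M\<^esub>" "smult (restrict_module M L) = smult M"
  "homog (restrict_module M L) i = homog M i \<inter> L"
  by (simp_all add: restrict_module_def)

section \<open>Localized submodules and their local generators\<close>

lemma submodule_localization:
  assumes L: "submodule L R (free_module R p q)" and P: "primeideal P (even_part R)"
  shows "module_localization R (restrict_module (free_module R p q) L) (homog R 0 - P)"
proof -
  let ?F = "free_module R p q"
  interpret F: abelian_group ?F by (rule free_module_abelian_group)
  note LD = free_submoduleD[OF L] and PD = even_primeidealD[OF P]
  have LF: "v \<in> carrier ?F" if "v \<in> L" for v using LD(1) that by blast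
  have "abelian_group (restrict_module ?F L)"
  proof (rule abelian_groupI)
    show "\<exists>w\<in>carrier (restrict_module ?F L). w \<oplus>\<^bsub>restrict_module ?F L\<^esub> v = \<zero>\<^bsub>restrict_module ?F L\<^esub>"
      if "v \<in> carrier (restrict_module ?F L)" for v
    proof (rule bexI)
      show "\<ominus>\<^bsub>?F\<^esub> v \<in> carrier (restrict_module ?F L)"
        using that LD(4)[of "\<ominus> \<one>" v] free_module_minus[of v p q] LF by simp
      show "\<ominus>\<^bsub>?F\<^esub> v \<oplus>\<^bsub>restrict_module ?F L\<^esub> v = \<zero>\<^bsub>restrict_module ?F L\<^esub>"
        using that LF by (simp add: F.l_neg)
    qed
  qed (use LD(2,3) LF in \<open>simp_all add: F.a_ac\<close>)
  then show ?thesis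
  proof (intro module_localization.intro module_localization_axioms.intro supercommutative_ring_axioms)
    show "s \<otimes> t \<in> homog R 0 - P" if "s \<in> homog R 0 - P" "t \<in> homog R 0 - P" for s t
      using that PD(8)[of s t] by auto
  qed (use PD(3) LD(4) LF in \<open>simp_all add: free_module_smult_r_distr free_module_smult_assoc
    free_module_smult_one\<close>)
qed

text \<open>The generator over the denominator \<one> is a basis at each prime. Uniqueness of the
  coefficient is read off at index 0, where an equality between multiples of the generator becomes
  an equality between the scalars.\<close>

lemma line_rank:
  assumes s: "s \<in> {..<k} \<rightarrow>\<^sub>E homog R 1"
  shows "has_rank R (restrict_module (free_module R 1 k) (line R k s)) 1 0"
  unfolding has_rank_def Let_def
proof (intro allI impI)
  fix P assume P: "primeideal P (even_part R)"
  let ?F = "free_module R 1 k" and ?e = "line_generator R k s" and ?S = "homog R 0 - P"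
  let ?M = "restrict_module ?F (line R k s)"
  let ?c = "fraction R ?S (regular_module R)" and ?m = "fraction R ?S ?M"
  interpret M: module_localization R ?M ?S
    by (rule submodule_localization[OF line_submodule[OF s] P])
  interpret A: module_localization R "regular_module R" ?S
    by (rule M.regular_localization)
  note e = line_generator_closed[OF s] line_generator_even[OF s]
  note eL = line_generator_in_line[OF s]
  have smult: "?c r t \<odot>\<^bsub>localization R ?S ?M\<^esub> ?m ?e \<one>
      = ?m (r \<odot>\<^bsub>?F\<^esub> ?e) t" if "r \<in> carrier R" "t \<in> ?S" for r t
    using M.fraction_smult[of r ?e t \<one>] that eL M.one_S homog_closed[of t 0] by simp
  have uniq: "?c r t = ?c r' t'"
    if rt: "r \<in> carrier R" "t \<in> ?S" "r' \<in> carrier R" "t' \<in> ?S"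
      and eq: "?m (r \<odot>\<^bsub>?F\<^esub> ?e) t = ?m (r' \<odot>\<^bsub>?F\<^esub> ?e) t'" for r t r' t'
  proof -
    have "r \<odot>\<^bsub>?F\<^esub> ?e \<in> line R k s" "r' \<odot>\<^bsub>?F\<^esub> ?e \<in> line R k s"
      using rt by (auto simp: line_def)
    then obtain u where u: "u \<in> ?S" "u \<odot>\<^bsub>?F\<^esub> (t' \<odot>\<^bsub>?F\<^esub> (r \<odot>\<^bsub>?F\<^esub> ?e)) = u \<odot>\<^bsub>?F\<^esub> (t \<odot>\<^bsub>?F\<^esub> (r' \<odot>\<^bsub>?F\<^esub> ?e))"
      using eq M.fraction_eq_iff[of "r \<odot>\<^bsub>?F\<^esub> ?e" "r' \<odot>\<^bsub>?F\<^esub> ?e" t t'] rt by auto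
    have "u \<otimes> (t' \<otimes> r) = u \<otimes> (t \<otimes> r')"
      using fun_cong[OF u(2), of 0] rt by simp
    then show ?thesis
      using A.fraction_eq_iff[of r r' t t'] rt u(1) by (auto simp: regular_module_def)
  qed
  show "free_of_rank (carrier (localization R ?S (regular_module R))) (localization R ?S ?M) 1 0"
  proof (subst M.free_of_rank_one_iff, simp, intro bexI[of _ "?m ?e \<one>"] ballI)
    show "?m ?e \<one> \<in> homog (localization R ?S ?M) 0"
      unfolding M.localization_carrier restrict_module_simps using e(2) eL M.one_S by blast
    fix x assume "x \<in> carrier (localization R ?S ?M)"
    then obtain m t where x: "x = ?m m t" "m \<in> line R k s" "t \<in> ?S"
      unfolding M.localization_carrier restrict_module_simps by blast
    then obtain r where r: "r \<in> carrier R" "m = r \<odot>\<^bsub>?F\<^esub> ?e"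
      by (auto simp: line_def)
    show "\<exists>!c. c \<in> carrier (localization R ?S (regular_module R)) \<and>
        x = c \<odot>\<^bsub>localization R ?S ?M\<^esub> ?m ?e \<one>"
    proof (rule ex1I[of _ "?c r t"])
      show "?c r t \<in> carrier (localization R ?S (regular_module R)) \<and>
        x = ?c r t \<odot>\<^bsub>localization R ?S ?M\<^esub> ?m ?e \<one>"
        using smult[OF r(1) x(3)] r x(1,3) unfolding M.regular_localization_carrier by blast
      fix c assume c: "c \<in> carrier (localization R ?S (regular_module R)) \<and>
        x = c \<odot>\<^bsub>localization R ?S ?M\<^esub> ?m ?e \<one>"
      then obtain r' t' where c': "c = ?c r' t'" "r' \<in> carrier R" "t' \<in> ?S"
        unfolding M.regular_localization_carrier by blast
      show "c = ?c r t"
        unfolding c'(1) using c smult[OF c'(2,3)] x(1)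
        by (intro uniq c' r(1) x(3)) (simp only: c'(1) r(2))
    qed
  qed
qed

text \<open>Clearing denominators turns freeness at P into statements about elements of the module
  itself. Here f is the numerator of a basis element f/s; the denominator s is absorbed into the
  multipliers t.\<close>

lemma rank_one_local_generator:
  assumes L: "submodule L R (free_module R p q)" and rank: "has_rank R (restrict_module (free_module R p q) L) 1 0"
    and P: "primeideal P (even_part R)"
  shows "\<exists>f. f \<in> L \<and> f \<in> homog (free_module R p q) 0 \<and>
    (\<forall>m\<in>L. \<exists>t\<in>homog R 0 - P. \<exists>r\<in>carrier R. t \<odot>\<^bsub>free_module R p q\<^esub> m = r \<odot>\<^bsub>free_module R p q\<^esub> f) \<and>
    (\<forall>t\<in>homog R 0 - P. t \<odot>\<^bsub>free_module R p q\<^esub> f \<noteq> \<zero>\<^bsub>free_module R p q\<^esub>)"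
proof -
  let ?F = "free_module R p q" and ?S = "homog R 0 - P"
  let ?M = "restrict_module ?F L"
  let ?c = "fraction R ?S (regular_module R)" and ?m = "fraction R ?S ?M"
  interpret M: module_localization R ?M ?S
    by (rule submodule_localization[OF L P])
  interpret A: module_localization R "regular_module R" ?S
    by (rule M.regular_localization)
  note LD = free_submoduleD[OF L] and PD = even_primeidealD[OF P]
  let ?loc = "localization R ?S ?M" and ?A = "carrier (localization R ?S (regular_module R))"
  have "free_of_rank ?A ?loc 1 0"
    using rank P by (simp add: has_rank_def Let_def)
  then obtain b where b: "b \<in> homog ?loc 0" "\<And>x. x \<in> carrier ?loc \<Longrightarrow> \<exists>!c. c \<in> ?A \<and> x = c \<odot>\<^bsub>?loc\<^esub> b"
    using M.free_of_rank_one_iff by auto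
  then obtain f s where f: "b = ?m f s" "f \<in> homog ?F 0" "f \<in> L" "s \<in> ?S"
    by (auto simp: M.localization_carrier)
  have smult: "?c r t \<odot>\<^bsub>?loc\<^esub> b = ?m (r \<odot>\<^bsub>?F\<^esub> f) (t \<otimes> s)"
    if "r \<in> carrier R" "t \<in> ?S" for r t
    using M.fraction_smult[of r f t s] that f by simp
  show ?thesis
  proof (intro exI[of _ f] conjI ballI f(3,2))
    show "\<exists>t\<in>?S. \<exists>r\<in>carrier R. t \<odot>\<^bsub>?F\<^esub> m = r \<odot>\<^bsub>?F\<^esub> f" if m: "m \<in> L" for m
    proof -
      have "?m m \<one> \<in> carrier ?loc"
        unfolding M.localization_carrier restrict_module_simps using m M.one_S by blast
      then obtain c where c: "c \<in> ?A" "?m m \<one> = c \<odot>\<^bsub>?loc\<^esub> b"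
        using b(2) by blast
      then obtain r t where rt: "c = ?c r t" "r \<in> carrier R" "t \<in> ?S"
        unfolding M.regular_localization_carrier by blast
      have ts: "t \<otimes> s \<in> ?S" by (rule M.mult_S[OF rt(3) f(4)])
      have "?m m \<one> = ?m (r \<odot>\<^bsub>?F\<^esub> f) (t \<otimes> s)"
        using c(2) smult[OF rt(2,3)] rt(1) by simp
      then obtain u where u: "u \<in> ?S" "u \<odot>\<^bsub>?F\<^esub> ((t \<otimes> s) \<odot>\<^bsub>?F\<^esub> m) = u \<odot>\<^bsub>?F\<^esub> (\<one> \<odot>\<^bsub>?F\<^esub> (r \<odot>\<^bsub>?F\<^esub> f))"
        using M.fraction_eq_iff[of m "r \<odot>\<^bsub>?F\<^esub> f" \<one> "t \<otimes> s"] m rt f(3) LD(4) ts M.one_S by auto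
      have mf: "m \<in> carrier ?F" "f \<in> carrier ?F"
        using m f(3) LD(1) by auto
      have cl: "u \<in> carrier R" "t \<otimes> s \<in> carrier R"
        using u(1) ts by auto
      have "(u \<otimes> (t \<otimes> s)) \<odot>\<^bsub>?F\<^esub> m = (u \<otimes> r) \<odot>\<^bsub>?F\<^esub> f"
        using u(2) free_module_smult_assoc[OF cl mf(1)] free_module_smult_assoc[OF cl(1) rt(2) mf(2)]
          free_module_smult_one[OF free_module_smult_closed[OF rt(2) mf(2)]] by simp
      then show ?thesis
        using M.mult_S[OF u(1) ts] cl rt(2) by blast
    qed
    \<comment> \<open>If t annihilated f, the scalars 0/1 and 1/1 would have the same product with
      f/s. Uniqueness of coefficients then makes them equal, so some u outside P is zero, although P
      contains zero.\<close>
    show "t \<odot>\<^bsub>?F\<^esub> f \<noteq> \<zero>\<^bsub>?F\<^esub>" if t: "t \<in> ?S" for t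
    proof
      assume tf: "t \<odot>\<^bsub>?F\<^esub> f = \<zero>\<^bsub>?F\<^esub>"
      have fF: "f \<in> carrier ?F" using f(3) LD(1) by auto
      note 0 = free_module_zero_smult[OF fF] and z = free_module_smult_zero
      have one: "\<one> \<in> ?S" by (rule M.one_S)
      have cl: "t \<in> carrier R" "s \<in> carrier R" using t f(4) by auto
      have "t \<odot>\<^bsub>?F\<^esub> (s \<odot>\<^bsub>?F\<^esub> f) = \<zero>\<^bsub>?F\<^esub>"
        using M.S_smult_commute[of t s f] t f(3) cl by (simp add: tf z)
      then have ts: "t \<odot>\<^bsub>?F\<^esub> (s \<odot>\<^bsub>?F\<^esub> \<zero>\<^bsub>?F\<^esub>) = t \<odot>\<^bsub>?F\<^esub> (s \<odot>\<^bsub>?F\<^esub> f)"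
        using cl by (simp add: z)
      have "?m (\<zero> \<odot>\<^bsub>?F\<^esub> f) (\<one> \<otimes> s) = ?m (\<one> \<odot>\<^bsub>?F\<^esub> f) (\<one> \<otimes> s)"
        using t ts f(3,4) cl free_module_smult_one[OF fF] LD(2)
        by (subst M.fraction_eq_iff) (auto simp: 0 intro!: bexI[of _ t])
      then have "?c \<zero> \<one> \<odot>\<^bsub>?loc\<^esub> b = ?c \<one> \<one> \<odot>\<^bsub>?loc\<^esub> b"
        using smult[OF zero_closed one] smult[OF one_closed one] by simp
      moreover have "?c \<zero> \<one> \<odot>\<^bsub>?loc\<^esub> b \<in> carrier ?loc"
        using LD(4)[OF zero_closed f(3)] M.mult_S[OF one f(4)]
        unfolding smult[OF zero_closed one] M.localization_carrier restrict_module_simps by blast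
      moreover have "?c \<zero> \<one> \<in> ?A" "?c \<one> \<one> \<in> ?A"
        unfolding M.regular_localization_carrier using one by blast+
      ultimately have "?c \<zero> \<one> = ?c \<one> \<one>"
        using b(2) by metis
      then obtain u where "u \<in> ?S" "u \<otimes> (\<one> \<otimes> \<zero>) = u \<otimes> (\<one> \<otimes> \<one>)"
        using A.fraction_eq_iff[of \<zero> \<one> \<one> \<one>] one by (auto simp: regular_module_def)
      moreover from this(1) have "u \<in> carrier R" by auto
      ultimately show False
        using PD(2) by auto
    qed
  qed
qed

end


section \<open>Classification of the summands of rank one\<close>

context supercommutative_ring
begin

text \<open>If all coordinates of \<open>f\<close> lie in \<open>P + R\<^sub>1\<close>, then projecting the expansion of \<open>f\<close> in the
  standard basis along the complement gives \<open>t f = r f\<close> with \<open>r \<in> P + R\<^sub>1\<close> and \<open>t \<notin> P\<close>.\<close>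

lemma direct_summand_local_generator_coordinate:
  assumes L: "direct_summand R (free_module R 1 k) L"
    and P: "primeideal P (even_part R)"
    and f: "f \<in> L" "f \<in> homog (free_module R 1 k) 0"
    and gen: "\<forall>m\<in>L. \<exists>t\<in>homog R 0 - P. \<exists>r\<in>carrier R. t \<odot>\<^bsub>free_module R 1 k\<^esub> m = r \<odot>\<^bsub>free_module R 1 k\<^esub> f"
    and faithful: "\<forall>t\<in>homog R 0 - P. t \<odot>\<^bsub>free_module R 1 k\<^esub> f \<noteq> \<zero>\<^bsub>free_module R 1 k\<^esub>"
  shows "f 0 \<notin> P"
proof
  let ?F = "free_module R 1 k" and ?S = "homog R 0 - P"
  assume f0: "f 0 \<in> P"
  note PD = even_primeidealD[OF P]
  obtain N where LS: "submodule L R ?F" and NS: "submodule N R ?F"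
    and inter: "L \<inter> N = {\<zero>\<^bsub>?F\<^esub>}" and sum: "L <+>\<^bsub>?F\<^esub> N = carrier ?F"
    using L unfolding direct_summand_def graded_submodule_def by blast
  note LD = free_submoduleD[OF LS] and ND = free_submoduleD[OF NS]
  have fF: "f \<in> carrier ?F" using f(1) LD(1) by blast
  have S_closed: "t \<in> carrier R" if "t \<in> ?S" for t using that homog_closed by blast
  have S_mult: "s \<otimes> t \<in> ?S" if "s \<in> ?S" "t \<in> ?S" for s t
    using that PD(8)[of s t] even_even_mult[of s t] by blast
  \<comment> \<open>This is P + R_1, the preimage of P under the projection to the even part. It is
    a two-sided ideal, which matters because \<open>v m\<close> gets multiplied by scalars from both
    sides.\<close>
  define Q where "Q = {a \<oplus> b | a b. a \<in> P \<and> b \<in> homog R 1}"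
  have Q_closed: "q \<in> carrier R" if "q \<in> Q" for q
    using that PD(1) homog_closed unfolding Q_def by blast
  have Q_add: "q \<oplus> q' \<in> Q" if qq': "q \<in> Q" "q' \<in> Q" for q q'
  proof -
    obtain a b a' b' where ab: "a \<in> P" "b \<in> homog R 1" "q = a \<oplus> b" "a' \<in> P" "b' \<in> homog R 1" "q' = a' \<oplus> b'"
      using qq' unfolding Q_def by blast
    then have cl: "a \<in> carrier R" "b \<in> carrier R" "a' \<in> carrier R" "b' \<in> carrier R"
      using PD(1) homog_closed by blast+
    have "q \<oplus> q' = (a \<oplus> a') \<oplus> (b \<oplus> b')"
      unfolding ab(3,6) using cl by (simp add: a_ac)
    then show ?thesis
      using PD(4)[OF ab(1,4)] homog_add[OF ab(2,5)] unfolding Q_def by blast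
  qed
  have Q_mult: "x \<otimes> q \<in> Q" "q \<otimes> x \<in> Q" if xq: "x \<in> carrier R" "q \<in> Q" for x q
  proof -
    obtain a b where ab: "a \<in> P" "b \<in> homog R 1" "q = a \<oplus> b"
      using xq(2) unfolding Q_def by blast
    obtain x0 x1 where x: "x0 \<in> homog R 0" "x1 \<in> homog R 1" "x = x0 \<oplus> x1"
      using homog_split[OF xq(1)] by blast
    have a0: "a \<in> homog R 0" using ab(1) PD(1) by blast
    have cl: "a \<in> carrier R" "b \<in> carrier R" "x0 \<in> carrier R" "x1 \<in> carrier R"
      using a0 ab(2) x homog_closed by blast+
    \<comment> \<open>The product of two odd elements squares to zero, which lies in P, so primeness
      puts the product itself in P.\<close>
    have odd: "y \<otimes> z \<in> P" if yz: "y \<in> homog R 1" "z \<in> homog R 1" for y z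
      using PD(8)[of "y \<otimes> z" "y \<otimes> z"] odd_odd_mult[OF yz] odd_mult_square[OF yz] PD(2) by simp
    have "x \<otimes> q = (x0 \<otimes> a \<oplus> x1 \<otimes> b) \<oplus> (x0 \<otimes> b \<oplus> x1 \<otimes> a)"
      unfolding ab(3) x(3) using cl by (simp add: l_distr r_distr a_ac)
    moreover have "x0 \<otimes> a \<oplus> x1 \<otimes> b \<in> P" "x0 \<otimes> b \<oplus> x1 \<otimes> a \<in> homog R 1"
      using PD(4)[OF PD(6)[OF ab(1) x(1)] odd[OF x(2) ab(2)]] ab(2) x a0 by simp_all
    ultimately show "x \<otimes> q \<in> Q" unfolding Q_def by blast
    have "q \<otimes> x = (a \<otimes> x0 \<oplus> b \<otimes> x1) \<oplus> (b \<otimes> x0 \<oplus> a \<otimes> x1)"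
      unfolding ab(3) x(3) using cl by (simp add: l_distr r_distr a_ac)
    moreover have "a \<otimes> x0 \<oplus> b \<otimes> x1 \<in> P" "b \<otimes> x0 \<oplus> a \<otimes> x1 \<in> homog R 1"
      using PD(4)[OF PD(7)[OF ab(1) x(1)] odd[OF ab(2) x(2)]] ab(2) x a0 by simp_all
    ultimately show "q \<otimes> x \<in> Q" unfolding Q_def by blast
  qed
  have Q_zero: "\<zero> \<in> Q"
    unfolding Q_def using PD(2) homog_zero[of 1] l_zero[OF zero_closed] by (metis (mono_tags, lifting) mem_Collect_eq)
  \<comment> \<open>Induction on the number m of leading coordinates that may be nonzero. Up to a
    denominator, a vector with coordinates in Q is congruent modulo N to a multiple of f by an
    element of Q. For m = 0 the vector is zero.\<close>
  have key: "\<exists>t\<in>?S. \<exists>r\<in>Q. \<exists>n\<in>N. t \<odot>\<^bsub>?F\<^esub> v = r \<odot>\<^bsub>?F\<^esub> f \<oplus>\<^bsub>?F\<^esub> n"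
    if "v \<in> carrier ?F" "\<And>i. i < 1 + k \<Longrightarrow> v i \<in> Q" "\<And>i. m \<le> i \<Longrightarrow> i < 1 + k \<Longrightarrow> v i = \<zero>" "m \<le> 1 + k" for m v
    using that
  proof (induction m arbitrary: v)
    case 0
    have one: "\<one> \<in> ?S" using PD(3) one_even by blast
    have "\<one> \<odot>\<^bsub>?F\<^esub> v = \<zero> \<odot>\<^bsub>?F\<^esub> f \<oplus>\<^bsub>?F\<^esub> \<zero>\<^bsub>?F\<^esub>"
      unfolding free_module_zero_smult[OF fF] free_module_smult_one[OF 0(1)] using 0(3)
      by (intro free_module_ext[OF 0(1) free_module_add_closed[OF free_module_zero_closed free_module_zero_closed]]) simp
    then show ?case using one Q_zero ND(2) by blast
  next
    case (Suc m)
    have m: "m < 1 + k" using Suc.prems(4) by simp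
    \<comment> \<open>The standard basis vector d with \<one> at m splits along L and N. Its
      component in L is, up to a denominator, a multiple of f, and v = v' \<oplus> v m \<odot> d
      reduces the claim to v'.\<close>
    define d where "d = (\<lambda>i\<in>{..<1 + k}. if i = m then \<one> else \<zero>)"
    define v' where "v' = (\<lambda>i\<in>{..<1 + k}. if i = m then \<zero> else v i)"
    have d: "d \<in> carrier ?F"
      by (auto simp: d_def free_module_simps)
    have v': "v' \<in> carrier ?F"
      using free_module_closed[OF Suc.prems(1)] by (auto simp: v'_def free_module_simps)
    have v'0: "v' i = \<zero>" if "m \<le> i" "i < 1 + k" for i
      using that Suc.prems(3)[of i] by (cases "i = m") (simp_all add: v'_def)
    have v'Q: "v' i \<in> Q" if "i < 1 + k" for i
      using that Suc.prems(2)[of i] Q_zero by (simp add: v'_def)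
    have "m \<le> 1 + k" using m by simp
    from Suc.IH[OF v' v'Q v'0 this] obtain t r n where IH: "t \<in> ?S" "r \<in> Q" "n \<in> N"
      "t \<odot>\<^bsub>?F\<^esub> v' = r \<odot>\<^bsub>?F\<^esub> f \<oplus>\<^bsub>?F\<^esub> n" by blast
    have "d \<in> L <+>\<^bsub>?F\<^esub> N" using d sum by simp
    then obtain l n' where ln: "l \<in> L" "n' \<in> N" "d = l \<oplus>\<^bsub>?F\<^esub> n'"
      unfolding set_add_def' by blast
    obtain t' r' where t': "t' \<in> ?S" "r' \<in> carrier R" "t' \<odot>\<^bsub>?F\<^esub> l = r' \<odot>\<^bsub>?F\<^esub> f"
      using bspec[OF gen ln(1)] by blast
    have vm: "v m \<in> Q" "v m \<in> carrier R"
      using Suc.prems(2)[OF m] Q_closed by auto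
    have cl: "t \<in> carrier R" "t' \<in> carrier R" "r \<in> carrier R" "r' \<in> carrier R" "v m \<in> carrier R"
      using IH(1,2) t' S_closed Q_closed vm by blast+
    have nF: "n \<in> carrier ?F" "n' \<in> carrier ?F" "l \<in> carrier ?F"
      using IH(3) ln ND(1) LD(1) by blast+
    \<comment> \<open>Multiply the relation for v' by t', and v m \<odot> (l \<oplus> n') by t'
      \<otimes> t. As t' is even it moves past \<open>v m\<close> and reaches l and n', where t'
      \<odot> l can be replaced by r' \<odot> f.\<close>
    let ?r = "t' \<otimes> r \<oplus> (t \<otimes> v m) \<otimes> r'"
    let ?n = "t' \<odot>\<^bsub>?F\<^esub> n \<oplus>\<^bsub>?F\<^esub> (t \<otimes> v m) \<odot>\<^bsub>?F\<^esub> (t' \<odot>\<^bsub>?F\<^esub> n')"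
    have r: "?r \<in> Q"
      by (rule Q_add[OF Q_mult(1)[OF cl(2) IH(2)] Q_mult(2)[OF cl(4) Q_mult(1)[OF cl(1) vm(1)]]])
    have n: "?n \<in> N"
      using ND(3,4) IH(3) ln(2) cl by simp
    have "(t' \<otimes> t) \<odot>\<^bsub>?F\<^esub> v = ?r \<odot>\<^bsub>?F\<^esub> f \<oplus>\<^bsub>?F\<^esub> ?n"
    proof (rule free_module_ext)
      show "(t' \<otimes> t) \<odot>\<^bsub>?F\<^esub> v \<in> carrier ?F"
        using cl Suc.prems(1) by (simp add: free_module_smult_closed del: One_nat_def)
      show "?r \<odot>\<^bsub>?F\<^esub> f \<oplus>\<^bsub>?F\<^esub> ?n \<in> carrier ?F"
        using free_module_add_closed[OF free_module_smult_closed[OF Q_closed[OF r] fF] subsetD[OF ND(1) n]] .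
      fix i assume i: "i < 1 + k"
      note ci = free_module_closed[OF fF i] free_module_closed[OF nF(1) i] free_module_closed[OF nF(2) i]
        free_module_closed[OF nF(3) i] free_module_closed[OF v' i] free_module_closed[OF d i]
      have e1: "t \<otimes> v' i = r \<otimes> f i \<oplus> n i"
        using fun_cong[OF IH(4), of i] i by simp
      have e2: "d i = l i \<oplus> n' i"
        using fun_cong[OF ln(3), of i] i by simp
      have e3: "t' \<otimes> l i = r' \<otimes> f i"
        using fun_cong[OF t'(3), of i] i by simp
      have e4: "v i = v' i \<oplus> v m \<otimes> d i"
        using i cl free_module_closed[OF Suc.prems(1) i] by (simp add: v'_def d_def)
      have e5: "t' \<otimes> (t \<otimes> v m) = (t \<otimes> v m) \<otimes> t'"
        using even_commute[of t' "t \<otimes> v m"] t'(1) cl by simp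
      have "(t' \<otimes> t) \<otimes> v i = t' \<otimes> (t \<otimes> v' i) \<oplus> (t' \<otimes> (t \<otimes> v m)) \<otimes> d i"
        unfolding e4 using cl ci by (simp add: r_distr m_assoc)
      also have "\<dots> = t' \<otimes> (r \<otimes> f i \<oplus> n i) \<oplus> (t \<otimes> v m) \<otimes> (t' \<otimes> l i \<oplus> t' \<otimes> n' i)"
        unfolding e1 e2 e5 using cl ci by (simp add: r_distr m_assoc)
      also have "\<dots> = (t' \<otimes> r \<oplus> (t \<otimes> v m) \<otimes> r') \<otimes> f i \<oplus> (t' \<otimes> n i \<oplus> (t \<otimes> v m) \<otimes> (t' \<otimes> n' i))"
        unfolding e3 using cl ci by (simp add: r_distr l_distr m_assoc a_ac)
      finally show "((t' \<otimes> t) \<odot>\<^bsub>?F\<^esub> v) i = (?r \<odot>\<^bsub>?F\<^esub> f \<oplus>\<^bsub>?F\<^esub> ?n) i"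
        using i by simp
    qed
    then show ?case
      using S_mult[OF t'(1) IH(1)] r n by blast
  qed
  have fQ: "f i \<in> Q" if i: "i < 1 + k" for i
  proof (cases "i = 0")
    case True
    have "f 0 = f 0 \<oplus> \<zero>" using free_module_closed[OF fF, of 0] by simp
    then show ?thesis
      using True f0 homog_zero[of 1] unfolding Q_def by blast
  next
    case False
    then have "f i \<in> homog R 1"
      using free_module_homog_nth[OF f(2) i] by (simp add: coord_parity_def)
    moreover from this have "f i = \<zero> \<oplus> f i" by simp
    ultimately show ?thesis
      using PD(2) unfolding Q_def by blast
  qed
  obtain t r n where trn: "t \<in> ?S" "r \<in> Q" "n \<in> N" "t \<odot>\<^bsub>?F\<^esub> f = r \<odot>\<^bsub>?F\<^esub> f \<oplus>\<^bsub>?F\<^esub> n"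
    using key[OF fF fQ, of "1 + k"] by auto
  have cl: "t \<in> carrier R" "r \<in> carrier R" "n \<in> carrier ?F"
    using trn S_closed Q_closed ND(1) by blast+
  \<comment> \<open>Hence n is a multiple of f and lies in both L and N, so it vanishes and t f = r
    f remains.\<close>
  have "n = (t \<oplus> \<ominus> r) \<odot>\<^bsub>?F\<^esub> f"
  proof (rule free_module_ext[OF cl(3)])
    show "(t \<oplus> \<ominus> r) \<odot>\<^bsub>?F\<^esub> f \<in> carrier ?F"
      using cl by (intro free_module_smult_closed[OF _ fF]) simp
    fix i assume i: "i < 1 + k"
    have "t \<otimes> f i = r \<otimes> f i \<oplus> n i"
      using fun_cong[OF trn(4), of i] i by simp
    then have "(t \<oplus> \<ominus> r) \<otimes> f i = n i \<oplus> (r \<otimes> f i \<oplus> \<ominus> (r \<otimes> f i))"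
      using cl free_module_closed[OF fF i] free_module_closed[OF cl(3) i] by (simp add: l_distr l_minus a_ac)
    then show "n i = ((t \<oplus> \<ominus> r) \<odot>\<^bsub>?F\<^esub> f) i"
      using i cl free_module_closed[OF fF i] free_module_closed[OF cl(3) i] by (simp add: r_neg)
  qed
  then have "n \<in> L"
    using LD(4)[of "t \<oplus> \<ominus> r" f] f(1) cl by simp
  then have n0: "n = \<zero>\<^bsub>?F\<^esub>"
    using inter trn(3) by blast
  obtain a b where ab: "a \<in> P" "b \<in> homog R 1" "r = a \<oplus> b"
    using trn(2) unfolding Q_def by blast
  have a0: "a \<in> homog R 0" using ab(1) PD(1) by blast
  \<comment> \<open>The difference t - r has an odd part b, so faithfulness does not apply to it
    directly. Its even part c lies outside P, since otherwise t = c \<oplus> a would lie in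
    P.\<close>
  define c where "c = t \<oplus> \<ominus> a"
  have c0: "c \<in> homog R 0"
    using trn(1) a0 by (simp add: c_def)
  have "c \<notin> P"
  proof
    assume "c \<in> P"
    then have "c \<oplus> a \<in> P" using ab(1) by (rule PD(4))
    then show False
      using trn(1) cl a0 by (simp add: c_def a_assoc l_neg)
  qed
  then have cS: "c \<otimes> c \<in> ?S"
    using S_mult[of c c] c0 by blast
  \<comment> \<open>The relation reads c f = b f. Applying it twice, with c central, gives c^2 f =
    b^2 f, and the odd element b squares to zero.\<close>
  have "(c \<otimes> c) \<odot>\<^bsub>?F\<^esub> f = \<zero>\<^bsub>?F\<^esub>"
  proof (rule free_module_ext[OF free_module_smult_closed[OF S_closed[OF cS] fF] free_module_zero_closed])
    fix i assume i: "i < 1 + k"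
    note fi = free_module_closed[OF fF i]
    have acl: "a \<in> carrier R" "b \<in> carrier R" "c \<in> carrier R"
      using a0 ab(2) c0 homog_closed by blast+
    have "t \<otimes> f i = (a \<oplus> b) \<otimes> f i"
      using fun_cong[OF trn(4), of i] i fi acl n0 ab(3) by simp
    then have tf: "t \<otimes> f i = b \<otimes> f i \<oplus> a \<otimes> f i"
      using acl fi by (simp add: l_distr a_comm)
    have "c \<otimes> f i = t \<otimes> f i \<oplus> \<ominus> (a \<otimes> f i)"
      using cl acl fi by (simp add: c_def l_distr l_minus)
    also have "\<dots> = b \<otimes> f i"
      unfolding tf using acl fi by (simp add: a_assoc r_neg)
    finally have cf: "c \<otimes> f i = b \<otimes> f i" .
    have "c \<otimes> (c \<otimes> f i) = (c \<otimes> b) \<otimes> f i"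
      unfolding cf using acl fi by (simp add: m_assoc)
    also have "\<dots> = b \<otimes> (c \<otimes> f i)"
      unfolding even_commute[OF c0 acl(2)] using acl fi by (simp add: m_assoc)
    finally have "c \<otimes> (c \<otimes> f i) = b \<otimes> (b \<otimes> f i)"
      by (simp only: cf)
    then show "((c \<otimes> c) \<odot>\<^bsub>?F\<^esub> f) i = \<zero>\<^bsub>?F\<^esub> i"
      using i acl fi odd_square[OF ab(2)] by (simp add: m_assoc[symmetric])
  qed
  then show False
    using bspec[OF faithful cS] by blast
qed

lemma rank_one_summand_even_section:
  assumes L: "direct_summand R (free_module R 1 k) L"
    and rank: "has_rank R (restrict_module (free_module R 1 k) L) 1 0"
  shows "\<exists>e\<in>L. e \<in> homog (free_module R 1 k) 0 \<and> e 0 = \<one>"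
proof -
  let ?F = "free_module R 1 k"
  have LS: "submodule L R ?F"
    using L unfolding direct_summand_def graded_submodule_def by blast
  note LD = free_submoduleD[OF LS]
  define I where "I = {v 0 | v. v \<in> L \<and> v \<in> homog ?F 0}"
  have "\<one> \<in> I"
  proof (rule even_ideal_eq_unit)
    show "I \<subseteq> homog R 0"
      unfolding I_def using free_module_homog_nth[of _ 1 k 0 0] by (auto simp: coord_parity_def)
    have "\<zero>\<^bsub>?F\<^esub> \<in> homog ?F 0"
      by (rule free_module_homogI[OF free_module_zero_closed]) (simp only: free_module_zero_nth homog_zero)
    moreover have "\<zero> = \<zero>\<^bsub>?F\<^esub> 0"
      by simp
    ultimately show "\<zero> \<in> I"
      unfolding I_def using LD(2) by blast
    show "a \<oplus> b \<in> I" if ab: "a \<in> I" "b \<in> I" for a b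
    proof -
      obtain v w where vw: "v \<in> L" "v \<in> homog ?F 0" "a = v 0" "w \<in> L" "w \<in> homog ?F 0" "b = w 0"
        using ab unfolding I_def by blast
      have "v \<oplus>\<^bsub>?F\<^esub> w \<in> homog ?F 0"
      proof (rule free_module_homogI)
        show "v \<oplus>\<^bsub>?F\<^esub> w \<in> carrier ?F"
          using vw(1,4) LD(1) by (intro free_module_add_closed) auto
        fix i assume i: "i < 1 + k"
        show "(v \<oplus>\<^bsub>?F\<^esub> w) i \<in> homog R (0 + coord_parity 1 i)"
          unfolding free_module_add_nth[OF i]
          by (rule homog_add[OF free_module_homog_nth[OF vw(2) i] free_module_homog_nth[OF vw(5) i]])
      qed
      moreover have "v \<oplus>\<^bsub>?F\<^esub> w \<in> L" "a \<oplus> b = (v \<oplus>\<^bsub>?F\<^esub> w) 0"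
        using LD(3)[OF vw(1,4)] vw by simp_all
      ultimately show ?thesis unfolding I_def by blast
    qed
    show "x \<otimes> a \<in> I" if ax: "a \<in> I" "x \<in> homog R 0" for a x
    proof -
      obtain v where v: "v \<in> L" "v \<in> homog ?F 0" "a = v 0"
        using ax(1) unfolding I_def by blast
      have "x \<odot>\<^bsub>?F\<^esub> v \<in> homog ?F 0"
        using free_module_homog_smult[OF ax(2) v(2)] by simp
      moreover have "x \<odot>\<^bsub>?F\<^esub> v \<in> L" "x \<otimes> a = (x \<odot>\<^bsub>?F\<^esub> v) 0"
        using LD(4)[OF homog_closed[OF ax(2)] v(1)] v(3) by simp_all
      ultimately show ?thesis unfolding I_def by blast
    qed
    \<comment> \<open>The local generator is itself an even element of L, so its first coordinate is
      a member of I outside P.\<close>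
    show "\<not> I \<subseteq> P" if P: "primeideal P (even_part R)" for P
    proof -
      obtain f where f: "f \<in> L" "f \<in> homog ?F 0"
        "\<forall>m\<in>L. \<exists>t\<in>homog R 0 - P. \<exists>r\<in>carrier R. t \<odot>\<^bsub>?F\<^esub> m = r \<odot>\<^bsub>?F\<^esub> f"
        "\<forall>t\<in>homog R 0 - P. t \<odot>\<^bsub>?F\<^esub> f \<noteq> \<zero>\<^bsub>?F\<^esub>"
        using rank_one_local_generator[OF LS rank P] by blast
      have "f 0 \<notin> P"
        using direct_summand_local_generator_coordinate[OF L P f] .
      then show ?thesis
        using f(1,2) unfolding I_def by blast
    qed
  qed
  then obtain e where "e \<in> L" "e \<in> homog ?F 0" "\<one> = e 0"
    unfolding I_def by blast
  then show ?thesis by auto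
qed

text \<open>At a prime P let f be a local generator. Comparing first coordinates in t e = r f shows
  f 0 outside P, and in t' w = r' f it gives r' f 0 = 0. Hence f 0 \<otimes> t' annihilates w and
  lies outside P, so the even annihilator of w contains \<one>.\<close>

lemma rank_one_summand_kernel:
  assumes LS: "submodule L R (free_module R 1 k)"
    and rank: "has_rank R (restrict_module (free_module R 1 k) L) 1 0"
    and e: "e \<in> L" "e 0 = \<one>"
    and w: "w \<in> L" "w 0 = \<zero>"
  shows "w = \<zero>\<^bsub>free_module R 1 k\<^esub>"
proof -
  let ?F = "free_module R 1 k"
  note LD = free_submoduleD[OF LS]
  have wF: "w \<in> carrier ?F" using w(1) LD(1) by blast
  define A where "A = {a \<in> homog R 0. a \<odot>\<^bsub>?F\<^esub> w = \<zero>\<^bsub>?F\<^esub>}"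
  interpret F: abelian_group ?F by (rule free_module_abelian_group)
  have "\<one> \<in> A"
  proof (rule even_ideal_eq_unit)
    show "A \<subseteq> homog R 0" by (auto simp: A_def)
    show "\<zero> \<in> A" using free_module_zero_smult[OF wF] by (simp add: A_def)
    show "a \<oplus> b \<in> A" if "a \<in> A" "b \<in> A" for a b
      using that free_module_smult_l_distr[OF homog_closed homog_closed wF, of a 0 b 0]
        F.l_zero[OF F.zero_closed] by (simp add: A_def)
    show "x \<otimes> a \<in> A" if "a \<in> A" "x \<in> homog R 0" for a x
      using that free_module_smult_assoc[OF homog_closed homog_closed wF, of x 0 a 0]
        free_module_smult_zero[OF homog_closed[OF that(2)]] by (simp add: A_def)
    show "\<not> A \<subseteq> P" if P: "primeideal P (even_part R)" for P
    proof -
      note PD = even_primeidealD[OF P]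
      obtain f where f: "f \<in> L" "f \<in> homog ?F 0"
        "\<forall>m\<in>L. \<exists>t\<in>homog R 0 - P. \<exists>r\<in>carrier R. t \<odot>\<^bsub>?F\<^esub> m = r \<odot>\<^bsub>?F\<^esub> f"
        "\<forall>t\<in>homog R 0 - P. t \<odot>\<^bsub>?F\<^esub> f \<noteq> \<zero>\<^bsub>?F\<^esub>"
        using rank_one_local_generator[OF LS rank P] by blast
      have fF: "f \<in> carrier ?F" using f(1) LD(1) by blast
      have f0: "f 0 \<in> homog R 0"
        using free_module_homog_nth[OF f(2), of 0] by (simp add: coord_parity_def)
      obtain t r where tr: "t \<in> homog R 0 - P" "r \<in> carrier R" "t \<odot>\<^bsub>?F\<^esub> e = r \<odot>\<^bsub>?F\<^esub> f"
        using bspec[OF f(3) e(1)] by blast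
      have t0: "t \<in> homog R 0" "t \<in> carrier R" using tr(1) homog_closed by blast+
      have trf: "t = r \<otimes> f 0"
        using fun_cong[OF tr(3), of 0] e(2) t0 by simp
      \<comment> \<open>The scalar r need not be even, but t and f 0 are; the even part alone
        already satisfies r0 \<otimes> f 0 = t, which is what the prime ideal of the even part can
        use.\<close>
      obtain r0 r1 where r: "r0 \<in> homog R 0" "r1 \<in> homog R 1" "r = r0 \<oplus> r1"
        using homog_split[OF tr(2)] by blast
      have "r0 \<otimes> f 0 \<oplus> r1 \<otimes> f 0 = t \<oplus> \<zero>"
        using trf t0 r f0 homog_closed[OF r(1)] homog_closed[OF r(2)] homog_closed[OF f0]
        by (simp add: l_distr)
      from homog_decomp_unique(1)[OF even_even_mult[OF r(1) f0] odd_even_mult[OF r(2) f0] t0(1) homog_zero this]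
      have "r0 \<otimes> f 0 = t" .
      then have f0P: "f 0 \<notin> P"
        using PD(6)[OF _ r(1), of "f 0"] tr(1) by auto
      obtain t' r' where tr': "t' \<in> homog R 0 - P" "r' \<in> carrier R" "t' \<odot>\<^bsub>?F\<^esub> w = r' \<odot>\<^bsub>?F\<^esub> f"
        using bspec[OF f(3) w(1)] by blast
      have t'0: "t' \<in> homog R 0" "t' \<in> carrier R" using tr'(1) homog_closed by blast+
      have r'f: "r' \<otimes> f 0 = \<zero>"
        using fun_cong[OF tr'(3), of 0] w(2) t'0 by simp
      have "(f 0 \<otimes> t') \<odot>\<^bsub>?F\<^esub> w = f 0 \<odot>\<^bsub>?F\<^esub> (r' \<odot>\<^bsub>?F\<^esub> f)"
        using free_module_smult_assoc[OF homog_closed[OF f0] t'0(2) wF] tr'(3) by simp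
      also have "\<dots> = (f 0 \<otimes> r') \<odot>\<^bsub>?F\<^esub> f"
        using free_module_smult_assoc[OF homog_closed[OF f0] tr'(2) fF] by simp
      also have "f 0 \<otimes> r' = \<zero>"
        using even_commute[OF f0 tr'(2)] r'f by simp
      also note free_module_zero_smult[OF fF]
      finally have "f 0 \<otimes> t' \<in> A"
        using even_even_mult[OF f0 t'0(1)] unfolding A_def by blast
      moreover have "f 0 \<otimes> t' \<notin> P"
        using PD(8)[OF f0 t'0(1)] f0P tr'(1) by blast
      ultimately show ?thesis by blast
    qed
  qed
  then show ?thesis
    using free_module_smult_one[OF wF] by (simp add: A_def)
qed

lemma rank_one_summand_is_line:
  assumes L: "direct_summand R (free_module R 1 k) L"
    and rank: "has_rank R (restrict_module (free_module R 1 k) L) 1 0"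
  shows "\<exists>s\<in>{..<k} \<rightarrow>\<^sub>E homog R 1. L = line R k s"
proof -
  let ?F = "free_module R 1 k"
  have LS: "submodule L R ?F"
    using L unfolding direct_summand_def graded_submodule_def by blast
  note LD = free_submoduleD[OF LS]
  obtain e where e: "e \<in> L" "e \<in> homog ?F 0" "e 0 = \<one>"
    using rank_one_summand_even_section[OF L rank] by blast
  have eF: "e \<in> carrier ?F" using e(1) LD(1) by blast
  define s where "s = (\<lambda>i\<in>{..<k}. e (Suc i))"
  have s: "s \<in> {..<k} \<rightarrow>\<^sub>E homog R 1"
  proof -
    have "e (Suc i) \<in> homog R 1" if "i < k" for i
      using free_module_homog_nth[OF e(2), of "Suc i"] that by (simp add: coord_parity_def)
    then show ?thesis by (auto simp: s_def)
  qed
  have e_eq: "line_generator R k s = e"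
  proof (rule free_module_ext[OF line_generator_closed[OF s] eF])
    fix i assume "i < 1 + k"
    then show "line_generator R k s i = e i"
      using e(3) by (cases i) (simp_all add: s_def)
  qed
  have "v \<in> line R k s" if v: "v \<in> L" for v
  proof -
    have vF: "v \<in> carrier ?F" using v LD(1) by blast
    have v0: "v 0 \<in> carrier R" using free_module_closed[OF vF, of 0] by simp
    \<comment> \<open>Subtracting the multiple of e with the same first coordinate leaves an element
      of L with first coordinate zero.\<close>
    let ?w = "v \<oplus>\<^bsub>?F\<^esub> (\<ominus> v 0) \<odot>\<^bsub>?F\<^esub> e"
    have "?w \<in> L"
      using LD(3)[OF v LD(4)[OF _ e(1)], of "\<ominus> v 0"] v0 by simp
    moreover have "?w 0 = \<zero>"
      using v0 e(3) by (simp add: r_neg)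
    ultimately have w: "?w = \<zero>\<^bsub>?F\<^esub>"
      by (rule rank_one_summand_kernel[OF LS rank e(1,3)])
    have "v = v 0 \<odot>\<^bsub>?F\<^esub> e"
    proof (rule free_module_ext[OF vF free_module_smult_closed[OF v0 eF]])
      fix i assume i: "i < 1 + k"
      note cl = free_module_closed[OF vF i] free_module_closed[OF eF i] v0
      have "v i \<oplus> \<ominus> (v 0 \<otimes> e i) = \<zero>"
        using fun_cong[OF w, of i] i cl by (simp add: l_minus)
      then have "v i = v 0 \<otimes> e i"
        using cl minus_equality[of "v i" "\<ominus> (v 0 \<otimes> e i)"] minus_minus[of "v 0 \<otimes> e i"] by simp
      then show "v i = (v 0 \<odot>\<^bsub>?F\<^esub> e) i"
        using i by simp
    qed
    then show ?thesis
      using v0 unfolding line_def e_eq by blast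
  qed
  moreover have "line R k s \<subseteq> L"
    using LD(4)[OF _ e(1)] by (auto simp: line_def e_eq)
  ultimately show ?thesis
    using s by blast
qed

text \<open>Injectivity rests on the normalization: a multiple of one generator that equals another
  has factor \<one>, as both have first coordinate \<one>.\<close>

lemma line_bij:
  "bij_betw (line R k) ({..<k} \<rightarrow>\<^sub>E homog R 1) (pts (super_projective_space 0 k) R)"
proof -
  have pts: "pts (super_projective_space 0 k) R = {L. direct_summand R (free_module R 1 k) L \<and>
      has_rank R (restrict_module (free_module R 1 k) L) 1 0}"
    by (simp add: super_projective_space_def)
  have "line R k ` ({..<k} \<rightarrow>\<^sub>E homog R 1) = pts (super_projective_space 0 k) R"
    unfolding pts using line_direct_summand line_rank rank_one_summand_is_line by blast
  moreover have "inj_on (line R k) ({..<k} \<rightarrow>\<^sub>E homog R 1)"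
  proof (rule inj_onI)
    fix s s' assume s: "s \<in> {..<k} \<rightarrow>\<^sub>E homog R 1" and s': "s' \<in> {..<k} \<rightarrow>\<^sub>E homog R 1"
      and eq: "line R k s = line R k s'"
    obtain r where r: "r \<in> carrier R" "line_generator R k s = r \<odot>\<^bsub>free_module R 1 k\<^esub> line_generator R k s'"
      using line_generator_in_line[OF s] unfolding eq by (auto simp: line_def)
    have r1: "r = \<one>"
      using fun_cong[OF r(2), of 0] r(1) by simp
    have gen: "line_generator R k s = line_generator R k s'"
      using r(2) unfolding r1 by (simp only: free_module_smult_one[OF line_generator_closed[OF s']])
    show "s = s'"
    proof (rule PiE_ext[OF s s'])
      fix i assume "i \<in> {..<k}"
      then show "s i = s' i"
        using fun_cong[OF gen, of "Suc i"] by simp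
    qed
  qed
  ultimately show ?thesis
    by (simp add: bij_betw_def)
qed

end

text \<open>Coordinatewise application of \<phi> sends generator to generator. The image of the line
  need not be closed under scalars of S, but it lies in the target line and contains its generator,
  so it spans that line.\<close>

lemma super_projective_space_map_line:
  assumes "supercommutative_ring R" "supercommutative_ring S" and phi: "\<phi> \<in> graded_ring_hom R S"
    and s: "s \<in> {..<k} \<rightarrow>\<^sub>E homog R 1"
  shows "pts_map (super_projective_space 0 k) R S \<phi> (line R k s) = line S k (\<lambda>i\<in>{..<k}. \<phi> (s i))"
proof -
  interpret R: supercommutative_ring R by fact
  interpret S: supercommutative_ring S by fact
  note phiD = graded_ring_homD[OF phi]
  let ?s = "\<lambda>i\<in>{..<k}. \<phi> (s i)" and ?\<Phi> = "\<lambda>v. \<lambda>i\<in>{..<1 + k}. \<phi> (v i)"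
  let ?F = "free_module R 1 k" and ?K = "free_module S 1 k"
  have s': "?s \<in> {..<k} \<rightarrow>\<^sub>E homog S 1"
    using PiE_mem[OF s] phiD(5) by auto
  have gen: "?\<Phi> (line_generator R k s) = line_generator S k ?s"
  proof
    fix i
    show "?\<Phi> (line_generator R k s) i = line_generator S k ?s i"
      by (cases i) (simp_all add: line_generator_def phiD(4))
  qed
  have smult: "?\<Phi> (r \<odot>\<^bsub>?F\<^esub> line_generator R k s) = \<phi> r \<odot>\<^bsub>?K\<^esub> line_generator S k ?s" if r: "r \<in> carrier R" for r
  proof
    fix i
    show "?\<Phi> (r \<odot>\<^bsub>?F\<^esub> line_generator R k s) i = (\<phi> r \<odot>\<^bsub>?K\<^esub> line_generator S k ?s) i"
    proof (cases "i < 1 + k")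
      case True
      then show ?thesis
        using fun_cong[OF gen, of i] phiD(2)[OF r R.free_module_closed[OF R.line_generator_closed[OF s] True]]
        by simp
    next
      case False
      then show ?thesis by (simp add: S.free_module_simps)
    qed
  qed
  have img: "?\<Phi> ` line R k s \<subseteq> line S k ?s"
    using smult phiD(1) by (auto simp: line_def)
  have mem: "line_generator S k ?s \<in> ?\<Phi> ` line R k s"
    using gen R.line_generator_in_line[OF s] by (metis image_eqI)
  have "supermodule_span S ?K (?\<Phi> ` line R k s) = line S k ?s"
  proof
    show "supermodule_span S ?K (?\<Phi> ` line R k s) \<subseteq> line S k ?s"
      unfolding supermodule_span_def using S.line_submodule[OF s'] img by blast
    show "line S k ?s \<subseteq> supermodule_span S ?K (?\<Phi> ` line R k s)"
      unfolding supermodule_span_def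
    proof (intro Inter_greatest)
      fix N assume "N \<in> {N. submodule N S ?K \<and> ?\<Phi> ` line R k s \<subseteq> N}"
      then have "submodule N S ?K" "line_generator S k ?s \<in> N"
        using mem by blast+
      then show "line S k ?s \<subseteq> N"
        using S.free_submoduleD(4)[of N 1 k] unfolding line_def by blast
    qed
  qed
  then show ?thesis
    by (simp add: super_projective_space_def)
qed

section \<open>Natural isomorphisms\<close>

text \<open>The affine superspace of dimension 0|k, which serves as the middle term: its functor
  laws are immediate, and both isomorphisms start from it.\<close>

definition odd_space :: "nat \<Rightarrow> ('a, nat \<Rightarrow> 'a) point_functor" where
  "odd_space k = \<lparr>pts = (\<lambda>R. {..<k} \<rightarrow>\<^sub>E homog R 1), pts_map = (\<lambda>R S \<phi> s. \<lambda>i\<in>{..<k}. \<phi> (s i))\<rparr>"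

lemma point_functor_odd_space: "point_functor (odd_space k)"
proof
  fix R S T :: "'a superalgebra" and \<phi> \<psi> s
  show "pts_map (odd_space k) R R (\<lambda>a. a) s = s" if "s \<in> pts (odd_space k) R"
    using that by (auto simp: odd_space_def PiE_iff extensional_restrict)
  assume "\<phi> \<in> superalgebra_hom R S" "s \<in> pts (odd_space k) R"
  then show "pts_map (odd_space k) R S \<phi> s \<in> pts (odd_space k) S"
    using PiE_mem[of s "{..<k}" "\<lambda>_. homog R 1"] graded_ring_homD(5)[OF superalgebra_hom_graded, of \<phi> R S _ 1]
    by (auto simp: odd_space_def)
  show "pts_map (odd_space k) R T (\<psi> \<circ> \<phi>) s = pts_map (odd_space k) S T \<psi> (pts_map (odd_space k) R S \<phi> s)"
    by (auto simp: odd_space_def)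
qed

lemma superalgebra_hom_id: "(\<lambda>a. a) \<in> superalgebra_hom R R"
  by (auto simp: superalgebra_hom_def ring_hom_def)

lemma superalgebra_hom_comp:
  assumes "\<phi> \<in> superalgebra_hom R S" "\<psi> \<in> superalgebra_hom S T"
  shows "\<psi> \<circ> \<phi> \<in> superalgebra_hom R T"
proof -
  have "\<psi> \<circ> \<phi> \<in> ring_hom R T"
    using ring_hom_trans[of \<phi> R S \<psi> T] assms by (simp add: superalgebra_hom_def)
  moreover have "\<phi> x \<in> carrier S" if "x \<in> carrier R" for x
    using assms(1) that by (auto simp: superalgebra_hom_def ring_hom_def)
  moreover have "(\<psi> \<circ> \<phi>) ` homog R i \<subseteq> homog T i" for i
    using assms unfolding superalgebra_hom_def image_comp[symmetric] by blast
  ultimately show ?thesis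
    using assms by (simp add: superalgebra_hom_def)
qed

text \<open>A natural bijection transports functoriality, so only one of the two sides has to be checked
  to be a functor.\<close>

lemma naturally_isomorphicI:
  assumes F: "point_functor F"
    and bij: "\<And>R. superalgebra R \<Longrightarrow> bij_betw (\<eta> R) (pts F R) (pts F' R)"
    and nat: "\<And>R S \<phi> x. superalgebra R \<Longrightarrow> superalgebra S \<Longrightarrow> \<phi> \<in> superalgebra_hom R S \<Longrightarrow> x \<in> pts F R \<Longrightarrow>
      \<eta> S (pts_map F R S \<phi> x) = pts_map F' R S \<phi> (\<eta> R x)"
  shows "F \<cong>\<^sub>F F'"
proof -
  interpret F: point_functor F by fact
  have preimage: "\<exists>x\<in>pts F R. y = \<eta> R x" if "superalgebra R" "y \<in> pts F' R" for R y
    using bij[OF that(1)] that(2) by (auto simp: bij_betw_def)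
  have mem: "\<eta> R x \<in> pts F' R" if "superalgebra R" "x \<in> pts F R" for R x
    using bij[OF that(1)] that(2) by (auto simp: bij_betw_def)
  have "point_functor F'"
  proof
    fix R S T :: "'a superalgebra" and \<phi> \<psi> y
    assume R: "superalgebra R" and y: "y \<in> pts F' R"
    obtain x where x: "x \<in> pts F R" "y = \<eta> R x"
      using preimage[OF R y] by blast
    show "pts_map F' R R (\<lambda>a. a) y = y"
      using nat[OF R R superalgebra_hom_id x(1)] F.map_id[OF R x(1)] x(2) by simp
    assume S: "superalgebra S" and phi: "\<phi> \<in> superalgebra_hom R S"
    note 1 = F.map_closed[OF R S phi x(1)] and 2 = nat[OF R S phi x(1), folded x(2)]
    show "pts_map F' R S \<phi> y \<in> pts F' S"
      using mem[OF S 1] 2 by simp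
    assume T: "superalgebra T" and psi: "\<psi> \<in> superalgebra_hom S T"
    show "pts_map F' R T (\<psi> \<circ> \<phi>) y = pts_map F' S T \<psi> (pts_map F' R S \<phi> y)"
      using nat[OF R T superalgebra_hom_comp[OF phi psi] x(1)] nat[OF S T psi 1]
        F.map_comp[OF R S T phi psi x(1)] x(2) 2 by simp
  qed
  then show ?thesis
    using F bij nat unfolding naturally_isomorphic_def by blast
qed

lemma naturally_isomorphic_sym:
  assumes "F \<cong>\<^sub>F F'"
  shows "F' \<cong>\<^sub>F F"
proof -
  obtain \<eta> where F: "point_functor F" "point_functor F'"
    and bij: "\<And>R. superalgebra R \<Longrightarrow> bij_betw (\<eta> R) (pts F R) (pts F' R)"
    and nat: "\<And>R S \<phi> x. superalgebra R \<Longrightarrow> superalgebra S \<Longrightarrow> \<phi> \<in> superalgebra_hom R S \<Longrightarrow> x \<in> pts F R \<Longrightarrow>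
      \<eta> S (pts_map F R S \<phi> x) = pts_map F' R S \<phi> (\<eta> R x)"
    using assms unfolding naturally_isomorphic_def by blast
  interpret F: point_functor F by (rule F)
  show ?thesis
  proof (rule naturally_isomorphicI[OF F(2)])
    show "bij_betw (inv_into (pts F R) (\<eta> R)) (pts F' R) (pts F R)" if "superalgebra R" for R
      by (rule bij_betw_inv_into[OF bij[OF that]])
    fix R S :: "'a superalgebra" and \<phi> y
    assume R: "superalgebra R" and S: "superalgebra S" and phi: "\<phi> \<in> superalgebra_hom R S" and y: "y \<in> pts F' R"
    obtain x where x: "x \<in> pts F R" "y = \<eta> R x"
      using bij[OF R] y by (auto simp: bij_betw_def)
    show "inv_into (pts F S) (\<eta> S) (pts_map F' R S \<phi> y) = pts_map F R S \<phi> (inv_into (pts F R) (\<eta> R) y)"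
      using nat[OF R S phi x(1)] bij_betw_inv_into_left[OF bij[OF S] F.map_closed[OF R S phi x(1)]]
        bij_betw_inv_into_left[OF bij[OF R] x(1)] x(2) by simp
  qed
qed

lemma naturally_isomorphic_trans:
  assumes "F \<cong>\<^sub>F F'" "F' \<cong>\<^sub>F F''"
  shows "F \<cong>\<^sub>F F''"
proof -
  obtain \<eta> where F: "point_functor F"
    and bij: "\<And>R. superalgebra R \<Longrightarrow> bij_betw (\<eta> R) (pts F R) (pts F' R)"
    and nat: "\<And>R S \<phi> x. superalgebra R \<Longrightarrow> superalgebra S \<Longrightarrow> \<phi> \<in> superalgebra_hom R S \<Longrightarrow> x \<in> pts F R \<Longrightarrow>
      \<eta> S (pts_map F R S \<phi> x) = pts_map F' R S \<phi> (\<eta> R x)"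
    using assms(1) unfolding naturally_isomorphic_def by blast
  obtain \<theta> where
      bij': "\<And>R. superalgebra R \<Longrightarrow> bij_betw (\<theta> R) (pts F' R) (pts F'' R)"
    and nat': "\<And>R S \<phi> x. superalgebra R \<Longrightarrow> superalgebra S \<Longrightarrow> \<phi> \<in> superalgebra_hom R S \<Longrightarrow> x \<in> pts F' R \<Longrightarrow>
      \<theta> S (pts_map F' R S \<phi> x) = pts_map F'' R S \<phi> (\<theta> R x)"
    using assms(2) unfolding naturally_isomorphic_def by blast
  show ?thesis
  proof (rule naturally_isomorphicI[OF F])
    show "bij_betw (\<theta> R \<circ> \<eta> R) (pts F R) (pts F'' R)" if "superalgebra R" for R
      by (rule bij_betw_trans[OF bij[OF that] bij'[OF that]])
    fix R S :: "'a superalgebra" and \<phi> x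
    assume R: "superalgebra R" and S: "superalgebra S" and phi: "\<phi> \<in> superalgebra_hom R S" and x: "x \<in> pts F R"
    have "\<eta> R x \<in> pts F' R"
      using bij[OF R] x by (auto simp: bij_betw_def)
    then show "(\<theta> S \<circ> \<eta> S) (pts_map F R S \<phi> x) = pts_map F'' R S \<phi> ((\<theta> R \<circ> \<eta> R) x)"
      using nat[OF R S phi x] nat'[OF R S phi] by simp
  qed
qed

lemma odd_space_Schubert: "odd_space k \<cong>\<^sub>F Schubert (int k, 0)"
proof (rule naturally_isomorphicI[OF point_functor_odd_space])
  fix R :: "'a superalgebra" assume "superalgebra R"
  then show "bij_betw (\<lambda>s. Schubert_representative R k s <#\<^bsub>GL11 (laurent R)\<^esub> carrier (GL11 (powser R)))
      (pts (odd_space k) R) (pts (Schubert (int k, 0)) R)"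
    using supercommutative_ring.Schubert_representative_bij[OF superalgebra_imp_supercommutative_ring]
    by (simp add: odd_space_def)
qed (simp add: odd_space_def Schubert_map_representative superalgebra_imp_supercommutative_ring superalgebra_hom_graded)

lemma odd_space_super_projective_space: "odd_space k \<cong>\<^sub>F super_projective_space 0 k"
proof (rule naturally_isomorphicI[OF point_functor_odd_space])
  fix R :: "'a superalgebra" assume "superalgebra R"
  then show "bij_betw (line R k) (pts (odd_space k) R) (pts (super_projective_space 0 k) R)"
    using supercommutative_ring.line_bij[OF superalgebra_imp_supercommutative_ring]
    by (simp add: odd_space_def)
qed (simp add: odd_space_def super_projective_space_map_line superalgebra_imp_supercommutative_ring superalgebra_hom_graded)

text \<open>Functoriality is assumed on one side only: for (k|0) it comes from the comparison with
  \<open>odd_space\<close>, and the exchange carries it to (0|k).\<close>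

lemma Schubert_swap:
  assumes "point_functor (Schubert (a, b) :: ('a, (int \<Rightarrow> 'a) supermatrix set) point_functor)"
  shows "(Schubert (a, b) :: ('a, (int \<Rightarrow> 'a) supermatrix set) point_functor) \<cong>\<^sub>F Schubert (b, a)"
proof (rule naturally_isomorphicI[OF assms])
  fix R :: "'a superalgebra" assume "superalgebra R"
  then show "bij_betw (image swap_supermatrix) (pts (Schubert (a, b)) R) (pts (Schubert (b, a)) R)"
    by (rule supercommutative_ring.swap_Schubert_bij[OF superalgebra_imp_supercommutative_ring])
qed (simp_all add: Schubert_map_swap superalgebra_imp_supercommutative_ring superalgebra_hom_graded)

theorem theorem2:
  fixes k :: nat
  assumes "k > 0"
  shows "(Schubert (0, int k) :: ('a, (int \<Rightarrow> 'a) supermatrix set) point_functor)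
           \<cong>\<^sub>F (Schubert (int k, 0) :: ('a, (int \<Rightarrow> 'a) supermatrix set) point_functor)
       \<and> (Schubert (int k, 0) :: ('a, (int \<Rightarrow> 'a) supermatrix set) point_functor)
           \<cong>\<^sub>F (super_projective_space 0 k :: ('a, (nat \<Rightarrow> 'a) set) point_functor)"
proof
  have "point_functor (Schubert (int k, 0) :: ('a, (int \<Rightarrow> 'a) supermatrix set) point_functor)"
    using odd_space_Schubert unfolding naturally_isomorphic_def by blast
  then show "(Schubert (0, int k) :: ('a, (int \<Rightarrow> 'a) supermatrix set) point_functor) \<cong>\<^sub>F Schubert (int k, 0)"
    by (rule naturally_isomorphic_sym[OF Schubert_swap])
  show "(Schubert (int k, 0) :: ('a, (int \<Rightarrow> 'a) supermatrix set) point_functor) \<cong>\<^sub>F super_projective_space 0 k"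
    by (rule naturally_isomorphic_trans[OF naturally_isomorphic_sym[OF odd_space_Schubert] odd_space_super_projective_space])
qed

end
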